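(* Let $(\Gamma,\mu)$ be an infinite, connected, locally finite weighted graph satisfying (COUNT), (VD), (HOM) and (P0), and suppose that its heat kernel $p_n$ satisfies the sub-Gaussian bounds (UE) and (LE) with escape time exponent $\gamma>1$ (all conditions are spelled out in the context). Let $\phi:[0,\infty)\to[1,\infty)$ be a continuous regularly varying function of positive index, and let $K$ be a Markov operator on $\Gamma$, symmetric with respect to $\mu$, satisfying $(J_\phi)$. Let $\zeta:[0,\infty)\to[1,\infty)$ be a continuous non-decreasing function which is an asymptotic inverse of $$t\mapsto \frac{t^\gamma}{\int_0^t \frac{s^{\gamma-1}\,ds}{\phi(s)}}.$$ Then there exists a constant $C>0$ such that $$\frac{C^{-1}}{V(\zeta(n))}\le \psi_K(n)\le \frac{C}{V(\zeta(n))}\qquad\text{for all } n\in\mathbb{N}=\{0,1,2,\dots\}.$$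
   Context: Weighted graph: $\Gamma$ is the vertex set of an infinite, connected, locally finite graph, with a symmetric non-negative weight $\mu_{xy}$ on $\Gamma\times\Gamma$ such that $\mu_{xy}>0$ iff $x\sim y$ ($x,y$ are neighbors). Put $\mu(x)=\sum_{y\sim x}\mu_{xy}$ and $\mu(A)=\sum_{x\in A}\mu(x)$. Let $d$ be the graph distance, $B(x,r)=\{y: d(x,y)\le r\}$ and $V_\mu(x,r)=\mu(B(x,r))$. (COUNT): there is $C_\mu\ge 1$ with $C_\mu^{-1}\le\mu(x)\le C_\mu$ for all $x\in\Gamma$. (VD) and (HOM): there are a strictly increasing continuous function $V:[0,\infty)\to(0,\infty)$ and constants $C_D,C_h>1$ such that $V(2r)\le C_D V(r)$ for all $r>0$ (VD), and $C_h^{-1}V(r)\le V_\mu(x,r)\le C_hV(r)$ for all $x\in\Gamma$, $r>0$ (HOM). This $V$ is fixed. Natural random walk: $P(x,y)=\mu_{xy}/\mu(x)$, with $n$-step transition probabilities $P_n(x,y)$ and heat kernel $p_n(x,y)=P_n(x,y)/\mu(y)$. (P0): there is $p_0>0$ such that $P(x,y)\ge p_0$ whenever $x\sim y$. (UE), (LE) with exponent $\gamma>1$: there are constants $c,C>0$ such that for all $x,y\in\Gamma$, $$p_n(x,y)\le\frac{C}{V(n^{1/\gamma})}\exp\Big[-\Big(\frac{d(x,y)^\gamma}{Cn}\Big)^{\frac1{\gamma-1}}\Big]\quad\forall n\ge1,\tag{UE}$$ $$(p_n+p_{n+1})(x,y)\ge\frac{c}{V(n^{1/\gamma})}\exp\Big[-\Big(\frac{d(x,y)^\gamma}{cn}\Big)^{\frac1{\gamma-1}}\Big]\quad\forall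 n\ge1\vee d(x,y).\tag{LE}$$ Regular variation: a positive measurable function $f$ is regularly varying of index $\beta$ if $\lim_{t\to\infty}f(\lambda t)/f(t)=\lambda^\beta$ for every $\lambda>0$. A function $g$ is an asymptotic inverse of $f$ if $f(g(t))\sim t$ and $g(f(t))\sim t$ as $t\to\infty$. $(J_\phi)$: $K$ is a Markov operator $Kf(x)=\sum_y k(x,y)f(y)\mu(y)$ with symmetric kernel $k(x,y)=k(y,x)\ge0$, $\sum_y k(x,y)\mu(y)=1$, and there is a constant $C_\phi>0$ with $$\frac{C_\phi^{-1}}{V(d(x,y))\phi(d(x,y))}\le k(x,y)\le\frac{C_\phi}{V(d(x,y))\phi(d(x,y))}\quad\forall x,y\in\Gamma.$$ $k_n(x,y)$ denotes the kernel of $K^n$ with respect to $\mu$, i.e. $K^nf(x)=\sum_y k_n(x,y)f(y)\mu(y)$. $\psi_K(n):=\sup_{x\in\Gamma}k_{2n}(x,x)=\sup_{x,y\in\Gamma}k_{2n}(x,y)=\|K^{2n}\|_{1\to\infty}=\|K^n\|_{1\to2}^2$ (norms between the spaces $\ell^p(\Gamma,\mu)$). *)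

theory Defs
  imports "HOL-Analysis.Analysis" "HOL-Library.Landau_Symbols"
begin

section \<open>Weighted graphs\<close>

text \<open>The vertex set is the universe of the type \<open>'a\<close>. Loops are permitted: the weight lives on all
  pairs of vertices, and adjacency is exactly positivity of the weight. Symmetry of the adjacency
  relation follows from that of the weight.\<close>

definition weighted_graph :: "('a \<Rightarrow> 'a \<Rightarrow> bool) \<Rightarrow> ('a \<Rightarrow> 'a \<Rightarrow> real) \<Rightarrow> bool" where
  "weighted_graph adj \<mu> \<longleftrightarrow>
     infinite (UNIV :: 'a set) \<and>
     (\<forall>x y. adj\<^sup>*\<^sup>* x y) \<and>
     (\<forall>x. finite {y. adj x y}) \<and>
     (\<forall>x y. \<mu> x y = \<mu> y x) \<and>
     (\<forall>x y. \<mu> x y \<ge> 0) \<and>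
     (\<forall>x y. \<mu> x y > 0 \<longleftrightarrow> adj x y)"

definition vmass :: "('a \<Rightarrow> 'a \<Rightarrow> bool) \<Rightarrow> ('a \<Rightarrow> 'a \<Rightarrow> real) \<Rightarrow> 'a \<Rightarrow> real" where
  "vmass adj \<mu> x = (\<Sum>y | adj x y. \<mu> x y)"

definition gdist :: "('a \<Rightarrow> 'a \<Rightarrow> bool) \<Rightarrow> 'a \<Rightarrow> 'a \<Rightarrow> nat" where
  "gdist adj x y = (LEAST n. (adj ^^ n) x y)"

definition gball :: "('a \<Rightarrow> 'a \<Rightarrow> bool) \<Rightarrow> 'a \<Rightarrow> real \<Rightarrow> 'a set" where
  "gball adj x r = {y. real (gdist adj x y) \<le> r}"

text \<open>Balls are finite in a connected, locally finite graph, so the finite sum is the measure of the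
  ball.\<close>

definition volume :: "('a \<Rightarrow> 'a \<Rightarrow> bool) \<Rightarrow> ('a \<Rightarrow> 'a \<Rightarrow> real) \<Rightarrow> 'a \<Rightarrow> real \<Rightarrow> real" where
  "volume adj \<mu> x r = (\<Sum>y\<in>gball adj x r. vmass adj \<mu> y)"

definition COUNT :: "('a \<Rightarrow> 'a \<Rightarrow> bool) \<Rightarrow> ('a \<Rightarrow> 'a \<Rightarrow> real) \<Rightarrow> bool" where
  "COUNT adj \<mu> \<longleftrightarrow> (\<exists>C\<ge>1. \<forall>x. 1 / C \<le> vmass adj \<mu> x \<and> vmass adj \<mu> x \<le> C)"

definition VD :: "(real \<Rightarrow> real) \<Rightarrow> bool" where
  "VD V \<longleftrightarrow> (\<exists>C>1. \<forall>r>0. V (2 * r) \<le> C * V r)"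

definition HOM :: "('a \<Rightarrow> 'a \<Rightarrow> bool) \<Rightarrow> ('a \<Rightarrow> 'a \<Rightarrow> real) \<Rightarrow> (real \<Rightarrow> real) \<Rightarrow> bool" where
  "HOM adj \<mu> V \<longleftrightarrow>
     (\<exists>C>1. \<forall>x. \<forall>r>0. V r / C \<le> volume adj \<mu> x r \<and> volume adj \<mu> x r \<le> C * V r)"


section \<open>The natural random walk and its heat kernel\<close>

definition step_prob :: "('a \<Rightarrow> 'a \<Rightarrow> bool) \<Rightarrow> ('a \<Rightarrow> 'a \<Rightarrow> real) \<Rightarrow> 'a \<Rightarrow> 'a \<Rightarrow> real" where
  "step_prob adj \<mu> x y = \<mu> x y / vmass adj \<mu> x"

fun trans_prob :: "('a \<Rightarrow> 'a \<Rightarrow> bool) \<Rightarrow> ('a \<Rightarrow> 'a \<Rightarrow> real) \<Rightarrow> nat \<Rightarrow> 'a \<Rightarrow> 'a \<Rightarrow> real" where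
  "trans_prob adj \<mu> 0 x y = (if x = y then 1 else 0)"
| "trans_prob adj \<mu> (Suc n) x y =
     (\<Sum>z | adj x z. step_prob adj \<mu> x z * trans_prob adj \<mu> n z y)"

definition heat_kernel :: "('a \<Rightarrow> 'a \<Rightarrow> bool) \<Rightarrow> ('a \<Rightarrow> 'a \<Rightarrow> real) \<Rightarrow> nat \<Rightarrow> 'a \<Rightarrow> 'a \<Rightarrow> real" where
  "heat_kernel adj \<mu> n x y = trans_prob adj \<mu> n x y / vmass adj \<mu> y"

definition P0 :: "('a \<Rightarrow> 'a \<Rightarrow> bool) \<Rightarrow> ('a \<Rightarrow> 'a \<Rightarrow> real) \<Rightarrow> bool" where
  "P0 adj \<mu> \<longleftrightarrow> (\<exists>p\<^sub>0>0. \<forall>x y. adj x y \<longrightarrow> step_prob adj \<mu> x y \<ge> p\<^sub>0)"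

definition UE :: "('a \<Rightarrow> 'a \<Rightarrow> bool) \<Rightarrow> ('a \<Rightarrow> 'a \<Rightarrow> real) \<Rightarrow> (real \<Rightarrow> real) \<Rightarrow> real \<Rightarrow> bool" where
  "UE adj \<mu> V \<gamma> \<longleftrightarrow>
     (\<exists>C>0. \<forall>x y. \<forall>n\<ge>1.
        heat_kernel adj \<mu> n x y
          \<le> C / V (real n powr (1 / \<gamma>))
             * exp (- ((real (gdist adj x y) powr \<gamma> / (C * real n)) powr (1 / (\<gamma> - 1)))))"

definition LE :: "('a \<Rightarrow> 'a \<Rightarrow> bool) \<Rightarrow> ('a \<Rightarrow> 'a \<Rightarrow> real) \<Rightarrow> (real \<Rightarrow> real) \<Rightarrow> real \<Rightarrow> bool" where
  "LE adj \<mu> V \<gamma> \<longleftrightarrow>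
     (\<exists>c>0. \<forall>x y. \<forall>n \<ge> max 1 (gdist adj x y).
        heat_kernel adj \<mu> n x y + heat_kernel adj \<mu> (Suc n) x y
          \<ge> c / V (real n powr (1 / \<gamma>))
             * exp (- ((real (gdist adj x y) powr \<gamma> / (c * real n)) powr (1 / (\<gamma> - 1)))))"


section \<open>Regular variation\<close>

text \<open>Functions on the half-line \<open>[0,\<infinity>)\<close> are represented by functions on the reals whose values at
  negative arguments play no role.\<close>

definition regularly_varying :: "(real \<Rightarrow> real) \<Rightarrow> real \<Rightarrow> bool" where
  "regularly_varying f \<beta> \<longleftrightarrow>
     (\<forall>t\<ge>0. f t > 0) \<and>
     f \<in> borel_measurable (restrict_space borel {0..}) \<and>
     (\<forall>a>0. ((\<lambda>t. f (a * t) / f t) \<longlongrightarrow> a powr \<beta>) at_top)"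

definition asymptotic_inverse :: "(real \<Rightarrow> real) \<Rightarrow> (real \<Rightarrow> real) \<Rightarrow> bool" where
  "asymptotic_inverse g f \<longleftrightarrow>
     (\<lambda>t. f (g t)) \<sim>[at_top] (\<lambda>t. t) \<and> (\<lambda>t. g (f t)) \<sim>[at_top] (\<lambda>t. t)"


section \<open>Markov operators with a kernel\<close>

definition markov_kernel :: "('a \<Rightarrow> real) \<Rightarrow> ('a \<Rightarrow> 'a \<Rightarrow> real) \<Rightarrow> bool" where
  "markov_kernel m k \<longleftrightarrow>
     (\<forall>x y. k x y \<ge> 0) \<and> (\<forall>x y. k x y = k y x) \<and> (\<forall>x. ((\<lambda>y. k x y * m y) has_sum 1) UNIV)"

definition kernel_op :: "('a \<Rightarrow> real) \<Rightarrow> ('a \<Rightarrow> 'a \<Rightarrow> real) \<Rightarrow> ('a \<Rightarrow> real) \<Rightarrow> 'a \<Rightarrow> real" where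
  "kernel_op m k f x = (\<Sum>\<^sub>\<infinity>y. k x y * f y * m y)"

text \<open>The kernel of the \<open>n\<close>-th power of the operator with respect to the measure \<open>m\<close>, read off from
  the action on the indicator functions of points. The lemma \<open>kernel_op_power\<close> below shows that it
  represents that power on bounded functions.\<close>

definition kernel_power :: "('a \<Rightarrow> real) \<Rightarrow> ('a \<Rightarrow> 'a \<Rightarrow> real) \<Rightarrow> nat \<Rightarrow> 'a \<Rightarrow> 'a \<Rightarrow> real" where
  "kernel_power m k n x y = (kernel_op m k ^^ n) (indicator {y}) x / m y"

definition J :: "('a \<Rightarrow> 'a \<Rightarrow> bool) \<Rightarrow> (real \<Rightarrow> real) \<Rightarrow> (real \<Rightarrow> real) \<Rightarrow> ('a \<Rightarrow> 'a \<Rightarrow> real) \<Rightarrow> bool" where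
  "J adj V \<phi> k \<longleftrightarrow>
     (\<exists>C>0. \<forall>x y.
        (1 / C) / (V (real (gdist adj x y)) * \<phi> (real (gdist adj x y))) \<le> k x y \<and>
        k x y \<le> C / (V (real (gdist adj x y)) * \<phi> (real (gdist adj x y))))"

text \<open>The supremum is taken in the reals; it is a genuine one by \<open>bdd_above_kernel_power\<close> below.\<close>

definition \<psi> :: "('a \<Rightarrow> real) \<Rightarrow> ('a \<Rightarrow> 'a \<Rightarrow> real) \<Rightarrow> nat \<Rightarrow> real" where
  "\<psi> m k n = (SUP x. kernel_power m k (2 * n) x x)"

lemma kernel_op_summable:
  fixes f :: "'a \<Rightarrow> real"
  assumes k: "markov_kernel m k" and m: "\<And>x. m x > 0" and f: "\<And>y. \<bar>f y\<bar> \<le> B"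
  shows "(\<lambda>y. k x y * f y * m y) summable_on UNIV"
proof -
  have s: "(\<lambda>y. k x y * m y) summable_on UNIV"
    using k unfolding markov_kernel_def by (blast intro: has_sum_imp_summable)
  have "(\<lambda>y. B * (k x y * m y)) summable_on UNIV"
    by (rule summable_on_cmult_right[OF s])
  moreover have "\<bar>k x y * f y * m y\<bar> \<le> B * (k x y * m y)" for y
  proof -
    have "0 \<le> k x y * m y"
      using k m[of y] by (auto simp: markov_kernel_def)
    then have "\<bar>f y\<bar> * (k x y * m y) \<le> B * (k x y * m y)"
      by (rule mult_right_mono[OF f])
    moreover have "\<bar>k x y * f y * m y\<bar> = \<bar>f y\<bar> * (k x y * m y)"
      using k m[of y] by (auto simp: markov_kernel_def abs_mult)
    ultimately show ?thesis by simp
  qed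
  ultimately have "(\<lambda>y. norm (k x y * f y * m y)) summable_on UNIV"
    by (intro Infinite_Sum.abs_summable_on_comparison_test'[where g="\<lambda>y. B * (k x y * m y)"]) auto
  then show ?thesis by (rule abs_summable_summable)
qed

lemma kernel_op_mono:
  fixes f g :: "'a \<Rightarrow> real"
  assumes k: "markov_kernel m k" and m: "\<And>x. m x > 0"
    and f: "\<And>y. \<bar>f y\<bar> \<le> B" and g: "\<And>y. \<bar>g y\<bar> \<le> B'" and "\<And>y. f y \<le> g y"
  shows "kernel_op m k f x \<le> kernel_op m k g x"
  unfolding kernel_op_def
proof (intro infsum_mono kernel_op_summable[OF k m f] kernel_op_summable[OF k m g])
  fix y
  have "0 \<le> k x y * m y"
    using k m[of y] by (auto simp: markov_kernel_def)
  from mult_right_mono[OF assms(5)[of y] this]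
  show "k x y * f y * m y \<le> k x y * g y * m y" by (simp add: ac_simps)
qed

lemma kernel_op_const:
  assumes "markov_kernel m k"
  shows "kernel_op m k (\<lambda>_. c) x = c"
proof -
  have "((\<lambda>y. c * (k x y * m y)) has_sum (c * 1)) UNIV"
    using assms by (intro has_sum_cmult_right) (auto simp: markov_kernel_def)
  then show ?thesis
    unfolding kernel_op_def by (simp add: infsumI ac_simps)
qed

lemma kernel_op_funpow_indicator_bounds:
  assumes k: "markov_kernel m k" and m: "\<And>x. m x > 0"
  shows "0 \<le> (kernel_op m k ^^ n) (indicator {y}) x \<and> (kernel_op m k ^^ n) (indicator {y}) x \<le> 1"
proof (induction n arbitrary: x)
  case 0
  show ?case by (auto simp: indicator_def)
next
  case (Suc n)
  let ?f = "(kernel_op m k ^^ n) (indicator {y})"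
  have f: "\<bar>?f z\<bar> \<le> 1" for z using Suc[of z] by auto
  have "kernel_op m k (\<lambda>_. 0) x \<le> kernel_op m k ?f x"
    using Suc by (intro kernel_op_mono[OF k m _ f, where B=0]) auto
  moreover have "kernel_op m k ?f x \<le> kernel_op m k (\<lambda>_. 1) x"
    using Suc by (intro kernel_op_mono[OF k m f, where B'=1]) auto
  ultimately show ?case by (simp add: kernel_op_const[OF k])
qed

lemma bdd_above_kernel_power:
  assumes k: "markov_kernel m k" and c: "c > 0" "\<And>x. m x \<ge> c"
  shows "bdd_above (range (\<lambda>x. kernel_power m k n x x))"
proof (rule bdd_aboveI2)
  fix x
  have m: "\<And>x. m x > 0" using c(1) c(2) less_le_trans by blast
  show "kernel_power m k n x x \<le> 1 / c"
    unfolding kernel_power_def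
    using kernel_op_funpow_indicator_bounds[OF k m, of n x x] c(1) c(2)[of x]
    by (intro frac_le) auto
qed

lemma kernel_op_power:
  fixes f :: "'a \<Rightarrow> real"
  assumes k: "markov_kernel m k" and m: "\<And>x. m x > 0" and f: "\<And>y. \<bar>f y\<bar> \<le> B"
  shows "((\<lambda>y. kernel_power m k n x y * f y * m y) has_sum (kernel_op m k ^^ n) f x) UNIV"
proof -
  define Q where "Q n z y = (kernel_op m k ^^ n) (indicator {y}) z" for n z y
  have Qb: "0 \<le> Q n z y" "Q n z y \<le> 1" for n z y
    using kernel_op_funpow_indicator_bounds[OF k m, of n y z] by (auto simp: Q_def)
  have QS: "Q (Suc n) z y = (\<Sum>\<^sub>\<infinity>w. k z w * m w * Q n w y)" for n z y
    by (simp add: Q_def kernel_op_def ac_simps)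
  have kx: "0 \<le> k z w * m w" for z w
    using k m[of w] by (auto simp: markov_kernel_def)
  have km: "(\<lambda>w. k z w * m w) summable_on UNIV" for z
    using k unfolding markov_kernel_def by (blast intro: has_sum_imp_summable)
  have main: "((\<lambda>y. Q n z y) has_sum 1) UNIV \<and>
      ((\<lambda>y. Q n z y * f y) has_sum (kernel_op m k ^^ n) f z) UNIV \<and>
      \<bar>(kernel_op m k ^^ n) f z\<bar> \<le> B" for n z
  proof (induction n arbitrary: z)
    case 0
    have "((\<lambda>y. Q 0 z y * g y) has_sum g z) UNIV" for g :: "'a \<Rightarrow> real"
    proof -
      have "((\<lambda>y. Q 0 z y * g y) has_sum (\<Sum>y\<in>{z}. Q 0 z y * g y)) {z}"
        by (rule has_sum_finite) auto
      then have "((\<lambda>y. Q 0 z y * g y) has_sum g z) {z}" by (simp add: Q_def)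
      then show ?thesis
        by (rule has_sum_cong_neutral[THEN iffD1, rotated -1]) (auto simp: Q_def indicator_def)
    qed
    from this[of "\<lambda>_. 1"] this[of f] show ?case using f by simp
  next
    case (Suc n)
    let ?F = "(kernel_op m k ^^ n) f"
    let ?a = "\<lambda>w. k z w * m w"
    have swap: "((\<lambda>y. Q (Suc n) z y * g y) has_sum (\<Sum>\<^sub>\<infinity>w. ?a w * G w)) UNIV"
      if g: "\<And>y. \<bar>g y\<bar> \<le> D" and G: "\<And>w. ((\<lambda>y. Q n w y * g y) has_sum G w) UNIV"
      for g G :: "'a \<Rightarrow> real" and D
    proof -
      have D: "0 \<le> D" using g[of undefined] by linarith
      have sQ: "(\<lambda>y. ?a w * Q n w y) summable_on UNIV" for w
        using Suc[of w] by (intro summable_on_cmult_right) (auto simp: summable_on_def)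
      have iQ: "(\<Sum>\<^sub>\<infinity>y. ?a w * Q n w y) = ?a w" for w
        using Suc[of w] by (subst infsum_cmult_right') (auto dest: infsumI)
      have "(\<lambda>(w,y). ?a w * Q n w y) summable_on Sigma UNIV (\<lambda>_. UNIV)"
      proof (rule summable_on_SigmaI[where g="?a"])
        show "((\<lambda>y. case (w, y) of (w, y) \<Rightarrow> ?a w * Q n w y) has_sum ?a w) UNIV" for w
          using has_sum_infsum[OF sQ[of w]] iQ[of w] by simp
      qed (auto simp: km kx Qb)
      then have "(\<lambda>p. D * (case p of (w,y) \<Rightarrow> ?a w * Q n w y)) summable_on UNIV"
        by (intro summable_on_cmult_right) simp
      then have "(\<lambda>p. norm (case p of (w,y) \<Rightarrow> ?a w * Q n w y * g y)) summable_on UNIV"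
      proof (rule Infinite_Sum.abs_summable_on_comparison_test')
        fix p :: "'a \<times> 'a"
        obtain w y where p: "p = (w,y)" by (cases p)
        have "\<bar>?a w * Q n w y * g y\<bar> = \<bar>g y\<bar> * (?a w * Q n w y)"
          using k m[of w] Qb(1)[of n w y] by (auto simp: markov_kernel_def abs_mult)
        also have "\<dots> \<le> D * (?a w * Q n w y)"
          using kx[of z w] Qb(1)[of n w y] by (intro mult_right_mono g) auto
        finally show "norm (case p of (w,y) \<Rightarrow> ?a w * Q n w y * g y)
            \<le> D * (case p of (w,y) \<Rightarrow> ?a w * Q n w y)"
          by (simp add: p)
      qed
      then have S: "(\<lambda>(w,y). ?a w * Q n w y * g y) summable_on UNIV \<times> UNIV"
        using abs_summable_summable by fastforce
      then have S': "(\<lambda>(y,w). ?a w * Q n w y * g y) summable_on UNIV \<times> UNIV"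
        using summable_on_swap[of "\<lambda>(y,w). ?a w * Q n w y * g y" UNIV UNIV] by simp
      have e1: "(\<Sum>\<^sub>\<infinity>w. ?a w * Q n w y * g y) = Q (Suc n) z y * g y" for y
        by (simp add: QS infsum_cmult_left')
      have e2: "(\<Sum>\<^sub>\<infinity>y. ?a w * Q n w y * g y) = ?a w * G w" for w
        using infsumI[OF G[of w]] by (simp add: mult.assoc infsum_cmult_right')
      have "(\<lambda>y. Q (Suc n) z y * g y) summable_on UNIV"
        using summable_on_Sigma_banach[OF S'] by (simp add: e1)
      moreover have "(\<Sum>\<^sub>\<infinity>y. Q (Suc n) z y * g y) = (\<Sum>\<^sub>\<infinity>w. ?a w * G w)"
        using infsum_swap_banach[OF S] by (simp add: e1 e2)
      ultimately show ?thesis by (simp add: has_sum_iff)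
    qed
    have "((\<lambda>y. Q (Suc n) z y * 1) has_sum (\<Sum>\<^sub>\<infinity>w. ?a w * 1)) UNIV"
      using Suc by (intro swap[where D=1]) auto
    moreover have "(\<Sum>\<^sub>\<infinity>w. ?a w) = 1"
      using k by (auto simp: markov_kernel_def intro!: infsumI)
    moreover have "((\<lambda>y. Q (Suc n) z y * f y) has_sum (\<Sum>\<^sub>\<infinity>w. ?a w * ?F w)) UNIV"
      using Suc by (intro swap[where D=B] f) auto
    moreover have "(\<Sum>\<^sub>\<infinity>w. ?a w * ?F w) = (kernel_op m k ^^ Suc n) f z"
      by (simp add: kernel_op_def ac_simps)
    moreover have "kernel_op m k ?F z \<le> kernel_op m k (\<lambda>_. B) z"
      using Suc by (intro kernel_op_mono[OF k m, where B=B and B'="\<bar>B\<bar>"]) (auto simp: abs_le_iff)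
    moreover have "kernel_op m k (\<lambda>_. - B) z \<le> kernel_op m k ?F z"
      using Suc by (intro kernel_op_mono[OF k m, where B="\<bar>B\<bar>" and B'=B]) (auto simp: abs_le_iff minus_le_iff)
    ultimately show ?case
      by (simp add: kernel_op_const[OF k] abs_le_iff minus_le_iff)
  qed
  have "(\<lambda>y. kernel_power m k n x y * f y * m y) = (\<lambda>y. Q n x y * f y)"
    using less_imp_neq[OF m] by (auto simp: kernel_power_def Q_def fun_eq_iff)
  then show ?thesis using main[of n x] by (simp only:)
qed

end

theory Submission
  imports Defs
begin

text \<open>
  Up to constants, the jump kernel is a subordination of the natural walk \<open>P\<close>:
  with \<open>a i = 1 / \<phi> (2 powr (i / \<gamma>))\<close>, (UE) gives \<open>\<Sum>i. a i * p\<^bsub>2 * 2^i\<^esub> \<le> C * k\<close> and (LE) gives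
  \<open>k \<le> C * (\<Sum>i. a i * (p\<^bsub>2^i\<^esub> + p\<^bsub>2^i + 1\<^esub>))\<close>, and inequalities between kernels pass to Dirichlet forms.
  As \<open>n \<mapsto> \<langle>P\<^sup>2\<^sup>n f, f\<rangle>\<close> is convex and decreasing, the first inequality yields, for
  \<open>W N = 2^N / (\<Sum>i\<le>N. 2^i * a i)\<close>, the pseudo-Poincare inequality
  \<open>\<parallel>f\<parallel>\<^sup>2 - \<parallel>P\<^sup>n f\<parallel>\<^sup>2 \<le> C * W N * (\<parallel>f\<parallel>\<^sup>2 - \<parallel>K f\<parallel>\<^sup>2)\<close> with \<open>n = 2^N\<close>, hence a Nash inequality and the upper bound.
  For the lower bound, the second inequality bounds the Dirichlet form of \<open>K\<close> on
  \<open>f = (I + P) P\<^sup>n \<delta>\<^sub>x\<close> by \<open>C * \<parallel>f\<parallel>\<^sup>2 / W N\<close>, so that \<open>\<langle>K\<^sup>2\<^sup>m f, f\<rangle> \<ge> \<parallel>f\<parallel>\<^sup>2 / 2\<close> as long as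
  \<open>m \<le> c * W N\<close>, while \<open>\<langle>K\<^sup>2\<^sup>m f, f\<rangle> \<le> \<psi>(m) * \<parallel>f\<parallel>\<^sub>1\<^sup>2\<close>. Spectral theory is replaced throughout by convexity
  of \<open>n \<mapsto> \<parallel>P\<^sup>n f\<parallel>\<^sup>2\<close>, that is by \<open>2 * \<langle>u, v\<rangle> \<le> \<parallel>u\<parallel>\<^sup>2 + \<parallel>v\<parallel>\<^sup>2\<close>, so that only non-negative functions occur.
\<close>

section \<open>Symmetric kernels on a discrete measure space\<close>

text \<open>The weights \<open>a i\<close> come from matching time with distance: at time 2^i the
  walk has spread to distance about R = 2^(i/\<gamma>), where its heat kernel is of order 1/V(R).
  For d = d(x,y) close to 2^(j/\<gamma>) the term i = j is thus of order 1/(V(d) \<phi>(d)), the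
  size that (J) prescribes for \<open>k\<close>. Two obstacles shape the proof. First, neither K nor
  P need be a positive operator, and P may be periodic, so convexity is available only along even
  times. The upper bound therefore compares the heat kernels with K^2, which dominates a multiple of
  k because k(x,x) m(x) is bounded below; the lower bound needs a test function that is insensitive
  to parity. Second, regular variation is a statement about each factor separately, while dyadic
  sums need a bound uniform over factors in [1,2]; a Baire argument supplies it. The index of \<phi>
  is never compared with \<gamma>: the sum \<Sum>i\<le>N. 2^i * a i may converge or diverge as N
  grows, and both cases enter only through the geometric growth of W.\<close>

locale vertex_measure =
  fixes m :: "'a \<Rightarrow> ennreal"
  assumes m_nonzero: "m x \<noteq> 0" and m_finite: "m x \<noteq> top"
begin

definition pairing :: "('a \<Rightarrow> ennreal) \<Rightarrow> ('a \<Rightarrow> ennreal) \<Rightarrow> ennreal" where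
  "pairing f g = (\<integral>\<^sup>+x. f x * g x * m x \<partial>count_space UNIV)"

definition kop :: "('a \<Rightarrow> 'a \<Rightarrow> ennreal) \<Rightarrow> ('a \<Rightarrow> ennreal) \<Rightarrow> 'a \<Rightarrow> ennreal" where
  "kop k f x = (\<integral>\<^sup>+y. k x y * f y * m y \<partial>count_space UNIV)"

text \<open>Dividing by \<open>m y\<close> makes this a unit mass: pairing with it evaluates at y,
  and its images under an operator are kernel values.\<close>

definition delta :: "'a \<Rightarrow> 'a \<Rightarrow> ennreal" where
  "delta y z = indicator {y} z / m y"

text \<open>The row sum is a parameter because weighted sums of heat kernels, with row sums other
  than 1, are compared with Markov kernels.\<close>

definition sym_kernel :: "('a \<Rightarrow> 'a \<Rightarrow> ennreal) \<Rightarrow> ennreal \<Rightarrow> bool" where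
  "sym_kernel k A \<longleftrightarrow> (\<forall>x y. k x y = k y x) \<and> (\<forall>x. kop k (\<lambda>_. 1) x = A)"

definition kpow :: "('a \<Rightarrow> 'a \<Rightarrow> ennreal) \<Rightarrow> nat \<Rightarrow> 'a \<Rightarrow> 'a \<Rightarrow> ennreal" where
  "kpow k n x y = (kop k ^^ n) (delta y) x"

lemma nn_integral_count_space_swap:
  "(\<integral>\<^sup>+x. \<integral>\<^sup>+y. F x y \<partial>count_space UNIV \<partial>count_space UNIV)
     = (\<integral>\<^sup>+y. \<integral>\<^sup>+x. F x y \<partial>count_space UNIV \<partial>count_space UNIV)"
  using nn_integral_fst_count_space[of "\<lambda>(x,y). F x y"] nn_integral_snd_count_space[of "\<lambda>(x,y). F x y"]
  by simp

lemma sym_kernelD: "sym_kernel k A \<Longrightarrow> k x y = k y x"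
  by (simp add: sym_kernel_def)

lemma sym_kernel_row: "sym_kernel k A \<Longrightarrow> kop k (\<lambda>_. 1) x = A"
  by (simp add: sym_kernel_def)

lemma pairing_commute: "pairing f g = pairing g f"
  by (simp add: pairing_def mult.commute)

lemma pairing_add: "pairing (\<lambda>x. f x + g x) h = pairing f h + pairing g h"
  by (simp add: pairing_def distrib_right nn_integral_add)

lemma pairing_add2: "pairing h (\<lambda>x. f x + g x) = pairing h f + pairing h g"
  using pairing_add[of f g h] by (simp add: pairing_commute)

lemma pairing_mono: "(\<And>x. f x \<le> f' x) \<Longrightarrow> (\<And>x. g x \<le> g' x) \<Longrightarrow> pairing f g \<le> pairing f' g'"
  unfolding pairing_def by (intro nn_integral_mono mult_mono) auto

lemma pairing_cmult: "pairing (\<lambda>x. c * f x) g = c * pairing f g"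
  by (simp add: pairing_def nn_integral_cmult mult.assoc)

text \<open>Writing the larger number as the smaller one plus c leaves the surplus c * c, so no
  square of a difference has to be formed.\<close>

lemma ennreal_two_mult_le: "2 * (a * b) \<le> a * a + b * (b::ennreal)"
proof -
  have "2 * (a * b) \<le> a * a + b * b" if le: "a \<le> b" for a b :: ennreal
  proof -
    obtain c where c: "b = a + c" using le by (auto simp: le_iff_add)
    have "2 * (a * b) \<le> 2 * (a * b) + c * c" by simp
    also have "\<dots> = a * a + b * b"
      unfolding c mult_2 by (simp only: distrib_left distrib_right ac_simps)
    finally show ?thesis .
  qed
  from this[of a b] this[of b a] show ?thesis
    using linear[of a b] by (auto simp: ac_simps)
qed

lemma pairing_le: "2 * pairing f g \<le> pairing f f + pairing g g"
proof -
  have "2 * pairing f g = (\<integral>\<^sup>+x. 2 * (f x * g x) * m x \<partial>count_space UNIV)"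
    by (simp add: pairing_def mult.assoc nn_integral_cmult)
  also have "\<dots> \<le> (\<integral>\<^sup>+x. (f x * f x + g x * g x) * m x \<partial>count_space UNIV)"
    by (intro nn_integral_mono mult_right_mono ennreal_two_mult_le) simp
  also have "\<dots> = pairing f f + pairing g g"
    by (simp add: pairing_def distrib_right nn_integral_add)
  finally show ?thesis .
qed

lemma pairing_delta: "pairing f (delta y) = f y"
proof -
  have "pairing f (delta y) = (\<Sum>x\<in>{y}. f x * delta y x * m x)"
    unfolding pairing_def by (rule nn_integral_count_space') (auto simp: delta_def)
  also have "\<dots> = f y * (1 / m y * m y)" by (simp add: delta_def mult.assoc)
  also have "1 / m y * m y = 1"
    using m_nonzero[of y] m_finite[of y]
    by (simp add: ennreal_divide_times ennreal_divide_self top.not_eq_extremum)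
  finally show ?thesis by simp
qed

lemma pairing_delta2: "pairing (delta y) f = f y"
  using pairing_delta[of f y] by (simp add: pairing_commute)

lemma kop_add: "kop k (\<lambda>x. f x + g x) x = kop k f x + kop k g x"
  by (simp add: kop_def distrib_left distrib_right nn_integral_add)

lemma kop_mono: "(\<And>x. f x \<le> f' x) \<Longrightarrow> kop k f x \<le> kop k f' x"
  unfolding kop_def by (intro nn_integral_mono mult_mono) auto

lemma kop_cmult: "kop k (\<lambda>x. c * f x) x = c * kop k f x"
  by (simp add: kop_def nn_integral_cmult[symmetric] ac_simps)

lemma kop_funpow_add: "(kop k ^^ n) (\<lambda>x. f x + g x) = (\<lambda>x. (kop k ^^ n) f x + (kop k ^^ n) g x)"
  by (induction n) (auto simp: kop_add)

lemma kop_kernel_add: "kop (\<lambda>x y. k x y + l x y) f x = kop k f x + kop l f x"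
  by (simp add: kop_def distrib_right nn_integral_add)

lemma kop_kernel_suminf:
  "kop (\<lambda>x y. \<Sum>i. w i * l i x y) f x = (\<Sum>i. w i * kop (l i) f x)"
  by (simp add: kop_def nn_integral_suminf nn_integral_cmult mult.assoc
      flip: ennreal_suminf_multc ennreal_suminf_cmult)

lemma pairing_suminf: "pairing (\<lambda>x. \<Sum>i. w i * F i x) g = (\<Sum>i. w i * pairing (F i) g)"
  by (simp add: pairing_def nn_integral_suminf nn_integral_cmult mult.assoc
      flip: ennreal_suminf_multc ennreal_suminf_cmult)

lemma pairing_kop:
  assumes "sym_kernel k A"
  shows "pairing (kop k f) g = pairing f (kop k g)"
proof -
  have "pairing (kop k f) g =
      (\<integral>\<^sup>+x. \<integral>\<^sup>+y. k x y * f y * m y * g x * m x \<partial>count_space UNIV \<partial>count_space UNIV)"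
    by (simp add: pairing_def kop_def nn_integral_multc)
  also have "\<dots> = (\<integral>\<^sup>+y. \<integral>\<^sup>+x. k x y * f y * m y * g x * m x \<partial>count_space UNIV \<partial>count_space UNIV)"
    by (rule nn_integral_count_space_swap)
  also have "\<dots> = (\<integral>\<^sup>+y. (\<integral>\<^sup>+x. (f y * m y) * (k y x * g x * m x) \<partial>count_space UNIV) \<partial>count_space UNIV)"
    by (intro nn_integral_cong) (simp add: sym_kernelD[OF assms] ac_simps)
  also have "\<dots> = pairing f (kop k g)"
    by (subst nn_integral_cmult) (simp_all add: pairing_def kop_def ac_simps)
  finally show ?thesis .
qed

lemma pairing_kop_funpow:
  assumes "sym_kernel k A"
  shows "pairing ((kop k ^^ n) f) g = pairing f ((kop k ^^ n) g)"
proof (induction n arbitrary: g)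
  case (Suc n)
  have "pairing ((kop k ^^ Suc n) f) g = pairing f ((kop k ^^ n) (kop k g))"
    by (simp add: pairing_kop[OF assms] Suc)
  then show ?case by (simp add: funpow_swap1)
qed simp

lemma pairing_kop_funpow_add:
  assumes "sym_kernel k A"
  shows "pairing ((kop k ^^ i) f) ((kop k ^^ j) g) = pairing ((kop k ^^ (i + j)) f) g"
  by (simp add: pairing_kop_funpow[OF assms] funpow_add add.commute[of i])

lemma kop_funpow_one:
  assumes "sym_kernel k 1"
  shows "(kop k ^^ n) (\<lambda>_. 1) = (\<lambda>_. 1)"
  using assms by (induction n) (auto simp: sym_kernel_def)

lemma kop_funpow_bound:
  assumes "sym_kernel k 1" "\<And>x. f x \<le> B"
  shows "(kop k ^^ n) f x \<le> B"
proof (induction n arbitrary: x)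
  case (Suc n)
  have "kop k ((kop k ^^ n) f) x \<le> kop k (\<lambda>x. B * 1) x" by (rule kop_mono) (use Suc in simp)
  also have "\<dots> = B * kop k (\<lambda>_. 1) x" by (rule kop_cmult)
  finally show ?case using assms(1) by (simp add: sym_kernel_def)
qed (simp add: assms)

lemma kpow_sym:
  assumes "sym_kernel k A"
  shows "kpow k n x y = kpow k n y x"
  unfolding kpow_def
  using pairing_kop_funpow[OF assms, of n "delta y" "delta x"] by (simp add: pairing_delta pairing_delta2)

text \<open>Self-adjointness moves the power from \<open>delta x\<close> to f, so no composition of
  kernels is computed.\<close>

lemma kop_kpow:
  assumes "sym_kernel k A"
  shows "kop (kpow k n) f x = (kop k ^^ n) f x"
proof -
  have "kop (kpow k n) f x = pairing ((kop k ^^ n) (delta x)) f"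
    using kpow_sym[OF assms, of n x] by (simp add: kpow_def pairing_def kop_def[of "kpow k n" for n])
  also have "\<dots> = (kop k ^^ n) f x" by (simp add: pairing_kop_funpow[OF assms] pairing_delta2)
  finally show ?thesis .
qed

lemma sym_kernel_kpow:
  assumes "sym_kernel k 1"
  shows "sym_kernel (kpow k n) 1"
  using kpow_sym[OF assms] kop_kpow[OF assms] kop_funpow_one[OF assms] by (auto simp: sym_kernel_def)

lemma sym_kernel_add:
  assumes "sym_kernel k A" "sym_kernel l B"
  shows "sym_kernel (\<lambda>x y. k x y + l x y) (A + B)"
  using assms by (auto simp: sym_kernel_def kop_kernel_add)

lemma sym_kernel_suminf:
  assumes "\<And>i. sym_kernel (l i) A"
  shows "sym_kernel (\<lambda>x y. \<Sum>i. w i * l i x y) ((\<Sum>i. w i) * A)"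
proof -
  have "kop (l i) (\<lambda>_. 1) x = A" and "l i x y = l i y x" for i x y
    using assms by (auto simp: sym_kernel_def)
  then show ?thesis
    by (auto simp: sym_kernel_def kop_kernel_suminf)
qed

text \<open>Schur's test: against the symmetric weight k(x,y) m(x) m(y), each of the two squares in
  2 f(x) f(y) \<le> f(x)^2 + f(y)^2 integrates to \<open>A * pairing f f\<close>.\<close>

lemma pairing_kop_le:
  assumes "sym_kernel k A"
  shows "pairing (kop k f) f \<le> A * pairing f f"
proof -
  let ?N = "count_space (UNIV :: 'a set)"
  have A: "(\<integral>\<^sup>+y. k x y * m y \<partial>?N) = A" for x
    using sym_kernel_row[OF assms, of x] by (simp add: kop_def)
  have 1: "(\<integral>\<^sup>+x. \<integral>\<^sup>+y. k x y * m y * m x * (f x * f x) \<partial>?N \<partial>?N) = A * pairing f f"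
  proof -
    have "(\<integral>\<^sup>+x. \<integral>\<^sup>+y. k x y * m y * m x * (f x * f x) \<partial>?N \<partial>?N)
        = (\<integral>\<^sup>+x. A * (f x * f x * m x) \<partial>?N)"
      by (simp add: nn_integral_multc A) (simp add: ac_simps)
    then show ?thesis by (simp add: pairing_def nn_integral_cmult)
  qed
  have 2: "(\<integral>\<^sup>+x. \<integral>\<^sup>+y. k x y * m y * m x * (f y * f y) \<partial>?N \<partial>?N) = A * pairing f f"
  proof -
    have "(\<integral>\<^sup>+x. \<integral>\<^sup>+y. k x y * m y * m x * (f y * f y) \<partial>?N \<partial>?N)
      = (\<integral>\<^sup>+y. \<integral>\<^sup>+x. k x y * m y * m x * (f y * f y) \<partial>?N \<partial>?N)"
      by (rule nn_integral_count_space_swap)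
    also have "\<dots> = (\<integral>\<^sup>+y. \<integral>\<^sup>+x. k y x * m x * m y * (f y * f y) \<partial>?N \<partial>?N)"
      by (intro nn_integral_cong) (simp add: sym_kernelD[OF assms] ac_simps)
    finally show ?thesis by (simp add: 1)
  qed
  have "2 * pairing (kop k f) f
      = (\<integral>\<^sup>+x. \<integral>\<^sup>+y. k x y * m y * m x * (2 * (f x * f y)) \<partial>?N \<partial>?N)"
    by (simp add: pairing_def kop_def flip: nn_integral_multc nn_integral_cmult) (simp add: ac_simps)
  also have "\<dots> \<le> (\<integral>\<^sup>+x. \<integral>\<^sup>+y. k x y * m y * m x * (f x * f x) + k x y * m y * m x * (f y * f y) \<partial>?N \<partial>?N)"
    by (intro nn_integral_mono) (auto simp: distrib_left[symmetric] intro!: mult_left_mono ennreal_two_mult_le)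
  also have "\<dots> = 2 * (A * pairing f f)"
    by (simp add: nn_integral_add 1 2 mult_2)
  finally show ?thesis
    by (simp add: ennreal_mult_le_mult_iff)
qed

text \<open>The Dirichlet form \<open>A \<langle>f, f\<rangle> - \<langle>k f, f\<rangle>\<close> of a kernel with row sums \<open>A\<close> increases with the
  kernel; both sides are moved so that no subtraction in \<open>ennreal\<close> occurs.\<close>

lemma dirichlet_form_mono:
  assumes k: "sym_kernel k A" and l: "sym_kernel l B" and le: "\<And>x y. l x y \<le> k x y"
    and B: "B \<noteq> top"
  shows "pairing (kop k f) f + B * pairing f f \<le> pairing (kop l f) f + A * pairing f f"
proof -
  \<comment> \<open>The remainder is again a symmetric kernel, with constant row sums A - B, so
    Schur's test applies to it. Finiteness of B is what lets it be cancelled from the row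
    sums.\<close>
  define d where "d x y = k x y - l x y" for x y
  have kd: "k x y = l x y + d x y" for x y
    using diff_add_cancel_ennreal[OF le[of x y]] by (simp only: d_def add.commute)
  have "k = (\<lambda>x y. l x y + d x y)" by (intro ext) (rule kd)
  then have kop: "kop k f x = kop l f x + kop d f x" for f x
    by (simp add: kop_kernel_add)
  have AB: "A = B + kop d (\<lambda>_. 1) x" for x
    using sym_kernel_row[OF k, of x] sym_kernel_row[OF l, of x] kop[of "\<lambda>_. 1" x] by simp
  have d: "sym_kernel d (A - B)"
    unfolding sym_kernel_def
  proof (intro conjI allI)
    show "kop d (\<lambda>_. 1) x = A - B" for x
      using AB[of x] B by simp
    show "d x y = d y x" for x y by (simp add: d_def sym_kernelD[OF k] sym_kernelD[OF l])
  qed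
  have BA: "(A - B) + B = A"
    by (rule diff_add_cancel_ennreal) (use AB[of undefined] in simp)
  have "pairing (kop k f) f + B * pairing f f
      \<le> pairing (kop l f) f + (A - B) * pairing f f + B * pairing f f"
    unfolding kop pairing_add by (intro add_mono pairing_kop_le[OF d]) auto
  also have "\<dots> = pairing (kop l f) f + ((A - B) + B) * pairing f f"
    by (simp only: distrib_right add.assoc)
  finally show ?thesis unfolding BA .
qed

text \<open>One power moves across the pairing: ||k^(n+1) f||^2 = <k^n f, k^(n+2) f>, to which the
  arithmetic-geometric inequality applies.\<close>

lemma energy_convex:
  assumes "sym_kernel k A"
  shows "2 * pairing ((kop k ^^ (n + 1)) f) ((kop k ^^ (n + 1)) f)
    \<le> pairing ((kop k ^^ n) f) ((kop k ^^ n) f) + pairing ((kop k ^^ (n + 2)) f) ((kop k ^^ (n + 2)) f)"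
proof -
  have "pairing ((kop k ^^ (n + 1)) f) ((kop k ^^ (n + 1)) f)
      = pairing ((kop k ^^ n) f) ((kop k ^^ (n + 2)) f)"
    unfolding pairing_kop_funpow_add[OF assms] by simp
  then show ?thesis by (simp only: pairing_le)
qed

text \<open>Positivity of \<open>\<langle>(I + K) g, g\<rangle>\<close> for \<open>g = u - v\<close>, expanded into non-negative terms.\<close>

lemma pairing_kop_polar:
  assumes k: "sym_kernel k 1"
  shows "2 * (pairing u v + pairing (kop k u) v)
    \<le> pairing u u + pairing (kop k u) u + (pairing v v + pairing (kop k v) v)"
proof -
  let ?N = "count_space (UNIV :: 'a set)"
  have A: "(\<integral>\<^sup>+y. k x y * m y \<partial>?N) = 1" for x
    using sym_kernel_row[OF k, of x] by (simp add: kop_def)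
  \<comment> \<open>As the rows sum to 1, \<open>F u v\<close> is twice <(I+k) u, v>. Its integrand
    is a product of two sums, so the pointwise arithmetic-geometric inequality gives the claim for
    \<open>F\<close>.\<close>
  define F where "F u v = (\<integral>\<^sup>+x. \<integral>\<^sup>+y. k x y * m y * m x * ((u x + u y) * (v x + v y)) \<partial>?N \<partial>?N)"
    for u v :: "'a \<Rightarrow> ennreal"
  have F: "F u v = 2 * (pairing u v + pairing (kop k u) v)" for u v
  proof -
    have 1: "(\<integral>\<^sup>+x. \<integral>\<^sup>+y. k x y * m y * m x * (u x * v x) \<partial>?N \<partial>?N) = pairing u v"
      by (simp add: nn_integral_multc A pairing_def) (simp add: ac_simps)
    have 2: "(\<integral>\<^sup>+x. \<integral>\<^sup>+y. k x y * m y * m x * (u y * v y) \<partial>?N \<partial>?N) = pairing u v"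
    proof -
      have "(\<integral>\<^sup>+x. \<integral>\<^sup>+y. k x y * m y * m x * (u y * v y) \<partial>?N \<partial>?N)
        = (\<integral>\<^sup>+y. \<integral>\<^sup>+x. k x y * m y * m x * (u y * v y) \<partial>?N \<partial>?N)"
        by (rule nn_integral_count_space_swap)
      also have "\<dots> = (\<integral>\<^sup>+y. \<integral>\<^sup>+x. k y x * m x * m y * (u y * v y) \<partial>?N \<partial>?N)"
        by (intro nn_integral_cong) (simp add: sym_kernelD[OF k] ac_simps)
      finally show ?thesis by (simp add: 1)
    qed
    have 3: "(\<integral>\<^sup>+x. \<integral>\<^sup>+y. k x y * m y * m x * (u y * v x) \<partial>?N \<partial>?N) = pairing (kop k u) v"
      for u v :: "'a \<Rightarrow> ennreal"
      by (simp add: pairing_def kop_def flip: nn_integral_multc) (simp add: ac_simps)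
    have 4: "(\<integral>\<^sup>+x. \<integral>\<^sup>+y. k x y * m y * m x * (u x * v y) \<partial>?N \<partial>?N) = pairing (kop k u) v"
      using 3[of v u] pairing_kop[OF k, of u v] by (simp add: pairing_commute mult.commute)
    have "F u v = (\<integral>\<^sup>+x. \<integral>\<^sup>+y. k x y * m y * m x * (u x * v x) + k x y * m y * m x * (u y * v y)
        + k x y * m y * m x * (u y * v x) + k x y * m y * m x * (u x * v y) \<partial>?N \<partial>?N)"
      unfolding F_def by (intro nn_integral_cong) (simp add: distrib_left distrib_right ac_simps)
    also have "\<dots> = 2 * (pairing u v + pairing (kop k u) v)"
      by (simp add: nn_integral_add 1 2 3 4 mult_2 add.assoc add.left_commute)
    finally show ?thesis .
  qed
  have "2 * F u v \<le> F u u + F v v"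
  proof -
    have "2 * F u v = (\<integral>\<^sup>+x. \<integral>\<^sup>+y. k x y * m y * m x * (2 * ((u x + u y) * (v x + v y))) \<partial>?N \<partial>?N)"
      unfolding F_def by (simp flip: nn_integral_cmult) (simp add: ac_simps)
    also have "\<dots> \<le> (\<integral>\<^sup>+x. \<integral>\<^sup>+y. k x y * m y * m x * ((u x + u y) * (u x + u y)) +
        k x y * m y * m x * ((v x + v y) * (v x + v y)) \<partial>?N \<partial>?N)"
      by (intro nn_integral_mono)
        (simp only: distrib_left[symmetric, of "k x y * m y * m x" for x y], intro mult_left_mono ennreal_two_mult_le, simp)
    also have "\<dots> = F u u + F v v" by (simp add: F_def nn_integral_add)
    finally show ?thesis .
  qed
  then have "2 * (2 * (pairing u v + pairing (kop k u) v))
    \<le> 2 * (pairing u u + pairing (kop k u) u + (pairing v v + pairing (kop k v) v))"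
    unfolding F by (simp only: distrib_left[symmetric])
  then show ?thesis by (subst (asm) ennreal_mult_le_mult_iff) auto
qed


text \<open>||f||^2 - ||k f||^2 is the Dirichlet form of k^2, and keeping only the two-step paths
  that first stay at x gives k_2(x,y) \<ge> k(x,x) m(x) k(x,y) \<ge> c k(x,y). The times 2 * s i are
  even so that the other form consists of squared norms.\<close>

lemma pairing_square_diff_le:
  assumes k: "sym_kernel k 1" and p: "sym_kernel p 1"
    and c: "\<And>x. c \<le> k x x * m x"
    and le: "\<And>x y. (\<Sum>i. w i * kpow p (2 * s i) x y) \<le> k x y"
  shows "pairing (kop k f) (kop k f) + c * (\<Sum>i. w i) * pairing f f
    \<le> c * (\<Sum>i. w i * pairing ((kop p ^^ s i) f) ((kop p ^^ s i) f)) + pairing f f"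
proof -
  define l where "l x y = (\<Sum>i. (c * w i) * kpow p (2 * s i) x y)" for x y
  have "sym_kernel l ((\<Sum>i. c * w i) * 1)"
    unfolding l_def by (intro sym_kernel_suminf sym_kernel_kpow p)
  then have l: "sym_kernel l (c * (\<Sum>i. w i))" by simp
  have k2: "sym_kernel (kpow k 2) 1" by (rule sym_kernel_kpow[OF k])
  have le2: "l x y \<le> kpow k 2 x y" for x y
  proof -
    have "l x y = c * (\<Sum>i. w i * kpow p (2 * s i) x y)"
      by (simp add: l_def mult.assoc)
    also have "\<dots> \<le> (k x x * m x) * k x y"
      by (intro mult_mono c le) auto
    also have "\<dots> = (\<Sum>z\<in>{x}. k x z * k z y * m z)" by (simp add: ac_simps)
    also have "\<dots> = (\<integral>\<^sup>+z. k x z * k z y * m z * indicator {x} z \<partial>count_space UNIV)"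
      by (subst nn_integral_count_space'[where A="{x}"]) auto
    also have "\<dots> \<le> (\<integral>\<^sup>+z. k x z * k z y * m z \<partial>count_space UNIV)"
      by (intro nn_integral_mono) (auto simp: indicator_def)
    also have "\<dots> = kpow k 2 x y"
    proof -
      have "kop k (delta y) z = k z y" for z
        using pairing_delta[of "k z" y] by (simp add: kop_def pairing_def)
      then have "kop k (delta y) = (\<lambda>z. k z y)" by (intro ext)
      then show ?thesis by (simp add: kpow_def numeral_2_eq_2) (simp add: kop_def)
    qed
    finally show ?thesis .
  qed
  \<comment> \<open>The row sums of \<open>l\<close> are at most those of k^2, that is 1; this
    yields the finiteness required by \<open>dirichlet_form_mono\<close>.\<close>
  have "c * (\<Sum>i. w i) = kop l (\<lambda>_. 1) undefined" using sym_kernel_row[OF l] by simp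
  also have "\<dots> \<le> kop (kpow k 2) (\<lambda>_. 1) undefined"
    unfolding kop_def by (intro nn_integral_mono mult_right_mono le2) auto
  finally have fin: "c * (\<Sum>i. w i) \<noteq> top"
    using sym_kernel_row[OF k2] by (auto simp: top_unique)
  have pl: "pairing (kop l f) f = c * (\<Sum>i. w i * pairing ((kop p ^^ s i) f) ((kop p ^^ s i) f))"
  proof -
    have "kop l f = (\<lambda>x. \<Sum>i. c * w i * (kop p ^^ (2 * s i)) f x)"
      unfolding l_def by (intro ext) (simp add: kop_kernel_suminf kop_kpow[OF p])
    then have "pairing (kop l f) f = (\<Sum>i. c * w i * pairing ((kop p ^^ (2 * s i)) f) f)"
      by (simp add: pairing_suminf)
    then show ?thesis
      by (simp add: pairing_kop_funpow_add[OF p] mult.assoc mult_2)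
  qed
  have pk: "pairing (kop (kpow k 2) f) f = pairing (kop k f) (kop k f)"
  proof -
    have "kop (kpow k 2) f = kop k (kop k f)"
      by (intro ext) (simp add: kop_kpow[OF k] numeral_2_eq_2)
    then show ?thesis by (simp add: pairing_kop[OF k])
  qed
  show ?thesis
    using dirichlet_form_mono[OF k2 l le2 fin, of f] by (simp add: pl pk)
qed

text \<open>Here \<open>k\<close> is the smaller kernel, so the row sum that must be finite is 1.
  Each pair of consecutive heat kernels has row sum 2, whence the factor 2.\<close>

lemma pairing_kop_ge:
  assumes k: "sym_kernel k 1" and p: "sym_kernel p 1"
    and le: "\<And>x y. k x y \<le> (\<Sum>i. w i * (kpow p (s i) x y + kpow p (s i + 1) x y))"
  shows "(\<Sum>i. w i * (pairing ((kop p ^^ s i) f) f + pairing ((kop p ^^ (s i + 1)) f) f)) + pairing f f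
    \<le> pairing (kop k f) f + (\<Sum>i. w i) * 2 * pairing f f"
proof -
  define h where "h x y = (\<Sum>i. w i * (kpow p (s i) x y + kpow p (s i + 1) x y))" for x y
  have h: "sym_kernel h ((\<Sum>i. w i) * (1 + 1))"
    unfolding h_def by (intro sym_kernel_suminf sym_kernel_add sym_kernel_kpow p)
  have "kop h f = (\<lambda>x. \<Sum>i. w i * ((kop p ^^ s i) f x + (kop p ^^ (s i + 1)) f x))"
    unfolding h_def
    by (intro ext) (simp only: kop_kernel_suminf kop_kernel_add kop_kpow[OF p])
  then have "pairing (kop h f) f
      = (\<Sum>i. w i * (pairing ((kop p ^^ s i) f) f + pairing ((kop p ^^ (s i + 1)) f) f))"
    by (simp only: pairing_suminf pairing_add)
  then show ?thesis
    using dirichlet_form_mono[OF h k, of f] le by (simp add: h_def)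
qed

section \<open>Real-valued correlations along the powers of a kernel\<close>

definition corr :: "('a \<Rightarrow> 'a \<Rightarrow> ennreal) \<Rightarrow> ('a \<Rightarrow> ennreal) \<Rightarrow> nat \<Rightarrow> real" where
  "corr k f n = enn2real (pairing ((kop k ^^ n) f) f)"

text \<open>Boundedness and integrability make every <k^n f, f> finite, so that \<open>corr\<close>
  never takes the default value of \<open>enn2real\<close> at infinity.\<close>

definition fin_mass :: "('a \<Rightarrow> ennreal) \<Rightarrow> bool" where
  "fin_mass f \<longleftrightarrow> (\<exists>B. B \<noteq> top \<and> (\<forall>x. f x \<le> B)) \<and> pairing (\<lambda>_. 1) f \<noteq> top"

lemma corr_nonneg [simp]: "0 \<le> corr k f n"
  by (simp add: corr_def)

lemma pairing_const: "pairing (\<lambda>_. c) f = c * pairing (\<lambda>_. 1) f"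
  using pairing_cmult[of c "\<lambda>_. 1" f] by simp

lemma corr_bounded:
  assumes "sym_kernel k 1" "fin_mass f"
  obtains M where "\<And>n. pairing ((kop k ^^ n) f) f \<le> ennreal M" "0 \<le> M"
proof -
  obtain B where B: "B \<noteq> top" "\<And>x. f x \<le> B" and m: "pairing (\<lambda>_. 1) f \<noteq> top"
    using assms(2) by (auto simp: fin_mass_def)
  have fin: "B * pairing (\<lambda>_. 1) f \<noteq> top" using B m by (simp add: ennreal_mult_eq_top_iff)
  have "pairing ((kop k ^^ n) f) f \<le> pairing (\<lambda>_. B) f" for n
    by (intro pairing_mono kop_funpow_bound assms B) auto
  then show ?thesis using fin that[of "enn2real (B * pairing (\<lambda>_. 1) f)"]
    by (simp add: pairing_const[of B] top.not_eq_extremum)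
qed

lemma ennreal_corr:
  assumes "sym_kernel k 1" "fin_mass f"
  shows "ennreal (corr k f n) = pairing ((kop k ^^ n) f) f"
proof -
  obtain M where "\<And>n. pairing ((kop k ^^ n) f) f \<le> ennreal M" "0 \<le> M"
    using corr_bounded[OF assms] by blast
  then have "pairing ((kop k ^^ n) f) f < top"
    using ennreal_less_top le_less_trans by blast
  then show ?thesis by (simp add: corr_def)
qed

lemma corr_convex:
  assumes k: "sym_kernel k 1" and f: "fin_mass f"
  shows "2 * corr k f (2 * (n + 1)) \<le> corr k f (2 * n) + corr k f (2 * (n + 2))"
proof -
  have e: "pairing ((kop k ^^ n) f) ((kop k ^^ n) f) = ennreal (corr k f (2 * n))" for n
    by (simp only: pairing_kop_funpow_add[OF k] ennreal_corr[OF k f] mult_2)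
  have "ennreal (2 * corr k f (2 * (n + 1))) \<le> ennreal (corr k f (2 * n) + corr k f (2 * (n + 2)))"
    using energy_convex[OF k, of n f] unfolding e by (simp add: ennreal_mult)
  then show ?thesis by (subst (asm) ennreal_le_iff) auto
qed

text \<open>Rearranged, the two-step drop from the odd time 2n+1 is at most the one from 2n; this
  carries the convexity along even times over to odd times. It is positivity of I + k tested on k^n
  f - k^(n+1) f.\<close>

lemma corr_polar:
  assumes k: "sym_kernel k 1" and f: "fin_mass f"
  shows "corr k f (2 * n + 1) + corr k f (2 * n + 2) \<le> corr k f (2 * n) + corr k f (2 * n + 3)"
proof -
  have e: "pairing ((kop k ^^ i) f) ((kop k ^^ j) f) = ennreal (corr k f (i + j))" for i j
    by (simp only: pairing_kop_funpow_add[OF k] ennreal_corr[OF k f])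
  have "2 * (ennreal (corr k f (2 * n + 1)) + ennreal (corr k f (2 * n + 2)))
    \<le> ennreal (corr k f (2 * n)) + ennreal (corr k f (2 * n + 1))
      + (ennreal (corr k f (2 * n + 2)) + ennreal (corr k f (2 * n + 3)))"
    using pairing_kop_polar[OF k, of "(kop k ^^ n) f" "(kop k ^^ (n + 1)) f"]
    unfolding funpow.simps(2)[of _ "kop k", THEN fun_cong, unfolded o_apply, symmetric] e
    by (simp add: mult_2 numeral_3_eq_3)
  then have "ennreal (2 * (corr k f (2 * n + 1) + corr k f (2 * n + 2))) \<le> ennreal (corr k f (2 * n)
      + corr k f (2 * n + 1) + (corr k f (2 * n + 2) + corr k f (2 * n + 3)))"
    by (simp add: ennreal_mult)
  then show ?thesis by (subst (asm) ennreal_le_iff) auto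
qed

lemma corr_le:
  assumes k: "sym_kernel k 1" and f: "fin_mass f"
  shows "corr k f n \<le> corr k f 0"
proof -
  have "kop (kpow k n) f = (kop k ^^ n) f" by (intro ext kop_kpow[OF k])
  then have "pairing ((kop k ^^ n) f) f \<le> pairing f f"
    using pairing_kop_le[OF sym_kernel_kpow[OF k], of n f] by simp
  then have "ennreal (corr k f n) \<le> ennreal (corr k f 0)" by (simp add: ennreal_corr[OF k f])
  then show ?thesis by simp
qed

end

section \<open>Convex sequences of reals\<close>

lemma convex_bounded_seq_antimono:
  fixes b :: "nat \<Rightarrow> real"
  assumes conv: "\<And>n. 2 * b (n + 1) \<le> b n + b (n + 2)" and M: "\<And>n. b n \<le> M"
  shows "b (n + 1) \<le> b n"
proof (rule ccontr)
  assume "\<not> b (n + 1) \<le> b n"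
  \<comment> \<open>By convexity a single positive increment persists and forces linear growth
    beyond the bound M.\<close>
  define e where "e = b (n + 1) - b n"
  have e: "e > 0" using \<open>\<not> b (n + 1) \<le> b n\<close> by (simp add: e_def)
  have step: "e \<le> b (n + i + 1) - b (n + i)" for i
  proof (induction i)
    case (Suc i)
    then show ?case using conv[of "n + i"] by simp
  qed (simp add: e_def)
  have grow: "b n + i * e \<le> b (n + i)" for i
  proof (induction i)
    case (Suc i)
    then show ?case using step[of i] by (simp add: algebra_simps)
  qed simp
  obtain i :: nat where "(M - b n) / e < i" using reals_Archimedean2 by blast
  then have "M < b n + i * e" using e by (simp add: field_simps)
  with grow[of i] M[of "n + i"] show False by linarith
qed

lemma convex_seq_increments:
  fixes b :: "nat \<Rightarrow> real"
  assumes conv: "\<And>n. 2 * b (n + 1) \<le> b n + b (n + 2)" and "i \<le> j"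
  shows "b j - b (j + 1) \<le> b i - b (i + 1)"
  using \<open>i \<le> j\<close>
proof (induction j rule: dec_induct)
  case (step j)
  then show ?case using conv[of j] by simp
qed simp

text \<open>Drops of a convex sequence shrink, so the drop at j is at most each of the j - i drops
  that add up to b i - b j.\<close>

lemma convex_seq_drop_le:
  fixes b :: "nat \<Rightarrow> real"
  assumes conv: "\<And>n. 2 * b (n + 1) \<le> b n + b (n + 2)" and "i \<le> j"
  shows "(real j - real i) * (b j - b (j + 1)) \<le> b i - b j"
  using \<open>i \<le> j\<close>
proof (induction j rule: dec_induct)
  case (step j)
  have "(real j + 1 - real i) * (b (j + 1) - b (j + 2)) \<le> (real j + 1 - real i) * (b j - b (j + 1))"
    using step convex_seq_increments[of b, OF conv, of j "j + 1"] by (intro mult_left_mono) auto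
  also have "\<dots> \<le> b i - b (j + 1)"
    using step by (simp add: algebra_simps)
  finally show ?case by (simp add: add.commute)
qed simp

text \<open>The mean drop (b 0 - b n) / n decreases in n; it is stated without division.\<close>

lemma convex_seq_secants:
  fixes b :: "nat \<Rightarrow> real"
  assumes conv: "\<And>n. 2 * b (n + 1) \<le> b n + b (n + 2)" and "n \<le> N"
  shows "real n * (b 0 - b N) \<le> real N * (b 0 - b n)"
  using \<open>n \<le> N\<close>
proof (induction N rule: dec_induct)
  case (step N)
  have "real n * (b N - b (N + 1)) \<le> real n * (b n - b (n + 1))"
    using step by (intro mult_left_mono convex_seq_increments[of b, OF conv]) auto
  also have "\<dots> \<le> b 0 - b n" using convex_seq_drop_le[of b 0 n, OF conv] by simp
  finally show ?case using step by (simp add: algebra_simps)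
qed simp

lemma convex_seq_total_drop:
  fixes b :: "nat \<Rightarrow> real"
  assumes conv: "\<And>n. 2 * b (n + 1) \<le> b n + b (n + 2)"
  shows "b 0 - b n \<le> real n * (b 0 - b 1)"
  using convex_seq_secants[of b 1 n, OF conv] by (cases "n = 0") auto

section \<open>Regularly varying functions at dyadic scales\<close>

text \<open>Each single factor l has its own threshold and constant. The sets \<open>F n\<close>,
  where n serves as both, are closed by continuity of \<phi> and cover [1,2], so by Baire's theorem
  one of them contains an interval.\<close>

lemma regularly_varying_interval_bound:
  fixes \<phi> :: "real \<Rightarrow> real"
  assumes ge1: "\<forall>t\<ge>0. \<phi> t \<ge> 1" and cont: "continuous_on {0..} \<phi>" and rv: "regularly_varying \<phi> \<beta>"
  obtains c c' :: real and n :: nat where "1 \<le> c" "c < c'" "c' \<le> 2"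
    "\<And>l t. l \<in> {c..c'} \<Longrightarrow> t \<ge> real n + 1 \<Longrightarrow>
      \<phi> (l * t) \<le> (real n + 1) * \<phi> t \<and> \<phi> t \<le> (real n + 1) * \<phi> (l * t)"
proof -
  define F where "F n = {l \<in> {1..2}. \<forall>t \<ge> real n + 1.
      \<phi> (l * t) \<le> (real n + 1) * \<phi> t \<and> \<phi> t \<le> (real n + 1) * \<phi> (l * t)}" for n :: nat
  have closed: "closed (F n)" for n
  proof -
    have cl: "closed {l \<in> {1..2}. \<phi> (l * t) \<le> (real n + 1) * \<phi> t \<and> \<phi> t \<le> (real n + 1) * \<phi> (l * t)}"
      if "t \<ge> real n + 1" for t
    proof -
      have 1: "continuous_on {1..2} (\<lambda>l. \<phi> (l * t))"
        by (rule continuous_on_compose2[OF cont]) (use that in \<open>auto intro!: continuous_intros\<close>)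
      have "closed ({1..2} \<inter> (\<lambda>l. \<phi> (l * t)) -` {\<phi> t / (real n + 1)..(real n + 1) * \<phi> t})"
        by (rule continuous_closed_preimage[OF 1]) auto
      moreover have "{1..2} \<inter> (\<lambda>l. \<phi> (l * t)) -` {\<phi> t / (real n + 1)..(real n + 1) * \<phi> t} =
        {l \<in> {1..2}. \<phi> (l * t) \<le> (real n + 1) * \<phi> t \<and> \<phi> t \<le> (real n + 1) * \<phi> (l * t)}"
        by (auto simp: field_simps)
      ultimately show ?thesis by simp
    qed
    have "F n = (\<Inter>t\<in>{real n + 1..}.
        {l \<in> {1..2}. \<phi> (l * t) \<le> (real n + 1) * \<phi> t \<and> \<phi> t \<le> (real n + 1) * \<phi> (l * t)})"
      by (auto simp: F_def)
    then show ?thesis by (simp only:) (intro closed_INT ballI cl, simp)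
  qed
  have cover: "\<exists>n. l \<in> F n" if l: "l \<in> {1..2}" for l
  proof -
    have "((\<lambda>t. \<phi> (l * t) / \<phi> t) \<longlongrightarrow> l powr \<beta>) at_top"
      using rv l by (auto simp: regularly_varying_def)
    then have "eventually (\<lambda>t. \<phi> (l * t) / \<phi> t > l powr \<beta> / 2 \<and> \<phi> (l * t) / \<phi> t < 2 * l powr \<beta>) at_top"
      using l by (intro eventually_conj order_tendstoD) auto
    then obtain T where T: "\<And>t. t \<ge> T \<Longrightarrow> \<phi> (l * t) / \<phi> t > l powr \<beta> / 2 \<and> \<phi> (l * t) / \<phi> t < 2 * l powr \<beta>"
      unfolding eventually_at_top_linorder by blast
    obtain n :: nat where n: "max T (max (2 * l powr \<beta>) (2 / l powr \<beta>)) \<le> n"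
      using real_arch_simple by blast
    have "\<phi> (l * t) \<le> (real n + 1) * \<phi> t \<and> \<phi> t \<le> (real n + 1) * \<phi> (l * t)" if t: "t \<ge> real n + 1" for t
    proof -
      have p: "\<phi> t \<ge> 1" "\<phi> (l * t) \<ge> 1" using ge1 t l by auto
      have lp: "l powr \<beta> > 0" using l by auto
      have "\<phi> (l * t) / \<phi> t \<le> real n + 1" "\<phi> (l * t) / \<phi> t > l powr \<beta> / 2" using T[of t] t n by auto
      moreover have "\<phi> t / \<phi> (l * t) \<le> 2 / l powr \<beta>"
        using T[of t] t n p lp by (auto simp: field_simps)
      then have "\<phi> t / \<phi> (l * t) \<le> real n + 1" using n by linarith
      ultimately show ?thesis using p by (auto simp: field_simps)
    qed
    then show ?thesis using l by (auto simp: F_def)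
  qed
  have "\<exists>n. \<not> {1..2} \<subseteq> closure ({1..2} - F n)"
  proof (rule ccontr)
    assume "\<nexists>n. \<not> {1..2} \<subseteq> closure ({1..2} - F n)"
    then have "{1..2::real} \<subseteq> closure (\<Inter>(range (\<lambda>n. {1..2} - F n)))"
      by (intro Baire) (auto simp: Diff_eq intro!: openin_open_Int open_Compl closed)
    moreover have "\<Inter>(range (\<lambda>n. {1..2} - F n)) = {}"
    proof -
      have "\<exists>n. l \<notin> {1..2} - F n" for l using cover[of l] by (cases "l \<in> {1..2}") auto
      then show ?thesis by blast
    qed
    ultimately have "{1..2::real} \<subseteq> closure {}" by (simp only:)
    then show False by simp
  qed
  then obtain n x where x: "x \<in> {1..2}" "x \<notin> closure ({1..2} - F n)"
    unfolding subset_eq by blast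
  then obtain e where e: "e > 0" "\<And>y. y \<in> {1..2} - F n \<Longrightarrow> \<not> dist y x < e"
    by (auto simp: closure_approachable)
  \<comment> \<open>Half the radius keeps the closed interval inside the open ball that misses the
    complement of \<open>F n\<close>; the cut-offs keep it inside [1,2].\<close>
  define c where "c = max 1 (x - e / 2)"
  define c' where "c' = min 2 (x + e / 2)"
  have "l \<in> F n" if "l \<in> {c..c'}" for l
  proof -
    have "\<bar>l - x\<bar> < e" using that e(1) by (auto simp: c_def c'_def abs_less_iff)
    then show ?thesis using that e(2)[of l] by (auto simp: c_def c'_def dist_real_def)
  qed
  moreover have "1 \<le> c" "c < c'" "c' \<le> 2" using e(1) x(1) by (auto simp: c_def c'_def)
  ultimately show ?thesis using that[of c c' n] by (auto simp: F_def)
qed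

text \<open>Quotients of two factors in [c,c'] fill [1,c'/c], and the k-th root of any l \<le> 2
  lies there for a fixed k, so k iterations reach all of [1,2] for large t. For bounded t,
  compactness and \<phi> \<ge> 1 suffice.\<close>

lemma regularly_varying_locally_bounded:
  fixes \<phi> :: "real \<Rightarrow> real"
  assumes ge1: "\<forall>t\<ge>0. \<phi> t \<ge> 1" and cont: "continuous_on {0..} \<phi>" and rv: "regularly_varying \<phi> \<beta>"
  obtains B where "B \<ge> 1"
    "\<And>l t. l \<in> {1..2} \<Longrightarrow> t \<ge> 0 \<Longrightarrow> \<phi> (l * t) \<le> B * \<phi> t \<and> \<phi> t \<le> B * \<phi> (l * t)"
proof -
  obtain c c' n where c: "1 \<le> c" "c < c'" "c' \<le> 2"
    and cb: "\<And>l t. l \<in> {c..c'} \<Longrightarrow> t \<ge> real n + 1 \<Longrightarrow>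
      \<phi> (l * t) \<le> (real n + 1) * \<phi> t \<and> \<phi> t \<le> (real n + 1) * \<phi> (l * t)"
    using regularly_varying_interval_bound[OF assms] by blast
  \<comment> \<open>Twice the threshold, so that t / c with c \<le> 2 still lies above it.\<close>
  define T where "T = 2 * (real n + 1)"
  define A where "A = (real n + 1)\<^sup>2"
  have A: "A \<ge> 1" by (simp add: A_def)
  have small: "\<phi> (l * t) \<le> A * \<phi> t \<and> \<phi> t \<le> A * \<phi> (l * t)"
    if l: "1 \<le> l" "l * c \<le> c'" and t: "t \<ge> T" for l t
  proof -
    define s where "s = t / c"
    have s: "s \<ge> real n + 1"
    proof -
      have "(real n + 1) * c \<le> (real n + 1) * 2" using c by (intro mult_left_mono) auto
      then show ?thesis using t c by (auto simp: s_def T_def field_simps)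
    qed
    have t': "t = c * s" "l * t = (l * c) * s" using c by (auto simp: s_def)
    have "c * 1 \<le> c * l" using l c by (intro mult_left_mono) auto
    then have lc: "l * c \<in> {c..c'}" using l by (auto simp: mult.commute)
    have b: "\<phi> t \<le> (real n + 1) * \<phi> s" "\<phi> s \<le> (real n + 1) * \<phi> t"
      "\<phi> (l * t) \<le> (real n + 1) * \<phi> s" "\<phi> s \<le> (real n + 1) * \<phi> (l * t)"
      using cb[OF lc s] cb[of c, OF _ s] c by (auto simp: t' mult.assoc)
    have "\<phi> (l * t) \<le> (real n + 1) * ((real n + 1) * \<phi> t)"
      by (rule order.trans[OF b(3)]) (use b(2) in \<open>intro mult_left_mono; simp\<close>)
    moreover have "\<phi> t \<le> (real n + 1) * ((real n + 1) * \<phi> (l * t))"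
      by (rule order.trans[OF b(1)]) (use b(4) in \<open>intro mult_left_mono; simp\<close>)
    ultimately show ?thesis by (simp add: A_def power2_eq_square mult.assoc)
  qed
  have iter: "\<phi> (l ^ i * t) \<le> A ^ i * \<phi> t \<and> \<phi> t \<le> A ^ i * \<phi> (l ^ i * t)"
    if l: "1 \<le> l" "l * c \<le> c'" and t: "t \<ge> T" for l t i
  proof (induction i)
    case (Suc i)
    have T0: "T > 0" by (simp add: T_def)
    have "1 * t \<le> l ^ i * t" using l t T0 by (intro mult_right_mono) auto
    then have "l ^ i * t \<ge> T" using t by simp
    note s = small[OF l this]
    have "\<phi> (l ^ Suc i * t) \<le> A * \<phi> (l ^ i * t)" using s by (simp add: mult.assoc)
    also have "\<dots> \<le> A * (A ^ i * \<phi> t)" using Suc A by (intro mult_left_mono) auto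
    finally have 1: "\<phi> (l ^ Suc i * t) \<le> A ^ Suc i * \<phi> t" by (simp add: mult.assoc)
    have "\<phi> t \<le> A ^ i * \<phi> (l ^ i * t)" using Suc by simp
    also have "\<dots> \<le> A ^ i * (A * \<phi> (l ^ Suc i * t))" using s A by (intro mult_left_mono) (auto simp: mult.assoc)
    finally show ?case using 1 by (simp add: ac_simps)
  qed simp
  have "c' / c > 1" using c by simp
  then obtain k where k: "(c' / c) ^ k > 2" using real_arch_pow by blast
  then have k0: "k > 0" by (cases k) auto
  have large: "\<phi> (l * t) \<le> A ^ k * \<phi> t \<and> \<phi> t \<le> A ^ k * \<phi> (l * t)"
    if l: "l \<in> {1..2}" and t: "t \<ge> T" for l t
  proof -
    have e: "root k l ^ k = l" using l k0 by (simp add: real_root_pow_pos2)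
    have "root k l \<le> root k ((c' / c) ^ k)" using k l k0 by (intro real_root_le_mono) auto
    also have "\<dots> = c' / c" using c k0 by (simp add: real_root_power_cancel)
    finally have "root k l * c \<le> c'" using c by (simp add: field_simps)
    moreover have "1 \<le> root k l" using l k0 by simp
    ultimately show ?thesis using iter[of "root k l" t k] t by (simp add: e)
  qed
  have "bounded (\<phi> ` {0..2 * T})"
    by (intro compact_imp_bounded compact_continuous_image continuous_on_subset[OF cont]) auto
  then have "\<exists>M. \<forall>t\<in>{0..2 * T}. \<bar>\<phi> t\<bar> \<le> M"
    unfolding bounded_iff by simp
  then obtain M where M: "\<And>t. t \<in> {0..2 * T} \<Longrightarrow> \<bar>\<phi> t\<bar> \<le> M" by blast
  show ?thesis
  proof (rule that[of "max (A ^ k) M"])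
    show "max (A ^ k) M \<ge> 1" using A by (simp add: le_max_iff_disj)
    fix l t :: real assume l: "l \<in> {1..2}" and t: "t \<ge> 0"
    have p: "\<phi> t \<ge> 1" "\<phi> (l * t) \<ge> 1" using ge1 t l by auto
    show "\<phi> (l * t) \<le> max (A ^ k) M * \<phi> t \<and> \<phi> t \<le> max (A ^ k) M * \<phi> (l * t)"
    proof (cases "t \<ge> T")
      case True
      have "A ^ k * \<phi> t \<le> max (A ^ k) M * \<phi> t" "A ^ k * \<phi> (l * t) \<le> max (A ^ k) M * \<phi> (l * t)"
        using p by (auto intro!: mult_right_mono)
      with large[OF l True] show ?thesis by linarith
    next
      case False
      have "l * t \<le> 2 * T" using l t False by (intro mult_mono) auto
      moreover have "l * t \<ge> 0" "t \<le> 2 * T" using l t False by auto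
      ultimately have m: "\<phi> (l * t) \<le> M" "\<phi> t \<le> M" using M[of "l * t"] M[of t] t by auto
      have "M * 1 \<le> max (A ^ k) M * \<phi> t" "M * 1 \<le> max (A ^ k) M * \<phi> (l * t)"
        using p m by (intro mult_mono; auto)+
      with m show ?thesis by auto
    qed
  qed
qed

section \<open>Sequences that decay geometrically, as 1/\<phi> does at dyadic radii\<close>

lemma sum_lessThan_add:
  fixes f :: "nat \<Rightarrow> 'b::comm_monoid_add"
  shows "(\<Sum>j<m + n. f j) = (\<Sum>j<m. f j) + (\<Sum>i<n. f (m + i))"
  by (induction n) (simp_all add: add.assoc)

text \<open>\<open>a_down\<close> reflects the bounded variation of \<phi> over one scale,
  \<open>a_decay\<close> its positive index. A decay rate may always be enlarged, so \<rho> > 1/2 is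
  no restriction; it makes the sum of (2\<rho>)^j over j < M comparable to (2\<rho>)^M.\<close>

locale scale_seq =
  fixes a :: "nat \<Rightarrow> real" and B C \<rho> :: real
  assumes a_pos: "a j > 0" and B_ge: "B \<ge> 1" and C_ge: "C \<ge> 1" and rho: "1 / 2 < \<rho>" "\<rho> < 1"
    and a_down: "a j \<le> B * a (Suc j)" and a_decay: "a (j + i) \<le> C * \<rho> ^ i * a j"
begin

text \<open>The dyadic form of the integral of s^(\<gamma>-1)/\<phi>(s): the radii from
  2^(j/\<gamma>) to 2^((j+1)/\<gamma>) contribute about 2^j * a j.\<close>

definition S :: "nat \<Rightarrow> real" where
  "S N = (\<Sum>j\<le>N. 2 ^ j * a j)"

text \<open>For \<open>a j = 1 / \<phi> (2 powr (j / \<gamma>))\<close>, \<open>W N\<close> is comparable to the function of the theorem,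
  of which \<open>\<zeta>\<close> is an asymptotic inverse, at \<open>t = 2 powr (N / \<gamma>)\<close>.\<close>

definition W :: "nat \<Rightarrow> real" where
  "W N = 2 ^ N / S N"

lemma a_down_pow: "a j \<le> B ^ i * a (j + i)"
proof (induction i)
  case (Suc i)
  have "B ^ i * a (j + i) \<le> B ^ i * (B * a (Suc (j + i)))"
    using B_ge a_down by (intro mult_left_mono) auto
  with Suc show ?case by (simp add: ac_simps)
qed simp

lemma S_ge: "i \<le> N \<Longrightarrow> 2 ^ i * a i \<le> S N"
  unfolding S_def using a_pos by (intro member_le_sum[of i "{..N}" "\<lambda>j. 2 ^ j * a j"]) (auto simp: less_imp_le)

lemma S_pos: "S N > 0"
  using S_ge[of 0 N] a_pos[of 0] by simp

lemma W_pos: "W N > 0"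
  using S_pos by (simp add: W_def)

lemma summable_a: "summable a"
proof (rule summable_comparison_test')
  show "summable (\<lambda>i. (C * a 0) * \<rho> ^ i)" using rho by (intro summable_mult summable_geometric) auto
  show "norm (a i) \<le> C * a 0 * \<rho> ^ i" if "i \<ge> 0" for i
    using a_decay[of 0 i] a_pos[of i] by (simp add: ac_simps)
qed

lemma a_tail_le: "(\<Sum>i. a (i + N)) \<le> C / (1 - \<rho>) * a N"
proof -
  have "(\<Sum>i. a (i + N)) \<le> (\<Sum>i. (C * a N) * \<rho> ^ i)"
    using rho a_decay[of N]
    by (intro suminf_le summable_mult summable_geometric) (auto simp: summable_iff_shift summable_a ac_simps)
  also have "\<dots> = C / (1 - \<rho>) * a N"
    using rho by (subst suminf_mult) (auto simp: suminf_geometric)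
  finally show ?thesis .
qed

lemma S_Suc_le: "S (Suc N) \<le> (1 + 2 * C) * S N"
proof -
  have "a (Suc N) \<le> C * a N"
  proof -
    have "\<rho> * (C * a N) \<le> 1 * (C * a N)"
      using rho C_ge a_pos[of N] by (intro mult_right_mono) auto
    then show ?thesis using a_decay[of N 1] by (simp add: ac_simps)
  qed
  then have "2 ^ Suc N * a (Suc N) \<le> 2 * C * (2 ^ N * a N)" by simp
  also have "\<dots> \<le> 2 * C * S N" using S_ge[of N N] C_ge by (intro mult_left_mono) auto
  finally show ?thesis by (simp add: S_def algebra_simps)
qed

text \<open>Over M scales \<open>S\<close> grows at most like (2\<rho>)^M, hence by less than 2^M,
  and \<open>W\<close> gains any prescribed factor after a number of scales independent of N.
  Constants in time can thus be traded for a shift of scale, which costs only a power of the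
  doubling constant in volume.\<close>

lemma W_grow: "\<exists>M. \<forall>N. Q * W N \<le> W (N + M)"
proof -
  define E where "E = C + C / (2 * \<rho> - 1)"
  have E: "E > 0" using rho C_ge by (simp add: E_def add_pos_nonneg)
  have S: "S (N + M) \<le> E * (2 * \<rho>) ^ M * S N" for N M
  proof -
    \<comment> \<open>The first M terms are compared with \<open>a 0\<close>, which is at most
      \<open>S N\<close>; the others are the terms of \<open>S N\<close> shifted by M, each enlarged
      by at most C (2\<rho>)^M.\<close>
    have "S (N + M) = (\<Sum>j<M + Suc N. 2 ^ j * a j)"
      by (simp add: S_def lessThan_Suc_atMost add.commute)
    also have "\<dots> = (\<Sum>j<M. 2 ^ j * a j) + (\<Sum>i<Suc N. 2 ^ (M + i) * a (M + i))"
      by (rule sum_lessThan_add)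
    also have "(\<Sum>j<M. 2 ^ j * a j) \<le> (\<Sum>j<M. C * a 0 * (2 * \<rho>) ^ j)"
      using a_decay[of 0] by (intro sum_mono) (simp add: power_mult_distrib ac_simps)
    also have "\<dots> = C * a 0 * (((2 * \<rho>) ^ M - 1) / (2 * \<rho> - 1))"
      using rho geometric_sum[of "2 * \<rho>" M] by (simp only: sum_distrib_left[symmetric])
    also have "\<dots> \<le> C * S N * ((2 * \<rho>) ^ M / (2 * \<rho> - 1))"
      using one_le_power[of "2 * \<rho>" M] rho C_ge S_ge[of 0 N] a_pos[of 0] S_pos[of N]
      by (intro mult_mono divide_right_mono) (auto intro!: divide_nonneg_nonneg)
    also have "(\<Sum>i<Suc N. 2 ^ (M + i) * a (M + i)) \<le> (\<Sum>i<Suc N. C * (2 * \<rho>) ^ M * (2 ^ i * a i))"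
      using a_decay[of _ M] by (intro sum_mono) (simp add: power_mult_distrib power_add ac_simps)
    also have "\<dots> = C * (2 * \<rho>) ^ M * S N"
      by (simp add: S_def sum_distrib_left lessThan_Suc_atMost)
    finally show ?thesis by (simp add: E_def algebra_simps)
  qed
  obtain M where M: "\<rho> ^ M < 1 / ((\<bar>Q\<bar> + 1) * E)"
    using real_arch_pow_inv[of "1 / ((\<bar>Q\<bar> + 1) * E)" \<rho>] E rho by auto
  have "Q * W N \<le> W (N + M)" for N
  proof -
    have "Q * S (N + M) \<le> (\<bar>Q\<bar> + 1) * (E * (2 * \<rho>) ^ M * S N)"
      using S[of N M] S_pos[of "N + M"] by (intro mult_mono) auto
    also have "\<dots> = ((\<bar>Q\<bar> + 1) * E * \<rho> ^ M) * (2 ^ M * S N)" by (simp add: power_mult_distrib)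
    also have "\<dots> \<le> 1 * (2 ^ M * S N)"
    proof (intro mult_right_mono)
      have "(\<bar>Q\<bar> + 1) * E > 0" using E by (intro mult_pos_pos) auto
      then show "(\<bar>Q\<bar> + 1) * E * \<rho> ^ M \<le> 1"
        using M pos_less_divide_eq[of "(\<bar>Q\<bar> + 1) * E" "\<rho> ^ M" 1] by (simp add: mult.commute)
    qed (use S_pos[of N] in simp)
    finally have "Q * S (N + M) \<le> 2 ^ M * S N" by simp
    then show ?thesis using S_pos[of N] S_pos[of "N + M"]
      by (simp add: W_def field_simps power_add)
  qed
  then show ?thesis by blast
qed

end

lemma two_powr_root_bounds:
  fixes \<gamma> :: real
  assumes "\<gamma> > 1"
  shows "1 < 2 powr (1 / \<gamma>)" "2 powr (1 / \<gamma>) \<le> 2"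
proof -
  have "2 powr (1 / \<gamma>) \<le> (2::real) powr 1" using assms by (intro powr_mono) auto
  moreover have "(2::real) powr 0 < 2 powr (1 / \<gamma>)" using assms by (intro powr_less_mono) auto
  ultimately show "1 < 2 powr (1 / \<gamma>)" "2 powr (1 / \<gamma>) \<le> 2" by auto
qed

lemma dyadic_scale:
  fixes \<gamma> t :: real
  assumes "\<gamma> > 1" "t \<ge> 1"
  obtains j :: nat where "2 powr (real j / \<gamma>) \<le> t" "t \<le> 2 powr (real (Suc j) / \<gamma>)"
proof -
  define j where "j = nat \<lfloor>\<gamma> * log 2 t\<rfloor>"
  have "\<gamma> * log 2 t \<ge> 0" using assms by simp
  then have jb: "real j \<le> \<gamma> * log 2 t" "\<gamma> * log 2 t \<le> real (Suc j)" unfolding j_def by linarith+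
  have tl: "2 powr (\<gamma> * log 2 t / \<gamma>) = t" using assms by simp
  have "2 powr (real j / \<gamma>) \<le> t" "t \<le> 2 powr (real (Suc j) / \<gamma>)"
    using jb assms by (subst tl[symmetric], intro powr_mono divide_right_mono; simp)+
  then show ?thesis by (rule that)
qed

lemma scale_seq_regularly_varying:
  fixes \<phi> :: "real \<Rightarrow> real" and \<gamma> :: real
  assumes ge1: "\<forall>t\<ge>0. \<phi> t \<ge> 1" and rv: "regularly_varying \<phi> \<beta>" "\<beta> > 0" and \<gamma>: "\<gamma> > 1"
    and B: "B \<ge> 1" "\<And>l t. l \<in> {1..2} \<Longrightarrow> t \<ge> 0 \<Longrightarrow> \<phi> (l * t) \<le> B * \<phi> t \<and> \<phi> t \<le> B * \<phi> (l * t)"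
  obtains C \<rho> where "scale_seq (\<lambda>j. 1 / \<phi> (2 powr (real j / \<gamma>))) B C \<rho>"
proof -
  define r where "r j = 2 powr (real j / \<gamma>)" for j :: nat
  define a where "a j = 1 / \<phi> (r j)" for j
  define l where "l = 2 powr (1 / \<gamma>)"
  have l: "l \<in> {1..2}" "l > 1" using two_powr_root_bounds[OF \<gamma>] by (auto simp: l_def)
  have r_Suc: "r (Suc j) = l * r j" for j
    by (simp add: r_def l_def powr_add[symmetric] add_divide_distrib)
  have r_pos: "r j > 0" for j by (simp add: r_def)
  have phi_pos: "\<phi> (r j) \<ge> 1" for j using ge1 r_pos[of j] by (auto simp: less_imp_le)
  have a_pos: "a j > 0" for j using phi_pos[of j] by (simp add: a_def)
  have ab: "a j \<le> B * a (Suc j)" "a (Suc j) \<le> B * a j" for j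
    using B(2)[OF l(1), of "r j"] r_pos[of j] phi_pos[of j] phi_pos[of "Suc j"]
    by (auto simp: a_def r_Suc field_simps less_imp_le)
  have "((\<lambda>j. \<phi> (l * r j) / \<phi> (r j)) \<longlongrightarrow> l powr \<beta>) sequentially"
  proof (rule filterlim_compose[of "\<lambda>t. \<phi> (l * t) / \<phi> t" _ at_top r])
    show "((\<lambda>t. \<phi> (l * t) / \<phi> t) \<longlongrightarrow> l powr \<beta>) at_top"
      using rv l by (auto simp: regularly_varying_def)
    have "filterlim (\<lambda>j. l ^ j) at_top sequentially"
      unfolding filterlim_at_top eventually_sequentially
    proof
      fix Z
      obtain k where "Z < l ^ k" using real_arch_pow[OF l(2)] by blast
      moreover have "l ^ k \<le> l ^ j" if "j \<ge> k" for j
        using that l(2) by (intro power_increasing) auto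
      ultimately show "\<exists>k. \<forall>j\<ge>k. Z \<le> l ^ j" by (meson less_le_trans less_imp_le)
    qed
    moreover have "r j = l ^ j" for j
      by (induction j) (simp_all add: r_Suc, simp add: r_def)
    then have "r = (\<lambda>j. l ^ j)" by (intro ext)
    ultimately show "filterlim r at_top sequentially" by simp
  qed
  moreover have "l powr \<beta> > 1" using l(2) rv(2) by (simp add: gr_one_powr)
  ultimately have lim: "((\<lambda>j. \<phi> (r j) / \<phi> (l * r j)) \<longlongrightarrow> 1 / l powr \<beta>) sequentially"
    using tendsto_divide[OF tendsto_const[of 1], of "\<lambda>j. \<phi> (l * r j) / \<phi> (r j)"] by fastforce
  have "1 / l powr \<beta> < 1"
    using divide_less_eq_1_pos[of "l powr \<beta>" 1] \<open>l powr \<beta> > 1\<close> by linarith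
  \<comment> \<open>The ratios of consecutive terms of \<open>a\<close> tend to l^(-\<beta>), which
    is below 1 as \<beta> > 0; any \<rho> strictly in between bounds them eventually.\<close>
  then obtain \<rho> where \<rho>: "max (1 / 2) (1 / l powr \<beta>) < \<rho>" "\<rho> < 1"
    using dense[of "max (1/2) (1 / l powr \<beta>)" 1] by auto
  have "eventually (\<lambda>j. \<phi> (r j) / \<phi> (l * r j) < \<rho>) sequentially"
    using order_tendstoD(2)[OF lim] \<rho> by auto
  then obtain n0 where n0: "\<And>j. j \<ge> n0 \<Longrightarrow> \<phi> (r j) / \<phi> (l * r j) < \<rho>"
    unfolding eventually_sequentially by blast
  have ev: "a (Suc j) \<le> \<rho> * a j" if "j \<ge> n0" for j
    using n0[OF that] phi_pos[of j] phi_pos[of "Suc j"] by (simp add: a_def r_Suc field_simps)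
  \<comment> \<open>The weight \<open>K ^ (n0 - j)\<close> turns the crude bound by B into a
    contraction by \<rho> for the first n0 terms as well. The truncated subtraction makes the weight
    1 from n0 on, and the constant \<open>K ^ n0\<close> pays for it.\<close>
  define K where "K = B / \<rho>"
  have K: "K \<ge> 1" using B \<rho> by (auto simp: K_def field_simps)
  have step: "a (Suc j) * K ^ (n0 - Suc j) \<le> \<rho> * (a j * K ^ (n0 - j))" for j
  proof (cases "j < n0")
    case True
    then have "n0 - j = Suc (n0 - Suc j)" by simp
    then have "\<rho> * (a j * K ^ (n0 - j)) = (B * a j) * K ^ (n0 - Suc j)" using \<rho> by (simp add: K_def)
    moreover have "a (Suc j) * K ^ (n0 - Suc j) \<le> (B * a j) * K ^ (n0 - Suc j)"
      using ab(2)[of j] K by (intro mult_right_mono) auto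
    ultimately show ?thesis by (simp only:)
  qed (use ev in auto)
  have decay: "a (j + i) * K ^ (n0 - (j + i)) \<le> \<rho> ^ i * (a j * K ^ (n0 - j))" for i j
  proof (induction i)
    case (Suc i)
    have "a (j + Suc i) * K ^ (n0 - (j + Suc i)) \<le> \<rho> * (a (j + i) * K ^ (n0 - (j + i)))"
      using step[of "j + i"] by simp
    also have "\<dots> \<le> \<rho> * (\<rho> ^ i * (a j * K ^ (n0 - j)))" using Suc \<rho> by (intro mult_left_mono) auto
    finally show ?case by simp
  qed simp
  have "scale_seq a B (K ^ n0) \<rho>"
  proof
    fix i j
    have "a (j + i) * 1 \<le> a (j + i) * K ^ (n0 - (j + i))"
      using a_pos K by (intro mult_left_mono) (auto simp: less_imp_le)
    also have "\<dots> \<le> \<rho> ^ i * (a j * K ^ (n0 - j))" by (rule decay)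
    also have "\<dots> \<le> \<rho> ^ i * (a j * K ^ n0)"
      using \<rho> a_pos[of j] K by (intro mult_left_mono power_increasing) auto
    finally show "a (j + i) \<le> K ^ n0 * \<rho> ^ i * a j" by (simp add: ac_simps)
  qed (use a_pos B K ab \<rho> in auto)
  then show ?thesis using that unfolding a_def[abs_def] r_def by blast
qed

text \<open>On the block between consecutive radii \<phi> varies by at most the factor B, and
  r^(\<gamma>-1) times the length of the block is of order 2^j. Both inequalities are then
  accumulated block by block.\<close>

lemma integral_scale_bound:
  fixes \<phi> :: "real \<Rightarrow> real" and \<gamma> :: real
  assumes ge1: "\<forall>t\<ge>0. \<phi> t \<ge> 1" and cont: "continuous_on {0..} \<phi>" and \<gamma>: "\<gamma> > 1"
    and Bd: "\<And>l t. l \<in> {1..2} \<Longrightarrow> t \<ge> 0 \<Longrightarrow> \<phi> (l * t) \<le> B * \<phi> t \<and> \<phi> t \<le> B * \<phi> (l * t)"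
    and seq: "scale_seq (\<lambda>j. 1 / \<phi> (2 powr (real j / \<gamma>))) B C \<rho>"
  obtains D where "D > 0" "\<And>j t. 2 powr (real j / \<gamma>) \<le> t \<Longrightarrow> t \<le> 2 powr (real (Suc j) / \<gamma>) \<Longrightarrow>
      integral {0..t} (\<lambda>s. s powr (\<gamma> - 1) / \<phi> s) \<le> D * scale_seq.S (\<lambda>j. 1 / \<phi> (2 powr (real j / \<gamma>))) j \<and>
      scale_seq.S (\<lambda>j. 1 / \<phi> (2 powr (real j / \<gamma>))) j \<le> D * integral {0..t} (\<lambda>s. s powr (\<gamma> - 1) / \<phi> s)"
proof -
  define r where "r j = 2 powr (real j / \<gamma>)" for j :: nat
  define a where "a j = 1 / \<phi> (r j)" for j
  define g where "g s = s powr (\<gamma> - 1) / \<phi> s" for s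
  define I where "I t = integral {0..t} g" for t
  have a_eq: "(\<lambda>j. 1 / \<phi> (2 powr (real j / \<gamma>))) = a" by (simp add: a_def[abs_def] r_def)
  interpret scale_seq a B C \<rho> using seq by (simp only: a_eq)
  define l where "l = 2 powr (1 / \<gamma>)"
  have l: "1 < l" "l \<le> 2" using two_powr_root_bounds[OF \<gamma>] by (auto simp: l_def)
  have r_Suc: "r (Suc j) = l * r j" for j
    by (simp add: r_def l_def powr_add[symmetric] add_divide_distrib)
  have r_pos: "r j > 0" for j by (simp add: r_def)
  have r_pow: "r j powr \<gamma> = 2 ^ j" for j
    using \<gamma> by (simp add: r_def powr_powr powr_realpow)
  have phi: "\<phi> s \<ge> 1" if "s \<ge> 0" for s using ge1 that by simp
  have gcont: "continuous_on {0..T} g" for T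
    unfolding g_def
  proof (intro continuous_on_divide continuous_on_powr' continuous_on_id continuous_on_const)
    show "continuous_on {0..T} \<phi>" by (rule continuous_on_subset[OF cont]) auto
    show "\<forall>s\<in>{0..T}. \<phi> s \<noteq> 0" using phi by force
  qed (use \<gamma> in auto)
  have gint: "g integrable_on {s..t}" if "0 \<le> s" for s t
    by (intro integrable_continuous_interval continuous_on_subset[OF gcont[of t]]) (use that in auto)
  have g_nonneg: "g s \<ge> 0" if "s \<ge> 0" for s using phi[OF that] by (simp add: g_def)
  have I_mono: "I s \<le> I t" if "0 \<le> s" "s \<le> t" for s t
    unfolding I_def using that g_nonneg by (intro integral_subset_le gint) auto
  have combine: "I t = I s + integral {s..t} g" if "0 \<le> s" "s \<le> t" for s t
    unfolding I_def using that by (intro Henstock_Kurzweil_Integration.integral_combine[symmetric] gint) auto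
  have block: "(l - 1) / B * (2 ^ j * a j) \<le> integral {r j..r (Suc j)} g"
    "integral {r j..r (Suc j)} g \<le> 2 * B * (2 ^ j * a j)" for j
  proof -
    have bounds: "r j powr (\<gamma> - 1) * (a j / B) \<le> g s \<and> g s \<le> r (Suc j) powr (\<gamma> - 1) * (B * a j)"
      if s: "s \<in> {r j..r (Suc j)}" for s
    proof -
      have "s / r j \<in> {1..2}"
      proof -
        have "s \<le> l * r j" "r j \<le> s" using s by (auto simp: r_Suc)
        moreover have "l * r j \<le> 2 * r j" using l r_pos[of j] by simp
        ultimately have "s \<le> 2 * r j" "r j \<le> s" by auto
        then show ?thesis using r_pos[of j] by (auto simp: field_simps)
      qed
      from Bd[OF this, of "r j"] have p: "\<phi> s \<le> B * \<phi> (r j)" "\<phi> (r j) \<le> B * \<phi> s"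
        using r_pos[of j] by (auto simp: less_imp_le)
      have ps: "\<phi> s \<ge> 1" "\<phi> (r j) \<ge> 1" using phi s r_pos[of j] by (auto simp: less_imp_le)
      have s0: "s > 0" using s r_pos[of j] by auto
      have "a j / B \<le> 1 / \<phi> s" "1 / \<phi> s \<le> B * a j"
        using p ps B_ge by (auto simp: a_def field_simps)
      moreover have "r j powr (\<gamma> - 1) \<le> s powr (\<gamma> - 1)" "s powr (\<gamma> - 1) \<le> r (Suc j) powr (\<gamma> - 1)"
        using s \<gamma> r_pos[of j] s0 by (auto intro!: powr_mono2)
      ultimately have "r j powr (\<gamma> - 1) * (a j / B) \<le> s powr (\<gamma> - 1) * (1 / \<phi> s)"
        "s powr (\<gamma> - 1) * (1 / \<phi> s) \<le> r (Suc j) powr (\<gamma> - 1) * (B * a j)"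
        using a_pos[of j] B_ge ps by (intro mult_mono; simp add: less_imp_le)+
      then show ?thesis by (simp add: g_def)
    qed
    have rr: "r j \<le> r (Suc j)" using l r_pos[of j] by (simp add: r_Suc)
    have i: "g integrable_on {r j..r (Suc j)}" using r_pos[of j] by (intro gint) auto
    have pw: "r j powr (\<gamma> - 1) * r j = 2 ^ j" for j
      using r_pos[of j] by (simp add: r_pow[symmetric] powr_diff)
    have "integral {r j..r (Suc j)} (\<lambda>_. r j powr (\<gamma> - 1) * (a j / B)) \<le> integral {r j..r (Suc j)} g"
      using bounds i by (intro integral_le) auto
    then have "(r j powr (\<gamma> - 1) * (a j / B)) * ((l - 1) * r j) \<le> integral {r j..r (Suc j)} g"
      using rr by (simp add: r_Suc algebra_simps)
    moreover have "(r j powr (\<gamma> - 1) * (a j / B)) * ((l - 1) * r j) = (l - 1) / B * ((r j powr (\<gamma> - 1) * r j) * a j)"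
      by simp
    ultimately show "(l - 1) / B * (2 ^ j * a j) \<le> integral {r j..r (Suc j)} g" by (simp only: pw)
    have "integral {r j..r (Suc j)} g \<le> integral {r j..r (Suc j)} (\<lambda>_. r (Suc j) powr (\<gamma> - 1) * (B * a j))"
      using bounds i by (intro integral_le) auto
    also have "\<dots> = (r (Suc j) powr (\<gamma> - 1) * (B * a j)) * (r (Suc j) - r j)"
      using rr by simp
    also have "\<dots> \<le> (r (Suc j) powr (\<gamma> - 1) * (B * a j)) * r (Suc j)"
      using r_pos[of j] a_pos[of j] B_ge by (intro mult_left_mono) auto
    also have "\<dots> = (r (Suc j) powr (\<gamma> - 1) * r (Suc j)) * (B * a j)" by simp
    also have "\<dots> = 2 * B * (2 ^ j * a j)" by (simp only: pw) simp
    finally show "integral {r j..r (Suc j)} g \<le> 2 * B * (2 ^ j * a j)" .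
  qed
  have r0: "r 0 = 1" by (simp add: r_def)
  have I_step: "I (r (Suc j)) = I (r j) + integral {r j..r (Suc j)} g" for j
    using r_pos[of j] l by (intro combine) (auto simp: r_Suc)
  have I0: "I 1 > 0"
  proof -
    define e where "e = (1 / 2) powr (\<gamma> - 1) / (B * \<phi> 1)"
    have e: "e > 0" using B_ge phi[of 1] by (simp add: e_def)
    have "e \<le> g s" if s: "s \<in> {1 / 2..1}" for s
    proof -
      have "\<phi> s \<le> B * \<phi> 1" using Bd[of "1 / s" s] s by (auto simp: field_simps)
      moreover have "(1 / 2) powr (\<gamma> - 1) \<le> s powr (\<gamma> - 1)" using s \<gamma> by (intro powr_mono2) auto
      ultimately show ?thesis unfolding e_def g_def using phi[of s] s by (intro frac_le) auto
    qed
    then have "integral {1 / 2..1::real} (\<lambda>_. e) \<le> integral {1 / 2..1} g"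
      by (intro integral_le gint) auto
    then have "integral {1 / 2..1} g > 0" using e by simp
    moreover have "I (1 / 2) \<ge> 0" unfolding I_def by (intro integral_nonneg gint) (auto intro: g_nonneg)
    ultimately show ?thesis using combine[of "1 / 2" 1] by simp
  qed
  \<comment> \<open>\<open>I 1 / a 0\<close> serves the initial piece [0,1], below all dyadic radii.
    In the square, one B comes from the block bound and one from replacing \<open>a j\<close> by
    \<open>a (Suc j)\<close>.\<close>
  define D1 where "D1 = max (B\<^sup>2) (I 1 / a 0)"
  have up: "I (r j) \<le> D1 * S j" for j
  proof (induction j)
    case 0
    have "I 1 = I 1 / a 0 * a 0" using a_pos[of 0] by simp
    also have "\<dots> \<le> D1 * a 0" using a_pos[of 0] by (intro mult_right_mono) (auto simp: D1_def)
    finally show ?case by (simp add: r0 S_def)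
  next
    case (Suc j)
    have "2 * B * (2 ^ j * a j) \<le> 2 * B * (2 ^ j * (B * a (Suc j)))"
      using a_down[of j] B_ge by (intro mult_left_mono) auto
    also have "\<dots> = B\<^sup>2 * (2 ^ Suc j * a (Suc j))" by (simp add: power2_eq_square)
    also have "\<dots> \<le> D1 * (2 ^ Suc j * a (Suc j))"
      using a_pos[of "Suc j"] by (intro mult_right_mono) (auto simp: D1_def)
    finally have "integral {r j..r (Suc j)} g \<le> D1 * (2 ^ Suc j * a (Suc j))" using block(2)[of j] by linarith
    then show ?case using Suc I_step[of j] by (simp add: S_def distrib_left)
  qed
  \<comment> \<open>The mirror image of \<open>D1\<close>: the factor C bounds
    \<open>a (Suc j)\<close> by \<open>a j\<close>, and B / (l - 1) inverts the lower bound on a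
    block.\<close>
  define D2 where "D2 = max (2 * C * B / (l - 1)) (a 0 / I 1)"
  have D2: "D2 > 0" using a_pos[of 0] I0 by (simp add: D2_def less_max_iff_disj)
  have low: "S j \<le> D2 * I (r j)" for j
  proof (induction j)
    case 0
    have "a 0 = a 0 / I 1 * I 1" using I0 by simp
    also have "\<dots> \<le> D2 * I 1" using I0 by (intro mult_right_mono) (auto simp: D2_def)
    finally show ?case by (simp add: r0 S_def)
  next
    case (Suc j)
    have "\<rho> * (C * a j) \<le> 1 * (C * a j)"
      using rho C_ge a_pos[of j] by (intro mult_right_mono) auto
    then have "2 ^ Suc j * a (Suc j) \<le> 2 ^ Suc j * (C * a j)"
      using a_decay[of j 1] by (intro mult_left_mono) (auto simp: ac_simps)
    also have "\<dots> = 2 * C * B / (l - 1) * ((l - 1) / B * (2 ^ j * a j))" using l B_ge by simp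
    also have "\<dots> \<le> D2 * ((l - 1) / B * (2 ^ j * a j))"
      using l B_ge a_pos[of j] by (intro mult_right_mono) (auto simp: D2_def)
    also have "\<dots> \<le> D2 * integral {r j..r (Suc j)} g"
      using block(1)[of j] D2 by (intro mult_left_mono) auto
    finally show ?case using Suc I_step[of j] by (simp add: S_def distrib_left)
  qed
  have D1: "D1 > 0" using B_ge by (simp add: D1_def less_max_iff_disj)
  define D where "D = max (D1 * (1 + 2 * C)) D2"
  have "I t \<le> D * S j \<and> S j \<le> D * I t" if t: "r j \<le> t" "t \<le> r (Suc j)" for j t
  proof
    have t0: "0 \<le> t" using r_pos[of j] t by linarith
    have "I t \<le> I (r (Suc j))" using t0 t by (intro I_mono) auto
    also have "\<dots> \<le> D1 * S (Suc j)" by (rule up)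
    also have "\<dots> \<le> D1 * ((1 + 2 * C) * S j)" using D1 S_Suc_le by (intro mult_left_mono) auto
    also have "\<dots> = (D1 * (1 + 2 * C)) * S j" by simp
    also have "\<dots> \<le> D * S j" using S_pos[of j] by (intro mult_right_mono) (auto simp: D_def)
    finally show "I t \<le> D * S j" .
    have "S j \<le> D2 * I (r j)" by (rule low)
    also have "\<dots> \<le> D2 * I t" using D2 t r_pos[of j] by (intro mult_left_mono I_mono) auto
    also have "\<dots> \<le> D * I t"
      unfolding I_def using t0 by (intro mult_right_mono integral_nonneg gint) (auto simp: D_def intro: g_nonneg)
    finally show "S j \<le> D * I t" .
  qed
  moreover have "D > 0" using D2 by (simp add: D_def less_max_iff_disj)
  ultimately show ?thesis using that[of D] by (simp add: a_eq I_def g_def[abs_def] r_def)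
qed

text \<open>At the scale j of \<zeta>(n), the power \<zeta>(n)^\<gamma> is 2^j up to a factor 2 and
  the integral is \<open>S j\<close> up to a constant, so their quotient, which is asymptotic to n,
  is comparable to \<open>W j\<close>.\<close>

lemma asymptotic_inverse_scale:
  fixes \<phi> \<zeta> :: "real \<Rightarrow> real" and \<gamma> :: real
  assumes ge1: "\<forall>t\<ge>0. \<phi> t \<ge> 1" and cont: "continuous_on {0..} \<phi>" and \<gamma>: "\<gamma> > 1"
    and Bd: "\<And>l t. l \<in> {1..2} \<Longrightarrow> t \<ge> 0 \<Longrightarrow> \<phi> (l * t) \<le> B * \<phi> t \<and> \<phi> t \<le> B * \<phi> (l * t)"
    and seq: "scale_seq (\<lambda>j. 1 / \<phi> (2 powr (real j / \<gamma>))) B C \<rho>"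
    and zeta: "\<forall>t\<ge>0. \<zeta> t \<ge> 1"
    and inv: "(\<lambda>t. \<zeta> t powr \<gamma> / integral {0..\<zeta> t} (\<lambda>s. s powr (\<gamma> - 1) / \<phi> s)) \<sim>[at_top] (\<lambda>t. t)"
  shows "\<exists>D>0. \<exists>n0. \<forall>n\<ge>n0. \<exists>j. 2 powr (real j / \<gamma>) \<le> \<zeta> (real n) \<and>
      \<zeta> (real n) \<le> 2 powr (real (Suc j) / \<gamma>) \<and>
      scale_seq.W (\<lambda>j. 1 / \<phi> (2 powr (real j / \<gamma>))) j \<le> D * real n \<and>
      real n \<le> D * scale_seq.W (\<lambda>j. 1 / \<phi> (2 powr (real j / \<gamma>))) j"
proof -
  interpret scale_seq "\<lambda>j. 1 / \<phi> (2 powr (real j / \<gamma>))" B C \<rho> by (rule seq)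
  define I where "I t = integral {0..t} (\<lambda>s. s powr (\<gamma> - 1) / \<phi> s)" for t
  obtain D where D: "D > 0" and ID: "\<And>j t. 2 powr (real j / \<gamma>) \<le> t \<Longrightarrow> t \<le> 2 powr (real (Suc j) / \<gamma>) \<Longrightarrow>
      I t \<le> D * S j \<and> S j \<le> D * I t"
    by (rule integral_scale_bound[OF ge1 cont \<gamma> Bd seq, folded I_def]) blast+
  define X where "X t = \<zeta> t powr \<gamma> / I (\<zeta> t)" for t
  \<comment> \<open>The conditional is the 0/0 convention of asymptotic equivalence; it is void for
    t > 0.\<close>
  have "((\<lambda>t. if X t = 0 \<and> t = 0 then 1 else X t / t) \<longlongrightarrow> 1) at_top"
    using inv unfolding asymp_equiv_def I_def X_def .
  then have "eventually (\<lambda>t. (if X t = 0 \<and> t = 0 then 1 else X t / t) \<in> {1/2<..<2}) at_top"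
    by (rule topological_tendstoD) auto
  with eventually_gt_at_top[of 0] have "eventually (\<lambda>t. t > 0 \<and> t / 2 \<le> X t \<and> X t \<le> 2 * t) at_top"
    by eventually_elim (auto simp: field_simps)
  then obtain T where T: "\<And>t. t \<ge> T \<Longrightarrow> t > 0 \<and> t / 2 \<le> \<zeta> t powr \<gamma> / I (\<zeta> t) \<and> \<zeta> t powr \<gamma> / I (\<zeta> t) \<le> 2 * t"
    unfolding eventually_at_top_linorder X_def by blast
  obtain n0 :: nat where n0: "T \<le> n0" using real_arch_simple by blast
  \<comment> \<open>In the 4, one factor 2 is the asymptotic error and the other the ratio of
    consecutive scales 2^j.\<close>
  have "\<exists>j. 2 powr (real j / \<gamma>) \<le> \<zeta> (real n) \<and> \<zeta> (real n) \<le> 2 powr (real (Suc j) / \<gamma>) \<and>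
      W j \<le> 4 * D * real n \<and> real n \<le> 4 * D * W j" if n: "n \<ge> n0" for n
  proof -
    define z where "z = \<zeta> (real n)"
    have z: "z \<ge> 1" using zeta by (simp add: z_def)
    have Tn: "real n / 2 \<le> z powr \<gamma> / I z" "z powr \<gamma> / I z \<le> 2 * real n"
      using T[of "real n"] n n0 by (auto simp: z_def)
    obtain j where zb: "2 powr (real j / \<gamma>) \<le> z" "z \<le> 2 powr (real (Suc j) / \<gamma>)"
      using dyadic_scale[OF \<gamma> z] by blast
    have zg: "2 ^ j \<le> z powr \<gamma>" "z powr \<gamma> \<le> 2 * 2 ^ j"
    proof -
      have "(2 powr (real j / \<gamma>)) powr \<gamma> \<le> z powr \<gamma>" "z powr \<gamma> \<le> (2 powr (real (Suc j) / \<gamma>)) powr \<gamma>"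
        using zb \<gamma> z by (auto intro!: powr_mono2)
      moreover have "(2 powr (real i / \<gamma>)) powr \<gamma> = 2 ^ i" for i
        using \<gamma> by (simp add: powr_powr powr_realpow)
      ultimately show "2 ^ j \<le> z powr \<gamma>" "z powr \<gamma> \<le> 2 * 2 ^ j"
        by (simp_all only: power_Suc)
    qed
    have Ib: "I z \<le> D * S j" "S j \<le> D * I z" using ID[OF zb] by auto
    have Ip: "I z > 0" using less_le_trans[OF S_pos Ib(2)] D by (simp add: zero_less_mult_iff)
    have "2 ^ j / (D * S j) \<le> z powr \<gamma> / I z"
      using zg Ib Ip by (intro frac_le) auto
    from order.trans[OF this Tn(2)] have 1: "W j \<le> 2 * D * real n"
      using D S_pos[of j] by (simp add: W_def field_simps)
    have "z powr \<gamma> / I z \<le> (2 * 2 ^ j) / (S j / D)"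
      using zg Ib D S_pos[of j] by (intro frac_le) (auto simp: field_simps)
    from order.trans[OF Tn(1) this] have 2: "real n \<le> 4 * D * W j"
      using D S_pos[of j] by (simp add: W_def field_simps)
    have "2 * D * real n \<le> 4 * D * real n" using D by (intro mult_right_mono) auto
    then show ?thesis
      using zb 1 2 unfolding z_def by (intro exI[of _ j] conjI) linarith+
  qed
  moreover have "4 * D > 0" using D by simp
  ultimately show ?thesis by blast
qed

section \<open>Comparison of a jump kernel with a subordinated walk\<close>

context vertex_measure
begin

text \<open>A pointwise bound on the kernel bounds the norm from l^1 to l^\<infinity>; integrating
  against f once more produces the second mass.\<close>

lemma pairing_kop_funpow_le_sup:
  assumes k: "sym_kernel k 1" and M: "\<And>x y. kpow k n x y \<le> M"
  shows "pairing ((kop k ^^ n) f) f \<le> M * (pairing (\<lambda>_. 1) f * pairing (\<lambda>_. 1) f)"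
proof -
  have "(kop k ^^ n) f y \<le> M * pairing (\<lambda>_. 1) f" for y
  proof -
    have "(kop k ^^ n) f y = pairing f ((kop k ^^ n) (delta y))"
      by (simp add: pairing_kop_funpow[OF k, symmetric] pairing_delta)
    also have "\<dots> \<le> pairing f (\<lambda>_. M)"
      using M by (intro pairing_mono) (auto simp: kpow_def)
    finally show ?thesis by (simp add: pairing_commute[of f] pairing_const[of M])
  qed
  then have "pairing ((kop k ^^ n) f) f \<le> pairing (\<lambda>_. M * pairing (\<lambda>_. 1) f) f"
    by (intro pairing_mono) auto
  then show ?thesis by (simp add: pairing_const[of "M * _"] mult.assoc)
qed

text \<open>k_2n(x,y) is the pairing of k^n \<open>delta x\<close> with k^n \<open>delta y\<close>.
  This is how a bound on the diagonal, all that \<psi> sees, controls the whole kernel.\<close>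

lemma kpow_even_le_diagonal:
  assumes k: "sym_kernel k 1"
  shows "2 * kpow k (2 * n) x y \<le> kpow k (2 * n) x x + kpow k (2 * n) y y"
proof -
  have "kpow k (2 * n) y x = pairing ((kop k ^^ n) (delta x)) ((kop k ^^ n) (delta y))" for x y
    by (simp add: pairing_kop_funpow_add[OF k] pairing_delta kpow_def mult_2)
  then show ?thesis unfolding kpow_sym[OF k, of "2 * n" x y] by (simp only: pairing_le)
qed

lemma fin_mass_funpow:
  assumes k: "sym_kernel k 1" and f: "fin_mass f"
  shows "fin_mass ((kop k ^^ n) f)"
proof -
  have "pairing (\<lambda>_. 1) ((kop k ^^ n) f) = pairing (\<lambda>_. 1) f"
    by (simp add: pairing_kop_funpow[OF k, symmetric] kop_funpow_one[OF k])
  then show ?thesis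
    using f kop_funpow_bound[OF k] unfolding fin_mass_def by metis
qed

lemma pairing_one_funpow_delta:
  assumes k: "sym_kernel k 1"
  shows "pairing (\<lambda>_. 1) ((kop k ^^ n) (delta x)) = 1"
  by (simp add: pairing_kop_funpow[OF k, symmetric] kop_funpow_one[OF k] pairing_delta)

lemma fin_mass_delta: "fin_mass (delta x)"
  unfolding fin_mass_def
proof
  show "\<exists>B. B \<noteq> top \<and> (\<forall>y. delta x y \<le> B)"
    using m_nonzero[of x]
    by (intro exI[of _ "1 / m x"]) (auto simp: delta_def indicator_def ennreal_divide_eq_top_iff)
qed (simp add: pairing_delta)

lemma fin_mass_add: "fin_mass f \<Longrightarrow> fin_mass g \<Longrightarrow> fin_mass (\<lambda>x. f x + g x)"
proof -
  assume f: "fin_mass f" and g: "fin_mass g"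
  obtain F G where "F \<noteq> top" "G \<noteq> top" "\<And>x. f x \<le> F" "\<And>x. g x \<le> G"
    using f g unfolding fin_mass_def by blast
  then have "\<exists>B. B \<noteq> top \<and> (\<forall>x. f x + g x \<le> B)"
    by (intro exI[of _ "F + G"]) (auto intro: add_mono)
  moreover have "pairing (\<lambda>_. 1) (\<lambda>x. f x + g x) \<noteq> top"
    using f g by (simp add: fin_mass_def pairing_add2)
  ultimately show ?thesis by (simp add: fin_mass_def)
qed

lemma corr_delta: "corr k (delta x) n = enn2real (kpow k n x x)"
  by (simp add: corr_def kpow_def pairing_delta)

end

lemma suminf_ennreal_mult:
  fixes a e :: "nat \<Rightarrow> real"
  assumes "summable a" "\<And>i. 0 \<le> a i" "\<And>i. 0 \<le> e i" "\<And>i. e i \<le> M"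
  shows "(\<Sum>i. ennreal (a i) * ennreal (e i)) = ennreal (\<Sum>i. a i * e i)"
    and "summable (\<lambda>i. a i * e i)"
proof -
  show s: "summable (\<lambda>i. a i * e i)"
    by (rule summable_comparison_test'[of "\<lambda>i. a i * M"])
      (use assms in \<open>auto intro!: summable_mult2 mult_left_mono simp: abs_mult\<close>)
  show "(\<Sum>i. ennreal (a i) * ennreal (e i)) = ennreal (\<Sum>i. a i * e i)"
    using assms s by (simp add: ennreal_mult[symmetric] suminf_ennreal2)
qed

lemma ennreal_affine_leD:
  fixes q X Y z e :: real
  assumes "q \<ge> 0" "X \<ge> 0" "Y \<ge> 0" "z \<ge> 0" "e \<ge> 0"
    and "ennreal z + ennreal q * ennreal X * ennreal e \<le> ennreal q * ennreal Y + ennreal e"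
  shows "z + q * X * e \<le> q * Y + e"
proof -
  have "ennreal (z + q * X * e) \<le> ennreal (q * Y + e)"
    using assms by (simp add: ennreal_mult ennreal_plus)
  then show ?thesis using assms by (subst (asm) ennreal_le_iff) auto
qed

section \<open>Volumes at dyadic radii and decay from a Nash inequality\<close>

locale volume_seq = scale_seq a B C \<rho> for a B C \<rho> +
  fixes v :: "nat \<Rightarrow> real" and D :: real
  assumes v_pos: "v j > 0" and v_mono: "v j \<le> v (Suc j)" and v_doubling: "v (Suc j) \<le> D * v j"
begin

lemma D_pos: "D > 0"
  using v_pos[of 0] v_pos[of "Suc 0"] v_doubling[of 0] by (smt (verit) mult_nonpos_nonneg)

lemma v_doubling_pow: "v (j + i) \<le> D ^ i * v j"
proof (induction i)
  case (Suc i)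
  have "v (j + Suc i) \<le> D * v (j + i)" using v_doubling[of "j + i"] by simp
  also have "\<dots> \<le> D * (D ^ i * v j)" using Suc D_pos by (intro mult_left_mono) auto
  finally show ?case by simp
qed simp

lemma v_mono': "i \<le> j \<Longrightarrow> v i \<le> v j"
  using lift_Suc_mono_le[of v i j] v_mono by auto

lemma S_le: "S N \<le> 2 * C * a 0 * 2 ^ N"
proof -
  have "a j \<le> C * a 0" for j
  proof -
    have "\<rho> ^ j * (C * a 0) \<le> 1 * (C * a 0)"
      using rho C_ge a_pos[of 0] by (intro mult_right_mono power_le_one) auto
    then show ?thesis using a_decay[of 0 j] by (simp add: ac_simps)
  qed
  then have "S N \<le> (\<Sum>j\<le>N. 2 ^ j * (C * a 0))"
    unfolding S_def by (intro sum_mono mult_left_mono) auto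
  also have "\<dots> = (2 ^ Suc N - 1) * (C * a 0)"
    by (simp add: sum_distrib_right[symmetric] mask_eq_sum_exp lessThan_Suc_atMost[symmetric] geometric_sum)
  also have "\<dots> \<le> 2 ^ Suc N * (C * a 0)"
    using C_ge a_pos[of 0] by (intro mult_right_mono) auto
  finally show ?thesis by (simp add: ac_simps)
qed

text \<open>In place of integrating the Nash inequality, induct over scales: from time \<open>n div 2\<close> to \<open>n\<close>
  convexity bounds the decrement of \<open>u\<close> at \<open>n\<close>, and \<open>M\<close> scales are gained at each step.\<close>

lemma nash_decay:
  assumes Q: "Q \<ge> 1"
  shows "\<exists>A>0. \<forall>u. (\<forall>n. 0 \<le> u n \<and> u n \<le> Q \<and> 2 * u (n + 1) \<le> u n + u (n + 2)) \<longrightarrow>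
      (\<forall>n N. u n \<le> Q * W N * (u n - u (n + 1)) + Q / v N) \<longrightarrow>
      (\<forall>n N. A * W N \<le> real n \<longrightarrow> u n \<le> A / v N)"
proof -
  \<comment> \<open>The 4 pays for halving the time: n \<le> 4 * (n div 2) as soon as n \<ge>
    2.\<close>
  obtain M where M: "\<And>N. 4 * W N \<le> W (N + M)" using W_grow[of 4] by blast
  \<comment> \<open>The first entry makes the Nash term at most half of \<open>E / v N\<close>; the
    second gives A * W N \<ge> 2, so that times in question are at least 2.\<close>
  define A where "A = max (4 * Q * D ^ M) (4 * C * a 0)"
  \<comment> \<open>\<open>2 * Q\<close> leaves the other half of \<open>E / v N\<close> for the
    volume term, and \<open>Q * v M\<close> makes the claim trivial at the first M scales, where u
    \<le> Q.\<close>
  define E where "E = max (2 * Q) (Q * v M)"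
  have A: "A > 0" using Q D_pos by (auto simp: A_def less_max_iff_disj)
  have E: "E > 0" using Q by (auto simp: E_def less_max_iff_disj)
  have AW: "2 \<le> A * W N" for N
  proof -
    have "2 * S N \<le> 4 * C * a 0 * 2 ^ N" using S_le[of N] by simp
    also have "\<dots> \<le> A * 2 ^ N" by (intro mult_right_mono) (auto simp: A_def)
    finally show ?thesis using S_pos[of N] by (simp add: W_def field_simps)
  qed
  have main: "u n \<le> E / v N"
    if u: "\<And>n. 0 \<le> u n \<and> u n \<le> Q \<and> 2 * u (n + 1) \<le> u n + u (n + 2)"
      and nash: "\<And>n N. u n \<le> Q * W N * (u n - u (n + 1)) + Q / v N"
      and n: "A * W N \<le> real n" for u :: "nat \<Rightarrow> real" and n N
    using n
  proof (induction N arbitrary: n rule: less_induct)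
    case (less N)
    show ?case
    proof (cases "N < M")
      case True
      have "Q * v N \<le> Q * v M" using True Q by (intro mult_left_mono v_mono') auto
      also have "\<dots> \<le> E" by (simp add: E_def)
      finally have "Q \<le> E / v N" using v_pos[of N] by (simp add: field_simps)
      then show ?thesis using u[of n] by linarith
    next
      case False
      define N' where "N' = N - M"
      have N: "N = N' + M" using False by (simp add: N'_def)
      have "M \<noteq> 0" using M[of 0] W_pos[of 0] by (cases M) auto
      then have lt: "N' < N" by (simp add: N)
      define n' where "n' = n div 2"
      have n2: "n \<ge> 2" using AW[of N] less.prems by linarith
      then have n': "real n \<le> 4 * real n'" "real n / 2 \<le> real n - real n'" "n' \<le> n"
        unfolding n'_def by linarith+
      have "4 * (A * W N') \<le> A * W N" using mult_left_mono[OF M[of N'], of A] A by (simp add: N)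
      then have "A * W N' \<le> real n'" using less.prems n' by linarith
      from less.IH[OF lt this] have IH: "u n' \<le> E / v N'" .
      have dec: "u (n + 1) \<le> u n"
        by (rule convex_bounded_seq_antimono[of u Q]) (use u in auto)
      have "real n / 2 * (u n - u (n + 1)) \<le> (real n - real n') * (u n - u (n + 1))"
        using dec n' by (intro mult_right_mono) auto
      also have "\<dots> \<le> u n' - u n" by (rule convex_seq_drop_le) (use u n' in auto)
      also have "\<dots> \<le> E / v N'" using IH u[of n] by linarith
      finally have 1: "real n * (u n - u (n + 1)) \<le> 2 * E / v N'" by (simp add: mult.commute)
      have "A * (W N * (u n - u (n + 1))) = (A * W N) * (u n - u (n + 1))" by simp
      also have "\<dots> \<le> real n * (u n - u (n + 1))"
        using less.prems dec by (intro mult_right_mono) auto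
      also have "\<dots> \<le> 2 * E / v N'" by (rule 1)
      also have "\<dots> \<le> 2 * E * D ^ M / v N"
        using v_doubling_pow[of N' M] E v_pos[of N] v_pos[of N'] by (simp add: N field_simps)
      finally have 2: "A * (W N * (u n - u (n + 1))) \<le> 2 * E * D ^ M / v N" .
      have "2 * Q * D ^ M * (2 * (W N * (u n - u (n + 1)))) \<le> A * (W N * (u n - u (n + 1)))"
        using dec W_pos[of N] mult_right_mono[of "4 * Q * D ^ M" A "W N * (u n - u (n + 1))"]
        by (simp add: A_def)
      also note 2
      finally have "(2 * D ^ M) * (Q * (2 * (W N * (u n - u (n + 1))))) \<le> (2 * D ^ M) * (E / v N)"
        by (simp add: ac_simps)
      then have "Q * (2 * (W N * (u n - u (n + 1)))) \<le> E / v N"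
        using D_pos by (subst (asm) mult_le_cancel_left_pos) auto
      then have "Q * W N * (u n - u (n + 1)) \<le> E / v N / 2" by simp
      moreover have "Q / v N \<le> E / v N / 2"
        using v_pos[of N] by (simp add: field_simps E_def)
      ultimately show ?thesis using nash[of n N] by (simp add: field_simps)
    qed
  qed
  show ?thesis
  proof (intro exI[of _ "max A E"] conjI allI impI)
    show "max A E > 0" using A by simp
    fix u :: "nat \<Rightarrow> real" and n N
    assume u: "\<forall>n. 0 \<le> u n \<and> u n \<le> Q \<and> 2 * u (n + 1) \<le> u n + u (n + 2)"
      and nash: "\<forall>n N. u n \<le> Q * W N * (u n - u (n + 1)) + Q / v N"
      and n: "max A E * W N \<le> real n"
    have "A * W N \<le> max A E * W N" using W_pos[of N] by (intro mult_right_mono) auto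
    then have "A * W N \<le> real n" using n by linarith
    with u nash have "u n \<le> E / v N" by (intro main[of u N n]) auto
    also have "\<dots> \<le> max A E / v N" using v_pos[of N] by (intro divide_right_mono) auto
    finally show "u n \<le> max A E / v N" .
  qed
qed

end

text \<open>The interface between graph and functional analysis, with one constant for all bounds.
  \<open>k_lower\<close> uses even times to produce squared norms, while \<open>k_upper\<close> and
  \<open>p_lower\<close> use sums over two consecutive times because heat kernels of one parity may
  vanish. The time 4 * 2^N is that of the squared norm of a function run for time 2 * 2^N.\<close>

locale kernel_comparison = vertex_measure m + volume_seq a B C \<rho> v D
  for m :: "'a \<Rightarrow> ennreal" and a B C \<rho> v D +
  fixes k p :: "'a \<Rightarrow> 'a \<Rightarrow> ennreal" and Q :: real
  assumes k: "sym_kernel k 1" and p: "sym_kernel p 1" and Q: "Q \<ge> 1"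
    and inverse_m: "1 / m x \<le> ennreal Q"
    and k_diag: "ennreal (1 / Q) \<le> k x x * m x"
    and k_lower: "(\<Sum>i. ennreal (a i / Q) * kpow p (2 * 2 ^ i) x y) \<le> k x y"
    and k_upper: "k x y \<le> (\<Sum>i. ennreal (Q * a i) * (kpow p (2 ^ i) x y + kpow p (2 ^ i + 1) x y))"
    and p_upper: "kpow p (2 * 2 ^ N) x y \<le> ennreal (Q / v N)"
    and p_lower: "ennreal (1 / (Q * v N)) \<le> kpow p (4 * 2 ^ N) x x + kpow p (4 * 2 ^ N + 1) x x"
begin

definition u :: "'a \<Rightarrow> nat \<Rightarrow> real" where
  "u x n = corr k (delta x) (2 * n)"

lemma u_le: "u x n \<le> Q"
proof -
  have "delta x x \<le> ennreal Q" using inverse_m[of x] by (simp add: delta_def)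
  then have "corr k (delta x) 0 \<le> Q"
    unfolding corr_delta using Q by (intro enn2real_leI) (auto simp: kpow_def)
  with corr_le[OF k fin_mass_delta, of x "2 * n"] show ?thesis by (simp add: u_def)
qed

lemma u_convex: "2 * u x (n + 1) \<le> u x n + u x (n + 2)"
  unfolding u_def by (rule corr_convex[OF k fin_mass_delta])

text \<open>With f = k^n \<open>delta x\<close>, of mass 1, split ||f||^2 at ||p^(2^N) f||^2. The
  latter is at most Q / v N by the kernel bound on p, and the difference is controlled by the
  comparison with k^2.\<close>

lemma nash_inequality: "u x n \<le> Q\<^sup>2 * W N * (u x n - u x (n + 1)) + Q / v N"
proof -
  define f where "f = (kop k ^^ n) (delta x)"
  have f: "fin_mass f" unfolding f_def by (intro fin_mass_funpow k fin_mass_delta)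
  have f1: "pairing (\<lambda>_. 1) f = 1" unfolding f_def by (rule pairing_one_funpow_delta[OF k])
  define e where "e i = corr p f (2 * i)" for i
  have e0: "pairing f f = ennreal (e 0)"
    using ennreal_corr[OF p f, of 0] by (simp add: e_def)
  have ee: "pairing ((kop p ^^ i) f) ((kop p ^^ i) f) = ennreal (e i)" for i
    using ennreal_corr[OF p f, of "2 * i"] by (simp add: e_def pairing_kop_funpow_add[OF p] mult_2)
  have uu: "pairing ((kop k ^^ n) (delta x)) ((kop k ^^ n) (delta x)) = ennreal (u x n)" for n
    by (simp add: pairing_kop_funpow_add[OF k] ennreal_corr[OF k fin_mass_delta, symmetric] u_def mult_2)
  have u0: "u x n = e 0"
    using uu[of n] e0 by (simp add: f_def e_def u_def)
  have u1: "pairing (kop k f) (kop k f) = ennreal (u x (n + 1))"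
    using uu[of "n + 1"] by (simp add: f_def)
  have e_nonneg: "0 \<le> e i" for i by (simp add: e_def)
  have e_le: "e i \<le> e 0" for i unfolding e_def using corr_le[OF p f] by simp
  have e_conv: "2 * e (i + 1) \<le> e i + e (i + 2)" for i unfolding e_def by (rule corr_convex[OF p f])
  have aQ: "summable (\<lambda>i. a i / Q)" "\<And>i. 0 \<le> a i / Q"
    using summable_a a_pos Q by (auto simp: less_imp_le)
  have sw: "(\<Sum>i. ennreal (a i / Q)) = ennreal (\<Sum>i. a i / Q)"
    using aQ by (intro suminf_ennreal2) auto
  note se = suminf_ennreal_mult[OF aQ, of "\<lambda>i. e (2 ^ i)" "e 0", OF e_nonneg e_le]
  have A0: "0 \<le> (\<Sum>i. a i / Q)" "0 \<le> (\<Sum>i. a i / Q * e (2 ^ i))"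
    by (rule suminf_nonneg[OF aQ], rule suminf_nonneg[OF se(2)], rule mult_nonneg_nonneg[OF aQ(2) e_nonneg])
  have "ennreal (u x (n + 1)) + ennreal (1 / Q) * ennreal (\<Sum>i. a i / Q) * ennreal (e 0)
      \<le> ennreal (1 / Q) * ennreal (\<Sum>i. a i / Q * e (2 ^ i)) + ennreal (e 0)"
    using pairing_square_diff_le[OF k p k_diag, of "\<lambda>i. ennreal (a i / Q)" "\<lambda>i. 2 ^ i", OF k_lower, of f]
    by (simp only: sw ee e0 u1 se)
  then have "u x (n + 1) + 1 / Q * (\<Sum>i. a i / Q) * e 0 \<le> 1 / Q * (\<Sum>i. a i / Q * e (2 ^ i)) + e 0"
    by (rule ennreal_affine_leD[rotated -1]) (use A0 Q e_nonneg in \<open>auto simp: u_def\<close>)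
  moreover have "(\<Sum>i. a i / Q * (e 0 - e (2 ^ i))) = (\<Sum>i. a i / Q) * e 0 - (\<Sum>i. a i / Q * e (2 ^ i))"
    using suminf_diff[OF summable_mult2[OF aQ(1)] se(2), of "e 0"] suminf_mult2[OF aQ(1), of "e 0"]
    by (simp add: right_diff_distrib)
  ultimately have 1: "1 / Q * (\<Sum>i. a i / Q * (e 0 - e (2 ^ i))) \<le> u x n - u x (n + 1)"
    by (simp add: u0 right_diff_distrib mult.assoc)
  have 2: "(\<Sum>i\<le>N. a i / Q * (e 0 - e (2 ^ i))) \<le> (\<Sum>i. a i / Q * (e 0 - e (2 ^ i)))"
  proof (rule sum_le_suminf)
    show "summable (\<lambda>i. a i / Q * (e 0 - e (2 ^ i)))"
      using summable_diff[OF summable_mult2[OF aQ(1)] se(2), of "e 0"] by (simp only: right_diff_distrib)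
    show "0 \<le> a i / Q * (e 0 - e (2 ^ i))" for i
      by (rule mult_nonneg_nonneg[OF aQ(2)]) (use e_le in simp)
  qed auto
  \<comment> \<open>Convexity gives each scale i \<le> N at least the share 2^i / 2^N of the full
    drop, and the nonnegative scales beyond N are discarded. The factor Q^2 collects 1 / Q from the
    diagonal of k and from the weights \<open>a i / Q\<close>.\<close>
  have "S N * (e 0 - e (2 ^ N)) = (\<Sum>i\<le>N. a i * (2 ^ i * (e 0 - e (2 ^ N))))"
    by (simp add: S_def sum_distrib_right sum_distrib_left ac_simps)
  also have "\<dots> \<le> (\<Sum>i\<le>N. a i * (2 ^ N * (e 0 - e (2 ^ i))))"
  proof (intro sum_mono mult_left_mono)
    fix i assume "i \<in> {..N}"
    then have "(2::nat) ^ i \<le> 2 ^ N" by (intro power_increasing) auto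
    from convex_seq_secants[OF e_conv this] show "2 ^ i * (e 0 - e (2 ^ N)) \<le> 2 ^ N * (e 0 - e (2 ^ i))"
      by simp
  qed (use a_pos in \<open>simp add: less_imp_le\<close>)
  also have "\<dots> = 2 ^ N * Q * (\<Sum>i\<le>N. a i / Q * (e 0 - e (2 ^ i)))"
    using Q by (auto simp: sum_distrib_left intro!: sum.cong)
  also have "\<dots> \<le> 2 ^ N * Q * (Q * (u x n - u x (n + 1)))"
    using 1 2 Q by (intro mult_left_mono) (auto simp: field_simps)
  finally have 3: "e 0 - e (2 ^ N) \<le> Q\<^sup>2 * W N * (u x n - u x (n + 1))"
    using S_pos[of N] by (simp add: W_def power2_eq_square field_simps)
  have "ennreal (e (2 ^ N)) \<le> ennreal (Q / v N)"
    using pairing_kop_funpow_le_sup[OF p p_upper, of N f]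
    by (simp add: f1 e_def ennreal_corr[OF p f])
  then have "e (2 ^ N) \<le> Q / v N" using Q v_pos[of N] by (subst (asm) ennreal_le_iff) auto
  with 3 show ?thesis by (simp add: u0)
qed

lemma upper_bound:
  "\<exists>A>0. \<forall>x n N. A * W N \<le> real n \<longrightarrow> u x n \<le> A / v N"
proof -
  \<comment> \<open>\<open>nash_decay\<close> works with a single constant, so Q is replaced by its
    square throughout.\<close>
  have Q2: "Q \<le> Q\<^sup>2" "Q\<^sup>2 \<ge> 1" using Q by (auto simp: power2_eq_square intro: order.trans[OF Q])
  obtain A where A: "A > 0" "\<And>u. (\<forall>n. 0 \<le> u n \<and> u n \<le> Q\<^sup>2 \<and> 2 * u (n + 1) \<le> u n + u (n + 2)) \<Longrightarrow>
      (\<forall>n N. u n \<le> Q\<^sup>2 * W N * (u n - u (n + 1)) + Q\<^sup>2 / v N) \<Longrightarrow>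
      (\<forall>n N. A * W N \<le> real n \<longrightarrow> u n \<le> A / v N)"
    using nash_decay[OF Q2(2)] by blast
  have "\<forall>n N. A * W N \<le> real n \<longrightarrow> u x n \<le> A / v N" for x
  proof (rule A(2))
    show "\<forall>n. 0 \<le> u x n \<and> u x n \<le> Q\<^sup>2 \<and> 2 * u x (n + 1) \<le> u x n + u x (n + 2)"
      using u_le[of x] u_convex[of x] Q2 by (auto simp: u_def intro: order.trans)
    show "\<forall>n N. u x n \<le> Q\<^sup>2 * W N * (u x n - u x (n + 1)) + Q\<^sup>2 / v N"
    proof (intro allI)
      fix n N
      have "Q / v N \<le> Q\<^sup>2 / v N" using Q2 v_pos[of N] by (intro divide_right_mono) auto
      with nash_inequality[of x n N] show "u x n \<le> Q\<^sup>2 * W N * (u x n - u x (n + 1)) + Q\<^sup>2 / v N"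
        by linarith
    qed
  qed
  with A(1) show ?thesis by blast
qed

text \<open>The test function is \<open>(I + P) P\<^sup>n \<delta>\<^sub>x\<close>: the factor \<open>I + P\<close> removes the part of the
  spectrum near \<open>-1\<close>, on which bipartite graphs would make the Dirichlet form of \<open>P\<close> large.\<close>

lemma test_function:
  fixes x N
  defines "f \<equiv> (\<lambda>y. (kop p ^^ (2 * 2 ^ N)) (delta x) y + (kop p ^^ (2 * 2 ^ N + 1)) (delta x) y)"
  shows "fin_mass f" "pairing (\<lambda>_. 1) f = 2" "1 / (Q * v N) \<le> corr p f 0"
    "corr p f 0 - corr p f n \<le> real n * (4 * Q\<^sup>2 / 2 ^ N * corr p f 0)"
proof -
  \<comment> \<open>Starting at twice 2^N leaves 2^N earlier drops of \<open>b\<close> to average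
    over, so by convexity the drop at \<open>K\<close> is at most \<open>b (2 ^ N)\<close> /
    2^N.\<close>
  define K :: nat where "K = 2 * 2 ^ N"
  define c where "c = corr p (delta x)"
  define b where "b n = c (2 * n)" for n
  define e where "e = 2 * (b K - b (K + 1))"
  have f_eq: "f = (\<lambda>y. (kop p ^^ K) (delta x) y + (kop p ^^ (K + 1)) (delta x) y)"
    by (simp add: f_def K_def)
  show f: "fin_mass f"
    unfolding f_eq by (intro fin_mass_add fin_mass_funpow p fin_mass_delta)
  show "pairing (\<lambda>_. 1) f = 2"
    unfolding f_eq by (simp only: pairing_add2 pairing_one_funpow_delta[OF p]) simp
  have c: "pairing ((kop p ^^ i) (delta x)) ((kop p ^^ j) (delta x)) = ennreal (c (i + j))" for i j
    by (simp only: pairing_kop_funpow_add[OF p] c_def ennreal_corr[OF p fin_mass_delta])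
  have c_nonneg: "0 \<le> c i" for i by (simp add: c_def)
  have b_conv: "2 * b (i + 1) \<le> b i + b (i + 2)" for i
    unfolding b_def c_def by (rule corr_convex[OF p fin_mass_delta])
  have d: "corr p f i = c (2 * K + i) + 2 * c (2 * K + i + 1) + c (2 * K + i + 2)" for i
  proof -
    have "(kop p ^^ i) f = (\<lambda>y. (kop p ^^ (i + K)) (delta x) y + (kop p ^^ (i + (K + 1))) (delta x) y)"
      unfolding f_eq kop_funpow_add by (simp only: funpow_add o_apply)
    then have "pairing ((kop p ^^ i) f) f = ennreal (c (i + K + K)) + ennreal (c (i + K + (K + 1)))
        + (ennreal (c (i + (K + 1) + K)) + ennreal (c (i + (K + 1) + (K + 1))))"
      unfolding f_eq by (simp only: pairing_add pairing_add2 c add.assoc)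
    also have "\<dots> = ennreal (c (2 * K + i) + 2 * c (2 * K + i + 1) + c (2 * K + i + 2))"
    proof -
      have "i + K + K = 2 * K + i" "i + K + (K + 1) = 2 * K + i + 1" "i + (K + 1) + K = 2 * K + i + 1"
        "i + (K + 1) + (K + 1) = 2 * K + i + 2" by simp_all
      moreover have "ennreal X + ennreal Y + (ennreal Y + ennreal Z) = ennreal (X + 2 * Y + Z)"
        if "0 \<le> X" "0 \<le> Y" "0 \<le> Z" for X Y Z
      proof -
        have "X + 2 * Y + Z = X + Y + (Y + Z)" by simp
        then show ?thesis using that by (simp only: ennreal_plus add_nonneg_nonneg)
      qed
      ultimately show ?thesis using c_nonneg by (simp only:)
    qed
    finally show ?thesis using c_nonneg by (simp add: corr_def del: ennreal_plus)
  qed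
  \<comment> \<open>Two-step drops are monotone along even times by convexity; at an odd time
    \<open>corr_polar\<close> bounds them by the drop one step earlier.\<close>
  have drop2: "c n - c (n + 2) \<le> b K - b (K + 1)" if n: "n \<ge> 2 * K" for n
  proof -
    have even: "c (2 * i) - c (2 * i + 2) \<le> b K - b (K + 1)" if "i \<ge> K" for i
      using convex_seq_increments[of b, OF b_conv that] by (simp add: b_def)
    show ?thesis
    proof (cases "even n")
      case True
      then obtain i where "n = 2 * i" by blast
      then show ?thesis using even[of i] n by simp
    next
      case False
      then obtain i where i: "n = 2 * i + 1" using oddE by blast
      have "c (2 * i + 1) + c (2 * i + 2) \<le> c (2 * i) + c (2 * i + 3)"
        unfolding c_def by (rule corr_polar[OF p fin_mass_delta])
      then show ?thesis using even[of i] n i by (simp add: numeral_3_eq_3)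
    qed
  qed
  \<comment> \<open>The coefficients 1, 2, 1 of (I+P)^2 make the one-step drop of
    \<open>corr p f\<close> the sum of two consecutive two-step drops of \<open>c\<close>, so no
    parity-dependent term survives.\<close>
  have step: "corr p f i - corr p f (i + 1) \<le> e" for i
    using drop2[of "2 * K + i"] drop2[of "2 * K + i + 1"] by (simp add: d e_def)
  have total: "corr p f 0 - corr p f n \<le> real n * e" for n
  proof (induction n)
    case (Suc n)
    then show ?case using step[of n] by (simp add: algebra_simps)
  qed simp
  have "ennreal (1 / (Q * v N)) \<le> ennreal (c (2 * K)) + ennreal (c (2 * K + 1))"
    using p_lower[of N x] c[of 0 "2 * K"] c[of 0 "2 * K + 1"]
    by (simp add: K_def kpow_def pairing_delta2 del: funpow.simps)
  then have "ennreal (1 / (Q * v N)) \<le> ennreal (c (2 * K) + c (2 * K + 1))"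
    using c_nonneg by simp
  then have "1 / (Q * v N) \<le> c (2 * K) + c (2 * K + 1)"
    using c_nonneg by (subst (asm) ennreal_le_iff) auto
  then show d0: "1 / (Q * v N) \<le> corr p f 0"
    using d[of 0] c_nonneg[of "2 * K + 1"] c_nonneg[of "2 * K + 2"] by simp
  have "b (2 ^ N) \<le> Q / v N"
  proof -
    have "ennreal (b (2 ^ N)) \<le> ennreal (Q / v N)"
      using p_upper[of N x x] c[of 0 "2 * 2 ^ N"]
      by (simp add: b_def kpow_def pairing_delta2 del: funpow.simps)
    then show ?thesis using Q v_pos[of N] by (subst (asm) ennreal_le_iff) auto
  qed
  moreover have "(real K - real (2 ^ N)) * (b K - b (K + 1)) \<le> b (2 ^ N) - b K"
    by (rule convex_seq_drop_le[of b, OF b_conv]) (simp add: K_def)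
  moreover have "0 \<le> b K" by (simp add: b_def c_nonneg)
  ultimately have "2 ^ N * (b K - b (K + 1)) \<le> Q / v N" by (simp add: K_def)
  \<comment> \<open>The upper bound on p controls the drops and the lower bound controls ||f||^2,
    both at volume \<open>v N\<close>; this makes the estimate relative to
    \<open>corr p f 0\<close>.\<close>
  also have "Q / v N = Q\<^sup>2 * (1 / (Q * v N))" using Q by (simp add: power2_eq_square)
  also have "\<dots> \<le> Q\<^sup>2 * corr p f 0" using d0 by (intro mult_left_mono) auto
  finally have "e \<le> 2 * Q\<^sup>2 / 2 ^ N * corr p f 0" by (simp add: e_def field_simps)
  also have "\<dots> \<le> 4 * Q\<^sup>2 / 2 ^ N * corr p f 0"
    by (intro mult_right_mono divide_right_mono) auto
  finally have "e \<le> 4 * Q\<^sup>2 / 2 ^ N * corr p f 0" .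
  then have "real n * e \<le> real n * (4 * Q\<^sup>2 / 2 ^ N * corr p f 0)" by (rule mult_left_mono) simp
  with total[of n] show "corr p f 0 - corr p f n \<le> real n * (4 * Q\<^sup>2 / 2 ^ N * corr p f 0)" by linarith
qed

text \<open>Scales i < N lose at most time 2^i at rate 2^(-N), and their weighted sum gives S N /
  2^N = 1 / W N. Beyond N the form is bounded by 2 ||f||^2, and the tail of \<open>a\<close> is of
  order a N \<le> S N / 2^N, the same size.\<close>

lemma dirichlet_form_test_function:
  fixes x N
  defines "f \<equiv> (\<lambda>y. (kop p ^^ (2 * 2 ^ N)) (delta x) y + (kop p ^^ (2 * 2 ^ N + 1)) (delta x) y)"
  shows "corr k f 0 - corr k f 1 \<le> Q * (12 * Q\<^sup>2 + 2 * C / (1 - \<rho>)) / W N * corr k f 0"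
proof -
  have f: "fin_mass f" unfolding f_def by (rule test_function)
  define d where "d = corr p f"
  define g where "g i = 2 * d 0 - d (2 ^ i) - d (2 ^ i + 1)" for i :: nat
  have d_nonneg: "0 \<le> d i" for i by (simp add: d_def)
  have d_le: "d i \<le> d 0" for i unfolding d_def by (rule corr_le[OF p f])
  have d0: "corr k f 0 = d 0" by (simp add: d_def corr_def)
  have de: "pairing ((kop p ^^ i) f) f = ennreal (d i)" for i
    by (simp add: d_def ennreal_corr[OF p f])
  have d0e: "pairing f f = ennreal (d 0)" using de[of 0] by simp
  have ke: "pairing (kop k f) f = ennreal (corr k f 1)" using ennreal_corr[OF k f, of 1] by simp
  have aQ: "summable (\<lambda>i. Q * a i)" "\<And>i. 0 \<le> Q * a i"
    using summable_a a_pos Q by (auto simp: less_imp_le intro: summable_mult)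
  have sw: "(\<Sum>i. ennreal (Q * a i)) = ennreal (\<Sum>i. Q * a i)"
    using aQ by (intro suminf_ennreal2) auto
  define h where "h i = d (2 ^ i) + d (2 ^ i + 1)" for i :: nat
  have h: "0 \<le> h i" "h i \<le> 2 * d 0" for i
    using d_nonneg[of "2 ^ i"] d_nonneg[of "2 ^ i + 1"] d_le[of "2 ^ i"] d_le[of "2 ^ i + 1"]
    by (auto simp: h_def)
  have he: "ennreal (d (2 ^ i)) + ennreal (d (2 ^ i + 1)) = ennreal (h i)" for i
    using d_nonneg by (simp add: h_def)
  note se = suminf_ennreal_mult[OF aQ, of h "2 * d 0", OF h]
  have sh: "0 \<le> (\<Sum>i. Q * a i * h i)" "0 \<le> (\<Sum>i. Q * a i)"
    by (rule suminf_nonneg[OF se(2)], rule mult_nonneg_nonneg[OF aQ(2) h(1)], rule suminf_nonneg[OF aQ])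
  have "ennreal (\<Sum>i. Q * a i * h i) + ennreal (d 0)
      \<le> ennreal (corr k f 1) + ennreal (\<Sum>i. Q * a i) * 2 * ennreal (d 0)"
    using pairing_kop_ge[OF k p, of "\<lambda>i. ennreal (Q * a i)" "\<lambda>i. 2 ^ i", OF k_upper, of f]
    by (simp only: de d0e ke he sw se)
  also have "\<dots> = ennreal (corr k f 1 + (\<Sum>i. Q * a i) * 2 * d 0)"
    using sh d_nonneg[of 0] by (simp add: ennreal_mult ennreal_plus)
  also have "ennreal (\<Sum>i. Q * a i * h i) + ennreal (d 0) = ennreal ((\<Sum>i. Q * a i * h i) + d 0)"
    using sh d_nonneg[of 0] by simp
  finally have "(\<Sum>i. Q * a i * h i) + d 0 \<le> corr k f 1 + (\<Sum>i. Q * a i) * 2 * d 0"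
    using sh d_nonneg[of 0] by (subst (asm) ennreal_le_iff) auto
  moreover have "(\<Sum>i. Q * a i * g i) = (\<Sum>i. Q * a i) * 2 * d 0 - (\<Sum>i. Q * a i * h i)"
    and sg: "summable (\<lambda>i. Q * a i * g i)"
  proof -
    have g: "Q * a i * g i = Q * a i * (2 * d 0) - Q * a i * h i" for i
      by (simp add: g_def h_def algebra_simps)
    show "(\<Sum>i. Q * a i * g i) = (\<Sum>i. Q * a i) * 2 * d 0 - (\<Sum>i. Q * a i * h i)"
      using suminf_diff[OF summable_mult2[OF aQ(1)] se(2), of "2 * d 0"] suminf_mult2[OF aQ(1), of "2 * d 0"]
      unfolding g by (simp only: mult.assoc)
    show "summable (\<lambda>i. Q * a i * g i)"
      using summable_diff[OF summable_mult2[OF aQ(1)] se(2), of "2 * d 0"] by (simp only: g)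
  qed
  ultimately have 1: "d 0 - corr k f 1 \<le> (\<Sum>i. Q * a i * g i)" by linarith
  \<comment> \<open>The times 2^i and 2^i + 1 add up to at most 3 * 2^i, which turns the 4 of the
    test function into 12.\<close>
  have "(\<Sum>i<N. Q * a i * g i) \<le> (\<Sum>i<N. Q * (12 * Q\<^sup>2 / 2 ^ N * d 0) * (2 ^ i * a i))"
  proof (intro sum_mono)
    fix i
    have "g i \<le> real (2 ^ i) * (4 * Q\<^sup>2 / 2 ^ N * d 0) + real (2 ^ i + 1) * (4 * Q\<^sup>2 / 2 ^ N * d 0)"
      using test_function(4)[of N x "2 ^ i", folded f_def] test_function(4)[of N x "2 ^ i + 1", folded f_def]
      by (simp add: g_def d_def)
    also have "\<dots> = (2 * 2 ^ i + 1) * (4 * Q\<^sup>2 / 2 ^ N * d 0)"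
      by (simp only: distrib_right[symmetric]) simp
    also have "\<dots> \<le> (3 * 2 ^ i) * (4 * Q\<^sup>2 / 2 ^ N * d 0)"
      using d_nonneg[of 0] by (intro mult_right_mono) auto
    finally have "g i \<le> (3 * 2 ^ i) * (4 * Q\<^sup>2 / 2 ^ N * d 0)" .
    from mult_left_mono[OF this aQ(2)[of i]]
    show "Q * a i * g i \<le> Q * (12 * Q\<^sup>2 / 2 ^ N * d 0) * (2 ^ i * a i)" by (simp add: ac_simps)
  qed
  also have "\<dots> = Q * (12 * Q\<^sup>2 / 2 ^ N * d 0) * (\<Sum>i<N. 2 ^ i * a i)" by (simp add: sum_distrib_left)
  also have "\<dots> \<le> Q * (12 * Q\<^sup>2 / 2 ^ N * d 0) * S N"
    unfolding S_def using Q d_nonneg[of 0] a_pos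
    by (intro mult_left_mono sum_mono2) (auto simp: less_imp_le)
  finally have 2: "(\<Sum>i<N. Q * a i * g i) \<le> Q * (12 * Q\<^sup>2 / 2 ^ N * d 0) * S N" .
  have "(\<Sum>i. Q * a (i + N) * g (i + N)) \<le> (\<Sum>i. Q * (2 * d 0) * a (i + N))"
  proof (intro suminf_le)
    fix i
    have "g (i + N) \<le> 2 * d 0"
      using d_nonneg[of "2 ^ (i + N)"] d_nonneg[of "2 ^ (i + N) + 1"] unfolding g_def by linarith
    from mult_left_mono[OF this aQ(2)[of "i + N"]]
    show "Q * a (i + N) * g (i + N) \<le> Q * (2 * d 0) * a (i + N)" by (simp add: ac_simps)
    show "summable (\<lambda>i. Q * a (i + N) * g (i + N))"
      using sg by (subst summable_iff_shift[of "\<lambda>i. Q * a i * g i"])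
    show "summable (\<lambda>i. Q * (2 * d 0) * a (i + N))"
      using summable_a by (intro summable_mult) (simp add: summable_iff_shift)
  qed
  also have "\<dots> = Q * (2 * d 0) * (\<Sum>i. a (i + N))"
    using summable_a by (intro suminf_mult) (simp add: summable_iff_shift)
  also have "\<dots> \<le> Q * (2 * d 0) * (C / (1 - \<rho>) * a N)"
    using Q d_nonneg[of 0] by (intro mult_left_mono a_tail_le) auto
  also have "\<dots> \<le> Q * (2 * d 0) * (C / (1 - \<rho>) * (S N / 2 ^ N))"
    using Q d_nonneg[of 0] C_ge rho S_ge[of N N] by (intro mult_left_mono) (auto simp: field_simps)
  finally have 3: "(\<Sum>i. Q * a (i + N) * g (i + N)) \<le> Q * (2 * d 0) * (C / (1 - \<rho>) * (S N / 2 ^ N))" .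
  have "d 0 - corr k f 1 \<le> Q * (2 * d 0) * (C / (1 - \<rho>) * (S N / 2 ^ N)) + Q * (12 * Q\<^sup>2 / 2 ^ N * d 0) * S N"
    using 1 2 3 suminf_split_initial_segment[OF sg, of N] by linarith
  also have "\<dots> = Q * (12 * Q\<^sup>2 + 2 * C / (1 - \<rho>)) / W N * d 0"
    using rho by (simp add: W_def field_simps)
  finally show ?thesis by (simp add: d0)
qed

text \<open>By convexity the first drop of ||k^n f||^2 is the largest, so up to time n of order W N
  at least half of ||f||^2 survives. It is bounded above by the supremum of k_2n times the squared
  mass of f.\<close>

lemma lower_bound:
  "\<exists>A>0. \<forall>n N M. A * real n \<le> W N \<longrightarrow> (\<forall>x. u x n \<le> M) \<longrightarrow> 1 / (A * v N) \<le> M"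
proof -
  define H where "H = Q * (12 * Q\<^sup>2 + 2 * C / (1 - \<rho>))"
  have H: "H > 0" using Q C_ge rho by (simp add: H_def add_pos_pos)
  \<comment> \<open>\<open>4 * H\<close> limits the loss to one half; in \<open>8 * Q\<close>, a
    factor 2 is that half and 4 is the squared mass of f.\<close>
  define A where "A = max (4 * H) (8 * Q)"
  have "1 / (A * v N) \<le> M" if n: "A * real n \<le> W N" and M: "\<And>x. u x n \<le> M" for n N M
  proof -
    fix x :: 'a
    define f where "f = (\<lambda>y. (kop p ^^ (2 * 2 ^ N)) (delta x) y + (kop p ^^ (2 * 2 ^ N + 1)) (delta x) y)"
    note tf = test_function[of N x, folded f_def]
    define b where "b i = corr k f (2 * i)" for i
    have b_conv: "2 * b (i + 1) \<le> b i + b (i + 2)" for i unfolding b_def by (rule corr_convex[OF k tf(1)])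
    have b0: "b 0 = corr p f 0" by (simp add: b_def corr_def)
    \<comment> \<open>Passes from k to k^2: rearranged, ||f||^2 - ||k f||^2 is at most twice the
      Dirichlet form of k.\<close>
    have b1: "2 * corr k f 1 \<le> b 0 + b 1"
    proof -
      have "pairing (kop k f) (kop k f) = ennreal (b 1)"
        using ennreal_corr[OF k tf(1), of 2] by (simp add: b_def pairing_kop[OF k] numeral_2_eq_2)
      moreover have "pairing (kop k f) f = ennreal (corr k f 1)" "pairing f f = ennreal (b 0)"
        using ennreal_corr[OF k tf(1), of 1] ennreal_corr[OF k tf(1), of 0] by (auto simp: b_def)
      ultimately have "ennreal (2 * corr k f 1) \<le> ennreal (b 0 + b 1)"
        using pairing_le[of "kop k f" f] by (simp add: ennreal_mult b_def add.commute)
      then show ?thesis by (subst (asm) ennreal_le_iff) (auto simp: b_def)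
    qed
    have "b 0 - b 1 \<le> 2 * (H / W N * b 0)"
      using b1 dirichlet_form_test_function[of N x, folded f_def] by (simp add: H_def b_def)
    then have "real n * (b 0 - b 1) \<le> real n * (2 * (H / W N * b 0))" by (rule mult_left_mono) simp
    also have "\<dots> = (2 * H * real n / W N) * b 0" by simp
    also have "\<dots> \<le> 1 / 2 * b 0"
    proof (rule mult_right_mono)
      have "4 * H * real n \<le> A * real n" by (intro mult_right_mono) (auto simp: A_def)
      then show "2 * H * real n / W N \<le> 1 / 2" using n W_pos[of N] by (simp add: field_simps)
    qed (simp add: b_def)
    finally have "b 0 / 2 \<le> b n" using convex_seq_total_drop[of b n, OF b_conv] by simp
    moreover have "b n \<le> 4 * M"
    proof -
      have M0: "0 \<le> M" using M[of x] by (simp add: u_def) (meson corr_nonneg order.trans)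
      have diag: "kpow k (2 * n) y y \<le> ennreal M" for y
      proof -
        have "kpow k (2 * n) y y = ennreal (u y n)"
          by (simp add: u_def kpow_def ennreal_corr[OF k fin_mass_delta] pairing_delta)
        then show ?thesis using M[of y] by (simp add: ennreal_leI)
      qed
      have "kpow k (2 * n) y z \<le> ennreal M" for y z
      proof -
        have "2 * kpow k (2 * n) y z \<le> 2 * ennreal M"
          unfolding mult_2[of "ennreal M"]
          by (rule order.trans[OF kpow_even_le_diagonal[OF k]]) (intro add_mono diag)
        then show ?thesis by (subst (asm) ennreal_mult_le_mult_iff) auto
      qed
      from pairing_kop_funpow_le_sup[OF k this, of f]
      have "ennreal (b n) \<le> ennreal M * (2 * 2)"
        by (simp only: b_def ennreal_corr[OF k tf(1)] tf(2))
      also have "\<dots> = ennreal (4 * M)" using M0 by (simp add: ennreal_mult mult.commute)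
      finally show ?thesis using M0 by (subst (asm) ennreal_le_iff) auto
    qed
    ultimately have "1 / (Q * v N) \<le> 8 * M" using tf(3) b0 by linarith
    moreover have "1 / (A * v N) \<le> 1 / (8 * Q * v N)"
      using Q v_pos[of N] by (intro divide_left_mono mult_right_mono) (auto simp: A_def less_max_iff_disj)
    ultimately show ?thesis by (simp add: field_simps)
  qed
  moreover have "A > 0" using H by (simp add: A_def less_max_iff_disj)
  ultimately show ?thesis by blast
qed

end

section \<open>Jump processes on graphs with sub-Gaussian heat kernels\<close>

lemma nn_integral_count_space_infsum:
  fixes f :: "'a \<Rightarrow> real"
  assumes "f summable_on UNIV" "\<And>x. f x \<ge> 0"
  shows "(\<integral>\<^sup>+x. ennreal (f x) \<partial>count_space UNIV) = ennreal (infsum f UNIV)"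
proof -
  have "Infinite_Set_Sum.abs_summable_on f UNIV"
    using assms by (simp add: abs_summable_equivalent[symmetric])
  then show ?thesis
    using nn_integral_conv_infsetsum[of f UNIV] infsetsum_infsum[of f UNIV] assms(2) by simp
qed

text \<open>For m with L \<le> \<theta>^m the factor L^l is at most the m-th power of \<theta>^l,
  and x^m \<le> m^m exp x absorbs it.\<close>

lemma power_times_exp_bounded:
  fixes L \<theta> \<eta> :: real
  assumes "L > 0" "\<theta> > 1" "\<eta> > 0"
  obtains T where "T > 0" "\<And>l :: nat. L ^ l * exp (- (\<eta> * \<theta> ^ l)) \<le> T"
proof -
  obtain n where n: "L < \<theta> ^ n" using real_arch_pow[OF assms(2)] by blast
  define m where "m = Suc n"
  have m: "L \<le> \<theta> ^ m" "m > 0" using n assms by (auto simp: m_def intro: order.trans[OF less_imp_le[OF n]])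
  have "L ^ l * exp (- (\<eta> * \<theta> ^ l)) \<le> (real m / \<eta>) ^ m" for l
  proof -
    define x where "x = \<eta> * \<theta> ^ l"
    have x: "x > 0" using assms by (simp add: x_def)
    have "x / m \<le> exp (x / m)" using exp_ge_add_one_self[of "x / real m"] by linarith
    then have "(x / m) ^ m \<le> exp (x / m) ^ m" using x by (intro power_mono) auto
    also have "\<dots> = exp x" using m(2) by (simp add: exp_of_nat_mult[symmetric])
    finally have e: "(x / m) ^ m \<le> exp x" .
    have "L ^ l \<le> (\<theta> ^ m) ^ l" using m assms by (intro power_mono) auto
    also have "\<dots> = (\<theta> ^ l) ^ m" by (simp add: power_mult[symmetric] mult.commute)
    also have "\<dots> = (real m / \<eta>) ^ m * (x / m) ^ m"
      using assms m(2) by (simp add: x_def power_mult_distrib[symmetric])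
    also have "\<dots> \<le> (real m / \<eta>) ^ m * exp x" using e assms by (intro mult_left_mono) auto
    finally show ?thesis by (simp add: x_def exp_minus field_simps)
  qed
  moreover have "(real m / \<eta>) ^ m > 0" using m assms by simp
  ultimately show ?thesis using that by blast
qed

lemma suminf_geometric_two_sided:
  fixes \<rho> :: real
  assumes "0 < \<rho>" "\<rho> < 1"
  shows "summable (\<lambda>i. \<rho> ^ nat \<bar>int i - int j\<bar>)"
    and "(\<Sum>i. \<rho> ^ nat \<bar>int i - int j\<bar>) \<le> 2 / (1 - \<rho>)"
proof -
  let ?f = "\<lambda>i. \<rho> ^ nat \<bar>int i - int j\<bar>"
  have s: "summable (\<lambda>i. \<rho> ^ i)" using assms by (intro summable_geometric) auto
  have shift: "(\<lambda>i. ?f (i + j)) = (\<lambda>i. \<rho> ^ i)" by (intro ext) simp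
  then show sf: "summable ?f" using s summable_iff_shift[of ?f j] by simp
  have "(\<Sum>i<j. ?f i) = (\<Sum>i<j. \<rho> * \<rho> ^ (j - Suc i))"
  proof (intro sum.cong refl)
    fix i assume "i \<in> {..<j}"
    then have "nat \<bar>int i - int j\<bar> = Suc (j - Suc i)" by simp
    then show "?f i = \<rho> * \<rho> ^ (j - Suc i)" by simp
  qed
  also have "\<dots> \<le> (\<Sum>i<j. 1 * \<rho> ^ (j - Suc i))"
    using assms by (intro sum_mono mult_right_mono) auto
  also have "\<dots> = (\<Sum>i<j. \<rho> ^ i)" by (simp add: sum.nat_diff_reindex)
  also have "\<dots> \<le> (\<Sum>i. \<rho> ^ i)" using s assms by (intro sum_le_suminf) auto
  finally show "(\<Sum>i. ?f i) \<le> 2 / (1 - \<rho>)"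
    using suminf_split_initial_segment[OF sf, of j] assms unfolding shift
    by (simp add: suminf_geometric)
qed

locale jump_walk = scale_seq "\<lambda>j. 1 / \<phi> (2 powr (real j / \<gamma>))" B C \<rho>
  for \<phi> :: "real \<Rightarrow> real" and \<gamma> B C \<rho> +
  fixes adj :: "'a \<Rightarrow> 'a \<Rightarrow> bool" and \<mu> k :: "'a \<Rightarrow> 'a \<Rightarrow> real" and V :: "real \<Rightarrow> real"
    and cm CV CJ CU cL :: real
  assumes graph: "weighted_graph adj \<mu>"
    and cm: "cm \<ge> 1" and mass: "1 / cm \<le> vmass adj \<mu> x" "vmass adj \<mu> x \<le> cm"
    and V_pos: "s \<ge> 0 \<Longrightarrow> V s > 0" and V_mono: "0 \<le> s \<Longrightarrow> s \<le> t \<Longrightarrow> V s \<le> V t"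
    and V_doubling: "s > 0 \<Longrightarrow> V (2 * s) \<le> CV * V s"
    and \<gamma>: "\<gamma> > 1"
    and CU: "CU > 0" "n \<ge> 1 \<Longrightarrow> heat_kernel adj \<mu> n x y \<le> CU / V (real n powr (1 / \<gamma>))
      * exp (- ((real (gdist adj x y) powr \<gamma> / (CU * real n)) powr (1 / (\<gamma> - 1))))"
    and cL: "cL > 0" "n \<ge> max 1 (gdist adj x y) \<Longrightarrow>
      heat_kernel adj \<mu> n x y + heat_kernel adj \<mu> (Suc n) x y \<ge> cL / V (real n powr (1 / \<gamma>))
      * exp (- ((real (gdist adj x y) powr \<gamma> / (cL * real n)) powr (1 / (\<gamma> - 1))))"
    and phi_ge1: "s \<ge> 0 \<Longrightarrow> \<phi> s \<ge> 1"
    and phi_bound: "l \<in> {1..2} \<Longrightarrow> s \<ge> 0 \<Longrightarrow> \<phi> (l * s) \<le> B * \<phi> s \<and> \<phi> s \<le> B * \<phi> (l * s)"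
    and markov: "markov_kernel (vmass adj \<mu>) k"
    and CJ: "CJ > 0"
      "(1 / CJ) / (V (real (gdist adj x y)) * \<phi> (real (gdist adj x y))) \<le> k x y"
      "k x y \<le> CJ / (V (real (gdist adj x y)) * \<phi> (real (gdist adj x y)))"
begin

abbreviation mu :: "'a \<Rightarrow> real" where "mu \<equiv> vmass adj \<mu>"
abbreviation r :: "nat \<Rightarrow> real" where "r j \<equiv> 2 powr (real j / \<gamma>)"
abbreviation a :: "nat \<Rightarrow> real" where "a \<equiv> \<lambda>j. 1 / \<phi> (r j)"
abbreviation v :: "nat \<Rightarrow> real" where "v j \<equiv> V (r j)"

definition m :: "'a \<Rightarrow> ennreal" where "m x = ennreal (mu x)"
definition K :: "'a \<Rightarrow> 'a \<Rightarrow> ennreal" where "K x y = ennreal (k x y)"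
text \<open>The one-step heat kernel: division by both masses makes it symmetric and leaves
  \<open>step_prob\<close> after integration against \<open>m\<close>.\<close>

definition P :: "'a \<Rightarrow> 'a \<Rightarrow> ennreal" where "P x y = ennreal (\<mu> x y / (mu x * mu y))"

lemma mu_pos: "mu x > 0"
  using mass(1)[of x] cm by (smt (verit) divide_pos_pos)

sublocale vertex_measure m
  by standard (use mu_pos in \<open>auto simp: m_def ennreal_eq_0_iff not_le\<close>)

lemma delta_eq: "delta y z = ennreal (indicator {y} z / mu y)"
  using mu_pos[of y] divide_ennreal[of 1 "mu y"] by (auto simp: delta_def m_def indicator_def)

lemma k_nonneg: "k x y \<ge> 0"
  using markov by (simp add: markov_kernel_def)

text \<open>Links the two formalisms: iterates of an indicator stay in [0,1], so every sum in
  \<open>kernel_op\<close> converges and agrees with the nonnegative integral.\<close>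

lemma kpow_K: "kpow K n x y = ennreal (kernel_power mu k n x y)"
proof -
  have "(kop K ^^ n) (delta y) x = ennreal ((kernel_op mu k ^^ n) (indicator {y}) x / mu y)" for x
  proof (induction n arbitrary: x)
    case (Suc n)
    define F where "F = (kernel_op mu k ^^ n) (indicator {y})"
    have F: "0 \<le> F z" "F z \<le> 1" for z
      using kernel_op_funpow_indicator_bounds[OF markov mu_pos, of n y z] by (auto simp: F_def)
    have IH: "(kop K ^^ n) (delta y) = (\<lambda>z. ennreal (F z / mu y))"
      unfolding F_def by (intro ext) (rule Suc)
    have s: "(\<lambda>z. k x z * F z * mu z) summable_on UNIV"
      using kernel_op_summable[OF markov mu_pos, of F 1] F by simp
    have "(kop K ^^ Suc n) (delta y) x = (\<integral>\<^sup>+z. K x z * ennreal (F z / mu y) * m z \<partial>count_space UNIV)"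
      by (simp add: IH) (simp add: kop_def)
    also have "\<dots> = (\<integral>\<^sup>+z. ennreal (k x z * F z * mu z * (1 / mu y)) \<partial>count_space UNIV)"
      using F k_nonneg mu_pos
      by (intro nn_integral_cong) (simp add: K_def m_def ennreal_mult[symmetric] less_imp_le)
    also have "\<dots> = ennreal (infsum (\<lambda>z. k x z * F z * mu z * (1 / mu y)) UNIV)"
      using F k_nonneg mu_pos by (intro nn_integral_count_space_infsum summable_on_cmult_left s) (simp add: less_imp_le)
    also have "infsum (\<lambda>z. k x z * F z * mu z * (1 / mu y)) UNIV = kernel_op mu k F x / mu y"
      unfolding kernel_op_def by (subst infsum_cmult_left') simp
    finally show ?case by (simp add: F_def)
  qed (simp add: delta_eq)
  then show ?thesis by (simp add: kpow_def kernel_power_def)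
qed

lemma sym_kernel_K: "sym_kernel K 1"
  unfolding sym_kernel_def
proof (intro conjI allI)
  fix x y
  show "K x y = K y x" using markov unfolding K_def markov_kernel_def by simp
  have h: "((\<lambda>y. k x y * mu y) has_sum 1) UNIV" using markov unfolding markov_kernel_def by blast
  have "kop K (\<lambda>_. 1) x = (\<integral>\<^sup>+y. ennreal (k x y * mu y) \<partial>count_space UNIV)"
    using k_nonneg mu_pos by (simp add: kop_def K_def m_def ennreal_mult less_imp_le)
  also have "\<dots> = ennreal (infsum (\<lambda>y. k x y * mu y) UNIV)"
    using h k_nonneg mu_pos
    by (intro nn_integral_count_space_infsum has_sum_imp_summable) (auto simp: less_imp_le)
  finally show "kop K (\<lambda>_. 1) x = 1" using h by (simp add: infsumI)
qed

lemma edge_weight: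
  "finite {z. adj x z}" "\<mu> x y = \<mu> y x" "0 \<le> \<mu> x y" "\<not> adj x y \<Longrightarrow> \<mu> x y = 0"
  using graph unfolding weighted_graph_def by (auto simp: order.antisym_conv2) (metis antisym_conv2)

lemma kop_P:
  assumes c: "c > 0" and G: "\<And>z. 0 \<le> G z"
  shows "kop P (\<lambda>z. ennreal (G z / c)) x = ennreal ((\<Sum>z | adj x z. step_prob adj \<mu> x z * G z) / c)"
proof -
  have e: "P x z * ennreal (G z / c) * m z = ennreal (step_prob adj \<mu> x z * G z / c)" for z
    using G[of z] edge_weight(3)[of x z] mu_pos[of x] mu_pos[of z] c
    by (simp add: P_def m_def step_prob_def ennreal_mult[symmetric] less_imp_le)
  have "kop P (\<lambda>z. ennreal (G z / c)) x = (\<Sum>z | adj x z. ennreal (step_prob adj \<mu> x z * G z / c))"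
    unfolding kop_def e
    by (rule nn_integral_count_space') (use edge_weight(1,4) in \<open>auto simp: step_prob_def\<close>)
  also have "\<dots> = ennreal (\<Sum>z | adj x z. step_prob adj \<mu> x z * G z / c)"
    using assms edge_weight(3) mu_pos c by (intro sum_ennreal) (simp add: step_prob_def less_imp_le)
  finally show ?thesis by (simp add: sum_divide_distrib)
qed

lemma trans_prob_nonneg: "0 \<le> trans_prob adj \<mu> n x y"
  by (induction n arbitrary: x)
    (auto intro!: sum_nonneg mult_nonneg_nonneg simp: step_prob_def edge_weight(3) mu_pos less_imp_le)

lemma heat_kernel_nonneg: "0 \<le> heat_kernel adj \<mu> n x y"
  using trans_prob_nonneg mu_pos[of y] by (simp add: heat_kernel_def less_imp_le)

lemma kpow_P: "kpow P n x y = ennreal (heat_kernel adj \<mu> n x y)"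
proof -
  have "(kop P ^^ n) (delta y) = (\<lambda>x. ennreal (trans_prob adj \<mu> n x y / mu y))"
  proof (induction n)
    case 0
    show ?case by (intro ext) (simp add: delta_eq indicator_def)
  next
    case (Suc n)
    show ?case
      by (intro ext) (simp add: Suc kop_P trans_prob_nonneg mu_pos)
  qed
  then show ?thesis by (simp add: kpow_def heat_kernel_def)
qed

lemma sym_kernel_P: "sym_kernel P 1"
  unfolding sym_kernel_def
proof (intro conjI allI)
  fix x y
  show "P x y = P y x" using edge_weight(2)[of x y] by (simp add: P_def mult.commute)
  have "(\<Sum>z | adj x z. step_prob adj \<mu> x z) = 1"
    using mu_pos[of x] by (simp add: step_prob_def sum_divide_distrib[symmetric] vmass_def)
  then show "kop P (\<lambda>_. 1) x = 1" using kop_P[of 1 "\<lambda>_. 1" x] by simp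
qed

lemma r_pos: "r j > 0" by simp

lemma r_Suc: "r j \<le> r (Suc j)" "r (Suc j) \<le> 2 * r j"
proof -
  have "r (Suc j) = 2 powr (1 / \<gamma>) * r j" by (simp add: powr_add[symmetric] add_divide_distrib)
  then show "r j \<le> r (Suc j)" "r (Suc j) \<le> 2 * r j"
    using two_powr_root_bounds[OF \<gamma>] r_pos[of j] by (auto intro!: mult_right_mono)
qed

lemma r_powr: "r j powr \<gamma> = 2 ^ j"
  using \<gamma> by (simp add: powr_powr powr_realpow)

lemma powr_root_eq: "real (2 ^ j) powr (1 / \<gamma>) = r j"
proof -
  have "real (2 ^ j) = 2 powr real j" by (simp add: powr_realpow)
  then show ?thesis by (simp only: powr_powr) simp
qed

sublocale volume_seq a B C \<rho> v CV
proof
  fix j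
  show "v j > 0" by (simp add: V_pos)
  show "v j \<le> v (Suc j)" using r_Suc by (intro V_mono) auto
  have "v (Suc j) \<le> V (2 * r j)" using r_Suc r_pos by (intro V_mono) auto
  also have "\<dots> \<le> CV * v j" by (rule V_doubling) simp
  finally show "v (Suc j) \<le> CV * v j" .
qed

section \<open>Two-sided subordination bounds for the jump kernel\<close>

lemma phi_scale:
  assumes "r j \<le> t" "t \<le> r (Suc j)"
  shows "\<phi> t \<le> B / a j" "1 / a j \<le> B * \<phi> t"
proof -
  have "t / r j \<in> {1..2}" using assms r_Suc(2)[of j] by (simp add: field_simps)
  from phi_bound[OF this, of "r j"] show "\<phi> t \<le> B / a j" "1 / a j \<le> B * \<phi> t" by auto
qed

lemma heat_kernel_le:
  "n \<ge> 1 \<Longrightarrow> heat_kernel adj \<mu> n x y \<le> CU / V (real n powr (1 / \<gamma>))"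
proof -
  assume n: "n \<ge> 1"
  have "CU / V (real n powr (1 / \<gamma>)) *
      exp (- ((real (gdist adj x y) powr \<gamma> / (CU * real n)) powr (1 / (\<gamma> - 1)))) \<le> CU / V (real n powr (1 / \<gamma>)) * 1"
    using CU(1) V_pos[of "real n powr (1 / \<gamma>)"] by (intro mult_left_mono) (auto simp: less_imp_le)
  with CU(2)[OF n, of x y] show ?thesis by simp
qed

lemma heat_kernel_dyadic_le: "heat_kernel adj \<mu> (2 * 2 ^ i) x y \<le> CU / v i"
proof -
  have "heat_kernel adj \<mu> (2 ^ Suc i) x y \<le> CU / v (Suc i)"
    using heat_kernel_le[of "2 ^ Suc i" x y] unfolding powr_root_eq by simp
  also have "\<dots> \<le> CU / v i" using CU(1) v_pos[of i] v_mono[of i] by (intro divide_left_mono) auto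
  finally show ?thesis by simp
qed

lemma heat_kernel_exp_le:
  assumes "r j \<le> real (gdist adj x y)"
  shows "heat_kernel adj \<mu> (2 * 2 ^ i) x y
    \<le> CU / v i * exp (- (((2 ^ j / 2 ^ i) / (2 * CU)) powr (1 / (\<gamma> - 1))))"
proof -
  have d: "2 ^ j \<le> real (gdist adj x y) powr \<gamma>"
    unfolding r_powr[symmetric] using assms \<gamma> by (intro powr_mono2) auto
  have "(2 ^ j / 2 ^ i) / (2 * CU) = 2 ^ j / (CU * real (2 ^ Suc i))" by simp
  also have "\<dots> \<le> real (gdist adj x y) powr \<gamma> / (CU * real (2 ^ Suc i))"
    using d CU(1) by (intro divide_right_mono) auto
  finally have "((2 ^ j / 2 ^ i) / (2 * CU)) powr (1 / (\<gamma> - 1))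
      \<le> (real (gdist adj x y) powr \<gamma> / (CU * real (2 ^ Suc i))) powr (1 / (\<gamma> - 1))"
    using \<gamma> CU(1) by (intro powr_mono2) auto
  moreover have "CU / v (Suc i) \<le> CU / v i"
    using CU(1) v_pos[of i] v_mono[of i] by (intro divide_left_mono) auto
  moreover have "heat_kernel adj \<mu> (2 ^ Suc i) x y \<le> CU / v (Suc i)
      * exp (- ((real (gdist adj x y) powr \<gamma> / (CU * real (2 ^ Suc i))) powr (1 / (\<gamma> - 1))))"
    using CU(2)[of "2 ^ Suc i" x y] unfolding powr_root_eq by simp
  ultimately have "heat_kernel adj \<mu> (2 ^ Suc i) x y \<le> CU / v i * exp (- (((2 ^ j / 2 ^ i) / (2 * CU)) powr (1 / (\<gamma> - 1))))"
    using CU(1) v_pos[of i] by (elim order.trans) (intro mult_mono, auto simp: less_imp_le)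
  then show ?thesis by simp
qed

text \<open>The scale \<open>j\<close> is that of \<open>d(x,y)\<close>: for \<open>i < j\<close> the exponential in (UE) beats all the geometric
  losses, for \<open>i \<ge> j\<close> the decay of \<open>a\<close> suffices.\<close>

lemma subordination_upper:
  "\<exists>T>0. \<forall>x y. \<exists>j. \<forall>i. a i * heat_kernel adj \<mu> (2 * 2 ^ i) x y \<le> T * \<rho> ^ nat \<bar>int i - int j\<bar> * k x y"
proof -
  define \<kappa> where "\<kappa> = 1 / (\<gamma> - 1)"
  define \<theta> where "\<theta> = 2 powr \<kappa>"
  define \<eta> where "\<eta> = (1 / (2 * CU)) powr \<kappa>"
  have \<kappa>: "\<kappa> > 0" using \<gamma> by (simp add: \<kappa>_def)
  have \<theta>: "\<theta> > 1" using powr_less_mono[of 0 \<kappa> 2] \<kappa> by (simp add: \<theta>_def)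
  have \<eta>: "\<eta> > 0" using CU(1) by (simp add: \<eta>_def)
  have rho0: "\<rho> > 0" using rho by simp
  \<comment> \<open>For i = j - l, each scale costs B from \<open>a\<close>, CV from the volume and
    1 / \<rho> for the decay to be displayed; the exponential in (UE) pays for all three.\<close>
  obtain T where T: "T > 0" "\<And>l :: nat. (B * CV / \<rho>) ^ l * exp (- (\<eta> * \<theta> ^ l)) \<le> T"
    using power_times_exp_bounded[of "B * CV / \<rho>" \<theta> \<eta>] \<theta> \<eta> B_ge D_pos rho0 by (auto simp: zero_less_mult_iff)
  have phi0: "\<phi> 0 \<ge> 1" by (simp add: phi_ge1)
  have V0: "V 0 > 0" by (simp add: V_pos)
  \<comment> \<open>Distance 0 lies on no dyadic scale and is treated separately, with the decay
    centred at scale 0.\<close>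
  define T0 where "T0 = CU * C * a 0 * (CJ * V 0 * \<phi> 0) / v 0"
  define T1 where "T1 = CU * max C T * (CJ * CV * B)"
  have T01: "T0 \<ge> 0" "T1 > 0"
    using CU(1) C_ge a_pos[of 0] CJ(1) V0 phi0 v_pos[of 0] D_pos B_ge by (auto simp: T0_def T1_def less_max_iff_disj less_imp_le)
  have "\<exists>j. \<forall>i. a i * heat_kernel adj \<mu> (2 * 2 ^ i) x y \<le> max T0 T1 * \<rho> ^ nat \<bar>int i - int j\<bar> * k x y" for x y
  proof (cases "gdist adj x y = 0")
    case True
    have kl: "1 \<le> (CJ * V 0 * \<phi> 0) * k x y"
      using CJ(1) CJ(2)[of x y] True V0 phi0 by (simp add: field_simps)
    have "a i * heat_kernel adj \<mu> (2 * 2 ^ i) x y \<le> max T0 T1 * \<rho> ^ nat \<bar>int i - int 0\<bar> * k x y" for i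
    proof -
      have "a i * heat_kernel adj \<mu> (2 * 2 ^ i) x y \<le> (C * \<rho> ^ i * a 0) * (CU / v 0)"
      proof (rule mult_mono)
        show "a i \<le> C * \<rho> ^ i * a 0" using a_decay[of 0 i] by simp
        have "CU / v i \<le> CU / v 0" using CU(1) v_pos[of 0] v_pos[of i] v_mono'[of 0 i] by (intro divide_left_mono mult_pos_pos) auto
        then show "heat_kernel adj \<mu> (2 * 2 ^ i) x y \<le> CU / v 0" using heat_kernel_dyadic_le[of i x y] by linarith
      qed (use C_ge rho a_pos[of 0] heat_kernel_nonneg in \<open>auto simp: less_imp_le\<close>)
      also have "\<dots> = (C * \<rho> ^ i * a 0) * (CU / v 0) * 1" by simp
      also have "\<dots> \<le> (C * \<rho> ^ i * a 0) * (CU / v 0) * ((CJ * V 0 * \<phi> 0) * k x y)"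
        using kl C_ge rho a_pos[of 0] CU(1) v_pos[of 0] by (intro mult_left_mono) (auto simp: less_imp_le)
      also have "\<dots> = T0 * \<rho> ^ i * k x y" by (simp add: T0_def)
      also have "\<dots> \<le> max T0 T1 * \<rho> ^ i * k x y"
        using k_nonneg rho by (intro mult_right_mono) auto
      finally show ?thesis by simp
    qed
    then show ?thesis by blast
  next
    case False
    define d where "d = real (gdist adj x y)"
    have "d \<ge> 1" using False by (simp add: d_def)
    then obtain j where j: "r j \<le> d" "d \<le> r (Suc j)" using dyadic_scale[OF \<gamma>] by blast
    have kl: "a j / v j \<le> (CJ * CV * B) * k x y"
    proof -
      have "V d \<le> CV * v j" using V_mono[of d "r (Suc j)"] j v_doubling[of j] \<open>d \<ge> 1\<close> by linarith
      then have "V d * \<phi> d \<le> (CV * v j) * (B / a j)"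
        using phi_scale(1)[OF j] V_pos[of d] phi_ge1[of d] \<open>d \<ge> 1\<close> by (intro mult_mono) auto
      then have "(1 / CJ) / ((CV * v j) * (B / a j)) \<le> (1 / CJ) / (V d * \<phi> d)"
        using CJ(1) V_pos[of d] phi_ge1[of d] \<open>d \<ge> 1\<close> D_pos v_pos[of j] B_ge a_pos[of j]
        by (intro divide_left_mono mult_pos_pos divide_pos_pos) auto
      also have "\<dots> \<le> k x y" using CJ(2)[of x y] by (simp add: d_def)
      finally show ?thesis using CJ(1) D_pos v_pos[of j] B_ge a_pos[of j] by (simp add: field_simps)
    qed
    have "a i * heat_kernel adj \<mu> (2 * 2 ^ i) x y \<le> max T0 T1 * \<rho> ^ nat \<bar>int i - int j\<bar> * k x y" for i
    proof -
      define l where "l = nat \<bar>int i - int j\<bar>"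
      have "a i * heat_kernel adj \<mu> (2 * 2 ^ i) x y \<le> CU * max C T * \<rho> ^ l * (a j / v j)"
      proof (cases "j \<le> i")
        case True
        then have i: "i = j + l" by (simp add: l_def)
        have "a i * heat_kernel adj \<mu> (2 * 2 ^ i) x y \<le> (C * \<rho> ^ l * a j) * (CU / v j)"
        proof (rule mult_mono)
          show "a i \<le> C * \<rho> ^ l * a j" using a_decay[of j l] by (simp add: i)
          have "CU / v i \<le> CU / v j" using CU(1) v_pos v_mono'[OF True] by (intro divide_left_mono mult_pos_pos) auto
          then show "heat_kernel adj \<mu> (2 * 2 ^ i) x y \<le> CU / v j" using heat_kernel_dyadic_le[of i x y] by linarith
        qed (use C_ge rho a_pos[of j] heat_kernel_nonneg in \<open>auto simp: less_imp_le\<close>)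
        also have "\<dots> = C * (CU * \<rho> ^ l * (a j / v j))" by simp
        also have "\<dots> \<le> max C T * (CU * \<rho> ^ l * (a j / v j))"
          using CU(1) rho a_pos[of j] v_pos[of j] by (intro mult_right_mono) (auto simp: less_imp_le)
        finally show ?thesis by (simp add: ac_simps)
      next
        case False
        then have jl: "j = i + l" by (simp add: l_def)
        have ex: "((2 ^ j / 2 ^ i) / (2 * CU)) powr \<kappa> = \<eta> * \<theta> ^ l"
        proof -
          have "(2 ^ j / 2 ^ i) / (2 * CU) = 2 powr real l * (1 / (2 * CU))"
            by (simp add: jl power_add powr_realpow)
          then have "((2 ^ j / 2 ^ i) / (2 * CU)) powr \<kappa> = (2 powr real l) powr \<kappa> * \<eta>"
            unfolding \<eta>_def by (simp only: powr_mult)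
          moreover have "(2 powr real l) powr \<kappa> = \<theta> powr real l"
            by (simp only: \<theta>_def powr_powr mult.commute)
          ultimately show ?thesis using \<theta> by (simp add: powr_realpow)
        qed
        have "a i * heat_kernel adj \<mu> (2 * 2 ^ i) x y
          \<le> (B ^ l * a j) * (CU * (CV ^ l / v j) * exp (- (\<eta> * \<theta> ^ l)))"
        proof (rule mult_mono)
          show "a i \<le> B ^ l * a j" using a_down_pow[of i l] by (simp add: jl)
          have "1 / v i \<le> CV ^ l / v j"
            using v_doubling_pow[of i l] v_pos[of i] v_pos[of j] by (simp add: jl field_simps)
          then have "CU * (1 / v i) * exp (- (\<eta> * \<theta> ^ l)) \<le> CU * (CV ^ l / v j) * exp (- (\<eta> * \<theta> ^ l))"
            using CU(1) by (intro mult_right_mono mult_left_mono) auto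
          moreover have "heat_kernel adj \<mu> (2 * 2 ^ i) x y \<le> CU * (1 / v i) * exp (- (\<eta> * \<theta> ^ l))"
            using heat_kernel_exp_le[of j x y i] j(1) ex by (simp add: d_def \<kappa>_def)
          ultimately show "heat_kernel adj \<mu> (2 * 2 ^ i) x y \<le> CU * (CV ^ l / v j) * exp (- (\<eta> * \<theta> ^ l))"
            by linarith
        qed (use B_ge a_pos[of j] heat_kernel_nonneg in \<open>auto simp: less_imp_le\<close>)
        also have "\<dots> = ((B * CV / \<rho>) ^ l * exp (- (\<eta> * \<theta> ^ l))) * (CU * \<rho> ^ l * (a j / v j))"
          using rho0 by (simp add: power_mult_distrib power_divide)
        also have "\<dots> \<le> max C T * (CU * \<rho> ^ l * (a j / v j))"
          using CU(1) rho a_pos[of j] v_pos[of j] T(2)[of l] by (intro mult_right_mono) (auto simp: less_imp_le le_max_iff_disj)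
        finally show ?thesis by (simp add: ac_simps)
      qed
      also have "\<dots> \<le> CU * max C T * \<rho> ^ l * ((CJ * CV * B) * k x y)"
        using kl CU(1) C_ge rho by (intro mult_left_mono) (auto simp: le_max_iff_disj)
      also have "\<dots> = T1 * \<rho> ^ l * k x y" by (simp add: T1_def)
      also have "\<dots> \<le> max T0 T1 * \<rho> ^ l * k x y"
        using k_nonneg rho by (intro mult_right_mono) auto
      finally show ?thesis by (simp add: l_def)
    qed
    then show ?thesis by blast
  qed
  then show ?thesis using T01 by (intro exI[of _ "max T0 T1"]) (auto simp: less_max_iff_disj)
qed

text \<open>A single time suffices, since (LE) loses only a constant when n is comparable to
  d^\<gamma>. For d at scale j that time is 2^(j+1), as d^\<gamma> may exceed 2^j; the exponential
  is then at least \<open>q\<close>.\<close>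

lemma subordination_lower:
  "\<exists>T>0. \<forall>x y. \<exists>i. k x y \<le> T * a i * (heat_kernel adj \<mu> (2 ^ i) x y + heat_kernel adj \<mu> (2 ^ i + 1) x y)"
proof -
  define q where "q = exp (- ((1 / cL) powr (1 / (\<gamma> - 1))))"
  have q: "q > 0" by (simp add: q_def)
  have phi0: "\<phi> 0 \<ge> 1" by (simp add: phi_ge1)
  have V0: "V 0 > 0" by (simp add: V_pos)
  define T0 where "T0 = CJ / (V 0 * \<phi> 0) * v 0 / (cL * a 0)"
  define T1 where "T1 = CJ * B\<^sup>2 * CV / (cL * q)"
  have T1: "T1 > 0" using CJ(1) B_ge D_pos cL(1) q by (simp add: T1_def)
  have "\<exists>i. k x y \<le> max T0 T1 * a i * (heat_kernel adj \<mu> (2 ^ i) x y + heat_kernel adj \<mu> (2 ^ i + 1) x y)" for x y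
  proof -
    define h where "h i = heat_kernel adj \<mu> (2 ^ i) x y + heat_kernel adj \<mu> (2 ^ i + 1) x y" for i
    have h0: "h i \<ge> 0" for i using heat_kernel_nonneg by (simp add: h_def)
    have "\<exists>i. k x y \<le> max T0 T1 * a i * h i"
    proof (cases "gdist adj x y = 0")
      case True
      have "cL / v 0 \<le> h 0" using cL(2)[of x y 1] True by (simp add: h_def numeral_2_eq_2)
      have "k x y \<le> CJ / (V 0 * \<phi> 0)" using CJ(3)[of x y] True by simp
      also have "\<dots> = T0 * a 0 * (cL / v 0)" using cL(1) a_pos[of 0] v_pos[of 0] by (simp add: T0_def)
      also have "\<dots> \<le> max T0 T1 * a 0 * h 0"
        using \<open>cL / v 0 \<le> h 0\<close> a_pos[of 0] v_pos[of 0] cL(1) T1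
        by (intro mult_mono) (auto simp: less_imp_le le_max_iff_disj)
      finally show ?thesis by blast
    next
      case False
      define d where "d = real (gdist adj x y)"
      have d1: "d \<ge> 1" using False by (simp add: d_def)
      then obtain j where j: "r j \<le> d" "d \<le> r (Suc j)" using dyadic_scale[OF \<gamma>] by blast
      have dg: "d powr \<gamma> \<le> 2 ^ Suc j"
        unfolding r_powr[symmetric] using j d1 \<gamma> by (intro powr_mono2) auto
      \<comment> \<open>As \<gamma> > 1, d \<le> d^\<gamma>, so the chosen time satisfies the
        restriction n \<ge> d of (LE).\<close>
      moreover have "d powr 1 \<le> d powr \<gamma>" using d1 \<gamma> by (intro powr_mono) auto
      ultimately have "d \<le> real (2 ^ Suc j)" using d1 by simp
      then have n: "2 ^ Suc j \<ge> max 1 (gdist adj x y)"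
        unfolding d_def of_nat_le_iff by simp
      have "cL / v (Suc j) * q \<le> h (Suc j)"
      proof -
        have "d powr \<gamma> / (cL * real (2 ^ Suc j)) \<le> 1 / cL"
          using dg cL(1) by (simp add: field_simps)
        then have "(d powr \<gamma> / (cL * real (2 ^ Suc j))) powr (1 / (\<gamma> - 1)) \<le> (1 / cL) powr (1 / (\<gamma> - 1))"
          using \<gamma> cL(1) by (intro powr_mono2) auto
        then have "cL / v (Suc j) * q \<le> cL / v (Suc j) * exp (- ((d powr \<gamma> / (cL * real (2 ^ Suc j))) powr (1 / (\<gamma> - 1))))"
          using cL(1) v_pos[of "Suc j"] by (intro mult_left_mono) (auto simp: q_def)
        then show ?thesis
          using cL(2)[OF n] unfolding powr_root_eq h_def d_def by simp
      qed
      have "V d * \<phi> d \<ge> v j * (1 / (B * a j))"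
        using V_mono[OF _ j(1)] phi_scale(2)[OF j] v_pos[of j] V_pos[of d] d1 B_ge a_pos[of j]
        by (intro mult_mono) (auto simp: field_simps)
      then have "CJ / (V d * \<phi> d) \<le> CJ / (v j * (1 / (B * a j)))"
        using CJ(1) v_pos[of j] B_ge a_pos[of j] V_pos[of d] phi_ge1[of d] d1
        by (intro divide_left_mono mult_pos_pos divide_pos_pos) auto
      then have "k x y \<le> CJ / (v j * (1 / (B * a j)))" using CJ(3)[of x y] by (simp add: d_def)
      also have "\<dots> = CJ * B * a j / v j" by simp
      also have "\<dots> \<le> CJ * B * (B * a (Suc j)) * (CV / v (Suc j))"
      proof -
        have "a j * (1 / v j) \<le> (B * a (Suc j)) * (CV / v (Suc j))"
          using a_down[of j] v_doubling[of j] v_pos[of j] v_pos[of "Suc j"] a_pos[of j] B_ge a_pos[of "Suc j"]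
          by (intro mult_mono) (auto simp: field_simps)
        then have "CJ * B * (a j * (1 / v j)) \<le> CJ * B * ((B * a (Suc j)) * (CV / v (Suc j)))"
          using CJ(1) B_ge by (intro mult_left_mono) auto
        then show ?thesis by simp
      qed
      also have "\<dots> = T1 * a (Suc j) * (cL / v (Suc j) * q)"
        using cL(1) q by (simp add: T1_def power2_eq_square)
      also have "\<dots> \<le> max T0 T1 * a (Suc j) * h (Suc j)"
        using \<open>cL / v (Suc j) * q \<le> h (Suc j)\<close> a_pos[of "Suc j"] T1 v_pos[of "Suc j"] cL(1) q
        by (intro mult_mono) (auto simp: less_imp_le le_max_iff_disj)
      finally show ?thesis by blast
    qed
    then show ?thesis by (simp add: h_def)
  qed
  then show ?thesis using T1 by (intro exI[of _ "max T0 T1"]) (auto simp: less_max_iff_disj)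
qed

lemma gdist_self: "gdist adj x x = 0"
  unfolding gdist_def by (rule Least_eq_0) simp

lemma kernel_comparison_exists: "\<exists>Q. kernel_comparison m a B C \<rho> v CV K P Q"
proof -
  obtain T1 where T1: "T1 > 0"
    "\<And>x y. \<exists>j. \<forall>i. a i * heat_kernel adj \<mu> (2 * 2 ^ i) x y \<le> T1 * \<rho> ^ nat \<bar>int i - int j\<bar> * k x y"
    using subordination_upper by blast
  obtain T2 where T2: "T2 > 0"
    "\<And>x y. \<exists>i. k x y \<le> T2 * a i * (heat_kernel adj \<mu> (2 ^ i) x y + heat_kernel adj \<mu> (2 ^ i + 1) x y)"
    using subordination_lower by blast
  have phi0: "\<phi> 0 \<ge> 1" by (simp add: phi_ge1)
  have V0: "V 0 > 0" by (simp add: V_pos)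
  \<comment> \<open>\<open>Q1\<close> is T1 times the mass of a two-sided geometric series;
    \<open>Q2\<close> pays for two doublings, because 4 * 2^N = 2^(N+2) puts (LE) at scale N + 2;
    \<open>Q3\<close> bounds the inverse of k(x,x) m(x). Their sum with the other constants
    dominates each of them.\<close>
  define Q1 where "Q1 = T1 * (2 / (1 - \<rho>))"
  define Q2 where "Q2 = CV\<^sup>2 / cL"
  define Q3 where "Q3 = CJ * V 0 * \<phi> 0 * cm"
  define Q where "Q = cm + Q1 + T2 + CU + Q2 + Q3"
  have pos: "Q1 > 0" "Q2 > 0" "Q3 > 0"
    using T1(1) rho D_pos cL(1) CJ(1) V0 phi0 cm by (auto simp: Q1_def Q2_def Q3_def)
  have Q: "Q \<ge> 1" "cm \<le> Q" "Q1 \<le> Q" "T2 \<le> Q" "CU \<le> Q" "Q2 \<le> Q" "Q3 \<le> Q"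
    using pos cm T2(1) CU(1) by (auto simp: Q_def)
  have "kernel_comparison m a B C \<rho> v CV K P Q"
  proof
    show "sym_kernel K 1" by (rule sym_kernel_K)
    show "sym_kernel P 1" by (rule sym_kernel_P)
    show "Q \<ge> 1" by (rule Q(1))
    fix x
    have "1 / mu x \<le> cm" using mass(1)[of x] mu_pos[of x] cm by (simp add: field_simps)
    then show "1 / m x \<le> ennreal Q"
      using divide_ennreal[of 1 "mu x"] mu_pos[of x] Q(2) by (simp add: m_def ennreal_leI)
    have "1 / Q \<le> 1 / Q3" using Q(1,7) pos by (intro divide_left_mono) auto
    also have "\<dots> = (1 / CJ) / (V 0 * \<phi> 0) * (1 / cm)" by (simp add: Q3_def)
    also have "\<dots> \<le> k x x * mu x"
      using CJ(2)[of x x] mass(1)[of x] CJ(1) V0 phi0 cm k_nonneg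
      by (intro mult_mono) (auto simp: gdist_self)
    finally show "ennreal (1 / Q) \<le> K x x * m x"
      using k_nonneg mu_pos by (simp add: K_def m_def ennreal_mult[symmetric] less_imp_le ennreal_leI)
    fix N
    have n: "max 1 (gdist adj x x) \<le> 2 ^ (N + 2)" by (simp add: gdist_self)
    have "1 / (Q * v N) \<le> 1 / (Q2 * v N)"
      using Q(1,6) pos v_pos[of N] by (intro divide_left_mono mult_right_mono) auto
    also have "\<dots> = cL / (CV\<^sup>2 * v N)" by (simp add: Q2_def)
    also have "\<dots> \<le> cL / v (N + 2)"
      using v_doubling_pow[of N 2] cL(1) v_pos[of N] v_pos[of "N + 2"] D_pos
      by (intro divide_left_mono mult_pos_pos) auto
    also have "\<dots> \<le> heat_kernel adj \<mu> (2 ^ (N + 2)) x x + heat_kernel adj \<mu> (Suc (2 ^ (N + 2))) x x"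
      using cL(2)[OF n] unfolding powr_root_eq by (simp add: gdist_self)
    finally show "ennreal (1 / (Q * v N)) \<le> kpow P (4 * 2 ^ N) x x + kpow P (4 * 2 ^ N + 1) x x"
      using heat_kernel_nonneg by (simp add: kpow_P ennreal_plus[symmetric] ennreal_leI power_add mult.commute del: ennreal_plus)
    fix y
    have "heat_kernel adj \<mu> (2 * 2 ^ N) x y \<le> CU / v N" by (rule heat_kernel_dyadic_le)
    also have "\<dots> \<le> Q / v N" using Q(5) v_pos[of N] by (intro divide_right_mono) auto
    finally show "kpow P (2 * 2 ^ N) x y \<le> ennreal (Q / v N)" by (simp add: kpow_P ennreal_leI)
    obtain j where j: "\<And>i. a i * heat_kernel adj \<mu> (2 * 2 ^ i) x y \<le> T1 * \<rho> ^ nat \<bar>int i - int j\<bar> * k x y"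
      using T1(2) by blast
    have rho0: "\<rho> > 0" "\<rho> < 1" using rho by auto
    define z where "z i = T1 * k x y / Q * \<rho> ^ nat \<bar>int i - int j\<bar>" for i
    have zs: "summable z" unfolding z_def by (intro summable_mult suminf_geometric_two_sided rho0)
    have z0: "z i \<ge> 0" for i using T1(1) k_nonneg Q(1) rho by (simp add: z_def)
    have "(\<Sum>i. ennreal (a i / Q) * kpow P (2 * 2 ^ i) x y) \<le> (\<Sum>i. ennreal (z i))"
    proof (intro suminf_le summableI)
      fix i
      have "a i / Q * heat_kernel adj \<mu> (2 * 2 ^ i) x y \<le> z i"
        using divide_right_mono[OF j[of i], of Q] Q(1) by (simp add: z_def ac_simps)
      then have "ennreal (a i / Q * heat_kernel adj \<mu> (2 * 2 ^ i) x y) \<le> ennreal (z i)" by (rule ennreal_leI)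
      then show "ennreal (a i / Q) * kpow P (2 * 2 ^ i) x y \<le> ennreal (z i)"
        using a_pos[of i] Q(1) heat_kernel_nonneg unfolding kpow_P
        by (subst ennreal_mult[symmetric]) (auto simp: less_imp_le)
    qed
    also have "\<dots> = ennreal (suminf z)" using z0 zs by (intro suminf_ennreal2) auto
    also have "\<dots> \<le> ennreal (k x y)"
    proof (rule ennreal_leI)
      have "suminf z = T1 * k x y / Q * (\<Sum>i. \<rho> ^ nat \<bar>int i - int j\<bar>)"
        unfolding z_def by (intro suminf_mult suminf_geometric_two_sided rho0)
      also have "\<dots> \<le> T1 * k x y / Q * (2 / (1 - \<rho>))"
        using T1(1) k_nonneg Q(1) by (intro mult_left_mono suminf_geometric_two_sided rho0) auto
      also have "\<dots> = (Q1 / Q) * k x y" by (simp add: Q1_def ac_simps)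
      also have "\<dots> \<le> 1 * k x y" using Q(1,3) k_nonneg by (intro mult_right_mono) auto
      finally show "suminf z \<le> k x y" by simp
    qed
    finally show "(\<Sum>i. ennreal (a i / Q) * kpow P (2 * 2 ^ i) x y) \<le> K x y" by (simp add: K_def)
    obtain i where i: "k x y \<le> T2 * a i * (heat_kernel adj \<mu> (2 ^ i) x y + heat_kernel adj \<mu> (2 ^ i + 1) x y)"
      using T2(2) by blast
    also have "\<dots> \<le> Q * a i * (heat_kernel adj \<mu> (2 ^ i) x y + heat_kernel adj \<mu> (2 ^ i + 1) x y)"
      using Q(4) a_pos[of i] heat_kernel_nonneg by (intro mult_right_mono) (auto simp: less_imp_le)
    finally have "K x y \<le> ennreal (Q * a i * (heat_kernel adj \<mu> (2 ^ i) x y + heat_kernel adj \<mu> (2 ^ i + 1) x y))"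
      unfolding K_def by (rule ennreal_leI)
    also have "\<dots> = ennreal (Q * a i) * (kpow P (2 ^ i) x y + kpow P (2 ^ i + 1) x y)"
      using Q(1) a_pos[of i] heat_kernel_nonneg unfolding kpow_P
      by (subst ennreal_mult) (auto simp: less_imp_le)
    also have "\<dots> \<le> (\<Sum>i. ennreal (Q * a i) * (kpow P (2 ^ i) x y + kpow P (2 ^ i + 1) x y))"
      using sum_le_suminf[of "\<lambda>i. ennreal (Q * a i) * (kpow P (2 ^ i) x y + kpow P (2 ^ i + 1) x y)" "{i}"]
      by simp
    finally show "K x y \<le> (\<Sum>i. ennreal (Q * a i) * (kpow P (2 ^ i) x y + kpow P (2 ^ i + 1) x y))" .
  qed
  then show ?thesis by blast
qed

text \<open>The diagonal values are bounded by Q, so the real supremum is a true one and bounds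
  uniform in x pass to it.\<close>

lemma psi_bounds:
  obtains A where "A > 0" "\<And>n. \<psi> mu k n \<le> A"
    "\<And>n N. A * W N \<le> real n \<Longrightarrow> \<psi> mu k n \<le> A / v N"
    "\<And>n N. A * real n \<le> W N \<Longrightarrow> 1 / (A * v N) \<le> \<psi> mu k n"
proof -
  obtain Q where "kernel_comparison m a B C \<rho> v CV K P Q"
    using kernel_comparison_exists by blast
  then interpret kernel_comparison m a B C \<rho> v CV K P Q .
  have nonneg: "0 \<le> kernel_power mu k n x y" for n x y
    using kernel_op_funpow_indicator_bounds[OF markov mu_pos, of n y x] mu_pos[of y]
    by (simp add: kernel_power_def less_imp_le)
  have u: "kernel_power mu k (2 * n) x x = u x n" for x n
    by (simp add: u_def corr_delta kpow_K nonneg)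
  have psi: "\<psi> mu k n = (SUP x. u x n)" for n by (simp add: \<psi>_def u)
  have bdd: "bdd_above (range (\<lambda>x. u x n))" for n
    by (rule bdd_aboveI2) (rule u_le)
  have psi_le: "\<psi> mu k n \<le> M" if "\<And>x. u x n \<le> M" for n M
    unfolding psi using that by (intro cSUP_least) auto
  have le_psi: "u x n \<le> \<psi> mu k n" for x n
    unfolding psi by (rule cSUP_upper[OF UNIV_I bdd])
  obtain A1 where A1: "A1 > 0" "\<And>x n N. A1 * W N \<le> real n \<Longrightarrow> u x n \<le> A1 / v N"
    using upper_bound by blast
  obtain A2 where A2: "A2 > 0"
    "\<And>n N M. A2 * real n \<le> W N \<Longrightarrow> (\<And>x. u x n \<le> M) \<Longrightarrow> 1 / (A2 * v N) \<le> M"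
    using lower_bound by blast
  define A where "A = max Q (max A1 A2)"
  have A: "A > 0" "Q \<le> A" "A1 \<le> A" "A2 \<le> A" using A1(1) by (auto simp: A_def less_max_iff_disj)
  show ?thesis
  proof (rule that[of A])
    show "A > 0" by (rule A)
    show "\<psi> mu k n \<le> A" for n using u_le A(2) by (intro psi_le) (rule order.trans)
    show "\<psi> mu k n \<le> A / v N" if n: "A * W N \<le> real n" for n N
    proof (rule psi_le)
      fix x
      have "A1 * W N \<le> A * W N" using A W_pos[of N] by (intro mult_right_mono) auto
      with n have "u x n \<le> A1 / v N" by (intro A1(2)) simp
      also have "\<dots> \<le> A / v N" using A v_pos[of N] by (intro divide_right_mono) auto
      finally show "u x n \<le> A / v N" .
    qed
    show "1 / (A * v N) \<le> \<psi> mu k n" if n: "A * real n \<le> W N" for n N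
    proof -
      have "A2 * real n \<le> A * real n" using A by (intro mult_right_mono) auto
      with n have "1 / (A2 * v N) \<le> \<psi> mu k n" by (intro A2(2)[of n N] le_psi) simp
      moreover have "1 / (A * v N) \<le> 1 / (A2 * v N)"
        using A A2(1) v_pos[of N] by (intro divide_left_mono mult_right_mono) auto
      ultimately show ?thesis by linarith
    qed
  qed
qed

end

section \<open>Transfer from dyadic scales to \<zeta>\<close>

theorem theorem1p1:
  fixes adj :: "'a \<Rightarrow> 'a \<Rightarrow> bool" and \<mu> :: "'a \<Rightarrow> 'a \<Rightarrow> real"
    and V \<phi> \<zeta> :: "real \<Rightarrow> real" and \<gamma> \<beta> :: real
    and k :: "'a \<Rightarrow> 'a \<Rightarrow> real"
  assumes "weighted_graph adj \<mu>"
    and "COUNT adj \<mu>"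
    and "\<forall>r\<ge>0. V r > 0" and "continuous_on {0..} V" and "strict_mono_on {0..} V"
    and "VD V"
    and "HOM adj \<mu> V"
    and "P0 adj \<mu>"
    and "\<gamma> > 1"
    and "UE adj \<mu> V \<gamma>"
    and "LE adj \<mu> V \<gamma>"
    and "\<forall>t\<ge>0. \<phi> t \<ge> 1" and "continuous_on {0..} \<phi>"
    and "\<beta> > 0" and "regularly_varying \<phi> \<beta>"
    and "markov_kernel (vmass adj \<mu>) k"
    and "J adj V \<phi> k"
    and "\<forall>t\<ge>0. \<zeta> t \<ge> 1" and "continuous_on {0..} \<zeta>" and "mono_on {0..} \<zeta>"
    and "asymptotic_inverse \<zeta>
           (\<lambda>t. t powr \<gamma> / integral {0..t} (\<lambda>s. s powr (\<gamma> - 1) / \<phi> s))"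
  shows "\<exists>C>0. \<forall>n :: nat.
           (1 / C) / V (\<zeta> (real n)) \<le> \<psi> (vmass adj \<mu>) k n \<and>
           \<psi> (vmass adj \<mu>) k n \<le> C / V (\<zeta> (real n))"
proof -
  obtain B where B: "B \<ge> 1"
    "\<And>l t. l \<in> {1..2} \<Longrightarrow> t \<ge> 0 \<Longrightarrow> \<phi> (l * t) \<le> B * \<phi> t \<and> \<phi> t \<le> B * \<phi> (l * t)"
    by (rule regularly_varying_locally_bounded[OF assms(12,13,15)]) blast
  obtain C \<rho> where seq: "scale_seq (\<lambda>j. 1 / \<phi> (2 powr (real j / \<gamma>))) B C \<rho>"
    using scale_seq_regularly_varying[OF assms(12,15,14,9) B] by blast
  obtain cm where cm: "cm \<ge> 1" "\<And>x. 1 / cm \<le> vmass adj \<mu> x \<and> vmass adj \<mu> x \<le> cm"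
    using assms(2) unfolding COUNT_def by blast
  obtain CV where CV: "\<And>s. s > 0 \<Longrightarrow> V (2 * s) \<le> CV * V s"
    using assms(6) unfolding VD_def by blast
  obtain CU where CU: "CU > 0" "\<And>x y n. n \<ge> 1 \<Longrightarrow> heat_kernel adj \<mu> n x y \<le> CU / V (real n powr (1 / \<gamma>))
      * exp (- ((real (gdist adj x y) powr \<gamma> / (CU * real n)) powr (1 / (\<gamma> - 1))))"
    using assms(10) unfolding UE_def by blast
  obtain cL where cL: "cL > 0" "\<And>x y n. n \<ge> max 1 (gdist adj x y) \<Longrightarrow>
      heat_kernel adj \<mu> n x y + heat_kernel adj \<mu> (Suc n) x y \<ge> cL / V (real n powr (1 / \<gamma>))
      * exp (- ((real (gdist adj x y) powr \<gamma> / (cL * real n)) powr (1 / (\<gamma> - 1))))"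
    using assms(11) unfolding LE_def by blast
  obtain CJ where CJ: "CJ > 0" "\<And>x y.
      (1 / CJ) / (V (real (gdist adj x y)) * \<phi> (real (gdist adj x y))) \<le> k x y \<and>
      k x y \<le> CJ / (V (real (gdist adj x y)) * \<phi> (real (gdist adj x y)))"
    using assms(17) unfolding J_def by blast
  have V_mono: "V s \<le> V t" if "0 \<le> s" "s \<le> t" for s t
    using strict_mono_on_leD[OF assms(5), of s t] that by simp
  interpret jump_walk \<phi> \<gamma> B C \<rho> adj \<mu> k V cm CV CJ CU cL
    using seq assms(1,3,9,12,16) cm CV CU cL CJ B V_mono
    by (intro jump_walk.intro jump_walk_axioms.intro) auto
  obtain A where A: "A > 0" "\<And>n. \<psi> mu k n \<le> A"
    "\<And>n N. A * W N \<le> real n \<Longrightarrow> \<psi> mu k n \<le> A / v N"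
    "\<And>n N. A * real n \<le> W N \<Longrightarrow> 1 / (A * v N) \<le> \<psi> mu k n"
    by (rule psi_bounds) blast
  obtain E n0 where E: "E > 0" and n0: "\<And>n. n \<ge> n0 \<Longrightarrow> \<exists>j. r j \<le> \<zeta> (real n) \<and>
      \<zeta> (real n) \<le> r (Suc j) \<and> W j \<le> E * real n \<and> real n \<le> E * W j"
    using asymptotic_inverse_scale[OF assms(12,13,9) B(2) seq assms(18)
          assms(21)[unfolded asymptotic_inverse_def, THEN conjunct1]] by metis
  obtain M1 where M1: "\<And>N. (A * E) * W N \<le> W (N + M1)" using W_grow[of "A * E"] by blast
  \<comment> \<open>Taken at N = 0 this gives A * n0 \<le> W M3, one scale for the lower bound at
    all n < n0, including n = 0.\<close>
  obtain M3 where M3: "\<And>N. (A * real n0 / W 0) * W N \<le> W (N + M3)" using W_grow[of "A * real n0 / W 0"] by blast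
  have zeta: "\<zeta> (real n) \<ge> 1" for n using assms(18) by simp
  have Vz: "V (\<zeta> (real n)) > 0" for n using assms(3) order.trans[OF zero_le_one zeta[of n]] by blast
  have D1: "CV ^ i > 0" for i using D_pos by simp
  \<comment> \<open>The second entries of \<open>X\<close> and \<open>Y\<close> serve the initial
    range: j < M1 and n < n0 for \<open>X\<close>, where \<psi> \<le> A and monotonicity of V and
    \<zeta> suffice, and n < n0 for \<open>Y\<close>.\<close>
  define X where "X = max (A * CV ^ Suc M1) (A * v M1 + A * V (\<zeta> (real n0)))"
  define Y where "Y = max (A * CV ^ M1) (A * v M3 / v 0)"
  have X: "X > 0" using A(1) D_pos D1[of M1] by (simp add: X_def less_max_iff_disj)
  have upper: "V (\<zeta> (real n)) * \<psi> mu k n \<le> X" for n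
  proof (cases "n \<ge> n0")
    case True
    then obtain j where j: "\<zeta> (real n) \<le> r (Suc j)" "W j \<le> E * real n" using n0 by blast
    have Vj: "V (\<zeta> (real n)) \<le> v (Suc j)" using zeta[of n] j(1) by (intro V_mono) auto
    show ?thesis
    proof (cases "M1 \<le> j")
      case True
      \<comment> \<open>Going down M1 scales from j makes A * W N \<le> n. The cost is M1 doublings,
        plus one because \<zeta>(n) is only known to lie below \<open>r (Suc j)\<close>.\<close>
      define N where "N = j - M1"
      have jN: "j = N + M1" using True by (simp add: N_def)
      have "E * (A * W N) \<le> E * real n" using M1[of N] j(2) by (simp add: jN ac_simps)
      then have "\<psi> mu k n \<le> A / v N" using E by (intro A(3)) simp
      then have "V (\<zeta> (real n)) * \<psi> mu k n \<le> V (\<zeta> (real n)) * (A / v N)"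
        using Vz[of n] by (intro mult_left_mono) auto
      also have "\<dots> \<le> (CV ^ Suc M1 * v N) * (A / v N)"
        using Vj v_doubling_pow[of N "Suc M1"] A(1) v_pos[of N] by (intro mult_right_mono) (auto simp: jN)
      also have "\<dots> = A * CV ^ Suc M1" using v_pos[of N] by simp
      also have "\<dots> \<le> X" by (simp add: X_def)
      finally show ?thesis .
    next
      case False
      have "v (Suc j) \<le> v M1" using False by (intro v_mono') simp
      then have "V (\<zeta> (real n)) * \<psi> mu k n \<le> V (\<zeta> (real n)) * A"
        using A(2)[of n] Vz[of n] by (intro mult_left_mono) auto
      also have "\<dots> \<le> v M1 * A" using Vj \<open>v (Suc j) \<le> v M1\<close> A(1) by (intro mult_right_mono) auto
      also have "\<dots> \<le> X" using A(1) Vz[of n0] by (simp add: X_def mult.commute le_max_iff_disj)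
      finally show ?thesis .
    qed
  next
    case False
    have "\<zeta> (real n) \<le> \<zeta> (real n0)" using assms(20) False by (intro mono_onD[of "{0..}" \<zeta>]) auto
    then have "V (\<zeta> (real n)) \<le> V (\<zeta> (real n0))" using zeta[of n] by (intro V_mono) auto
    have "V (\<zeta> (real n)) * \<psi> mu k n \<le> V (\<zeta> (real n)) * A"
      using A(2)[of n] Vz[of n] by (intro mult_left_mono) auto
    also have "\<dots> \<le> V (\<zeta> (real n0)) * A" using \<open>V (\<zeta> (real n)) \<le> V (\<zeta> (real n0))\<close> A(1) by (intro mult_right_mono) auto
    also have "\<dots> \<le> X" using A(1) v_pos[of M1] by (simp add: X_def mult.commute le_max_iff_disj)
    finally show ?thesis .
  qed
  have lower: "1 / Y \<le> V (\<zeta> (real n)) * \<psi> mu k n" for n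
  proof (cases "n \<ge> n0")
    case True
    then obtain j where j: "r j \<le> \<zeta> (real n)" "real n \<le> E * W j" using n0 by blast
    \<comment> \<open>The lower bound goes up M1 scales instead, to reach A * n \<le> W (j + M1), at
      the cost of CV^M1.\<close>
    have "A * real n \<le> A * (E * W j)" using A(1) j(2) by (intro mult_left_mono) auto
    also have "\<dots> \<le> W (j + M1)" using M1[of j] by simp
    finally have "1 / (A * v (j + M1)) \<le> \<psi> mu k n" by (rule A(4))
    then have 1: "v j * (1 / (A * v (j + M1))) \<le> V (\<zeta> (real n)) * \<psi> mu k n"
      using V_mono[OF _ j(1)] v_pos[of j] A(1) v_pos[of "j + M1"] Vz[of n] by (intro mult_mono) (auto simp: less_imp_le)
    have "1 / Y \<le> 1 / (A * CV ^ M1)" using A(1) D1[of M1] by (intro divide_left_mono) (auto simp: Y_def less_max_iff_disj)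
    also have "\<dots> \<le> v j * (1 / (A * v (j + M1)))"
      using v_doubling_pow[of j M1] A(1) D1[of M1] v_pos[of j] v_pos[of "j + M1"] by (simp add: field_simps)
    finally show ?thesis using 1 by linarith
  next
    case False
    have "A * real n \<le> A * real n0" using False A(1) by (intro mult_left_mono) auto
    also have "\<dots> \<le> W M3" using M3[of 0] W_pos[of 0] by simp
    finally have "1 / (A * v M3) \<le> \<psi> mu k n" by (rule A(4))
    moreover have "v 0 \<le> V (\<zeta> (real n))" using zeta[of n] by (intro V_mono) auto
    ultimately have 1: "v 0 * (1 / (A * v M3)) \<le> V (\<zeta> (real n)) * \<psi> mu k n"
      using v_pos[of 0] A(1) v_pos[of M3] Vz[of n] by (intro mult_mono) (auto simp: less_imp_le)
    have "1 / Y \<le> 1 / (A * v M3 / v 0)"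
      using A(1) v_pos[of 0] v_pos[of M3] by (intro divide_left_mono) (auto simp: Y_def less_max_iff_disj)
    then show ?thesis using 1 by simp
  qed
  have Y: "Y > 0" using A(1) D1[of M1] by (simp add: Y_def less_max_iff_disj)
  show ?thesis
  proof (intro exI[of _ "max X Y"] conjI allI)
    show "max X Y > 0" using X by simp
    fix n
    have "1 / max X Y \<le> 1 / Y" using X Y by (intro divide_left_mono) (auto simp: less_max_iff_disj)
    with lower[of n] have "1 / max X Y \<le> \<psi> mu k n * V (\<zeta> (real n))" by (simp add: mult.commute)
    then show "1 / max X Y / V (\<zeta> (real n)) \<le> \<psi> mu k n"
      using Vz[of n] by (subst pos_divide_le_eq)
    have "\<psi> mu k n * V (\<zeta> (real n)) \<le> max X Y" using upper[of n] by (simp add: mult.commute le_max_iff_disj)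
    then show "\<psi> mu k n \<le> max X Y / V (\<zeta> (real n))"
      using Vz[of n] by (subst pos_le_divide_eq)
  qed
qed

end
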